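(* Let $d\in\mathbb N$, let $(A_n)_{n\ge1}$, $(Y_n)_{n\ge0}$ and the autoregressive process $X$ and max-autoregressive process $M$ be as in the context. Assume that there is a primitive matrix $A\in[0,\infty)^{d\times d}$ with spectral radius $\varrho<1$ such that almost surely $A_n=A$ for all $n\ge1$. Let $y\in(0,\infty)$ be such that $P[\|Y_1\|\le y]>0$. Then the following three assertions are equivalent: (XR) the autoregressive process $X$ is recurrent; (MR) the max-autoregressive process $M$ is recurrent; (RC) $\displaystyle\sum_{n\ge0}\prod_{m=0}^{n}P\left[\|Y_1\|\le y\varrho^{-m}\right]=\infty$. Suppose in addition that the matrices $A_n$ are the mean offspring matrices of a branching process with immigration $Z$ as in the context, that there is a $\psi\in\Phi^d$ such that almost surely $\Psi_n=\psi$ for all $n\ge1$, and that $E[\xi_{0,1,1}^{i,j}\ln\xi_{0,1,1}^{i,j}]<\infty$ for all $i,j\in\{1,\dots,d\}$ (with $0\ln0:=0$). Then (XR), (MR) and (RC) are equivalent to (ZR) the branching process with immigration $Z$ is recurrent.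
   Context: Notation: $\mathbb N=\{1,2,\dots\}$, $\mathbb N_0=\mathbb N\cup\{0\}$. $\|\cdot\|$ is the $\ell_\infty$-norm on $\mathbb R^d$ and the associated matrix norm (maximum absolute row sum); $[x]_i$ is the $i$-th coordinate of a vector $x$. Maxima of vectors are taken coordinatewise. A matrix $A\in[0,\infty)^{d\times d}$ is primitive if $A^K\in(0,\infty)^{d\times d}$ for some $K\in\mathbb N$. Standing setting: $Y=(Y_n)_{n\ge0}$ is a sequence of $[0,\infty)^d$-valued random vectors and $(A_n)_{n\ge1}$ a sequence of $[0,\infty)^{d\times d}$-valued random matrices such that $(A_n,Y_n)_{n\ge1}$ is i.i.d. and independent of $Y_0$; the support of the law of $Y_1$ is unbounded. Autoregressive process: $X_0:=Y_0$, $X_n:=A_nX_{n-1}+Y_n$ for $n\ge1$. Max-autoregressive process: $M_0:=Y_0$, $M_n:=\max\{A_nM_{n-1},Y_n\}$ for $n\ge1$. Branching process with immigration in random environment: let $\Phi$ be the set of measurable functions $[0,1]\to\mathbb N_0^d$. Let $\Psi=(\Psi_n)_{n\ge1}=((\Psi_n^j)_{j=1,\dots,d})_{n\ge1}$ be an i.i.d. sequence of $\Phi^d$-valued random variables (the random environment) such that $(\Psi_n,Y_n)_{n\ge1}$ is i.i.d. and independent of $Y_0$. Let $(U_{m,n,k}^j)_{0\le m<n;\,k\ge1;\,1\le j\le d}$ be i.i.d. uniform on $[0,1]$, independent of $(\Psi,Y)$, and set $\xi_{m,n,k}^{i,j}:=[\Psi_n^j(U_{m,n,k}^j)]_i$.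 Let $\lfloor Y_m\rfloor$ be the vector of integer parts of the components of $Y_m$. For $m\ge0$ set $B_{m,m}:=\lfloor Y_m\rfloor$ and $$B_{m,n}:=\Big(\sum_{j=1}^d\sum_{k=1}^{[B_{m,n-1}]_j}\xi_{m,n,k}^{i,j}\Big)_{i=1,\dots,d},\qquad n\ge m+1.$$ Then $Z_n:=\sum_{m=0}^nB_{m,n}$, $n\ge0$. The associated mean offspring matrices are $A_n:=(E[\xi_{0,n,1}^{i,j}\mid\Psi])_{i,j=1,\dots,d}$, assumed to be $[0,\infty)^{d\times d}$-valued. Recurrence: each of $V\in\{X,M,Z\}$ is a Markov chain on $[0,\infty)^d$; it is called recurrent if there exists $b\in(0,\infty)$ such that $\sum_{n\ge0}P[\|V_n\|\le b]=\infty$ for the chain started at $0$ (i.e. with $Y_0$ replaced by $0$). (This property does not depend on the initial state.) *)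

theory Defs
  imports "HOL-Probability.Probability"
begin

text \<open>\<open>*\<close> and \<open>^\<close> on \<^typ>\<open>real^'d^'d\<close> act entrywise, so matrix powers are iterates of \<open>**\<close>.\<close>

definition mat_power :: "real^'d^'d \<Rightarrow> nat \<Rightarrow> real^'d^'d" where
  "mat_power A k = ((\<lambda>B. A ** B) ^^ k) (mat 1)"

definition nonneg_mat :: "real^'d^'d \<Rightarrow> bool" where
  "nonneg_mat A \<longleftrightarrow> (\<forall>i j. 0 \<le> A $ i $ j)"

definition nonneg_vec :: "real^'d \<Rightarrow> bool" where
  "nonneg_vec x \<longleftrightarrow> (\<forall>i. 0 \<le> x $ i)"

definition primitive_mat :: "real^'d^'d \<Rightarrow> bool" where
  "primitive_mat A \<longleftrightarrow> nonneg_mat A \<and> (\<exists>k\<ge>1. \<forall>i j. 0 < mat_power A k $ i $ j)"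

definition complex_eigenvalue :: "real^'d^'d \<Rightarrow> complex \<Rightarrow> bool" where
  "complex_eigenvalue A z \<longleftrightarrow>
     (\<exists>v::complex^'d. v \<noteq> 0 \<and> (\<chi> i j. complex_of_real (A $ i $ j)) *v v = z *s v)"

definition mat_spectral_radius :: "real^'d^'d \<Rightarrow> real" where
  "mat_spectral_radius A = Max {cmod z |z. complex_eigenvalue A z}"

definition measure_support :: "'a::topological_space measure \<Rightarrow> 'a set" where
  "measure_support \<mu> = {x. \<forall>G. open G \<longrightarrow> x \<in> G \<longrightarrow> emeasure \<mu> G > 0}"

text \<open>The library's \<open>indep_var\<close> requires both random variables to have the same type.\<close>

definition indep_rvs ::
  "'w measure \<Rightarrow> 'a measure \<Rightarrow> ('w \<Rightarrow> 'a) \<Rightarrow> 'b measure \<Rightarrow> ('w \<Rightarrow> 'b) \<Rightarrow> bool" where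
  "indep_rvs M S X T Y \<longleftrightarrow>
     X \<in> measurable M S \<and> Y \<in> measurable M T \<and>
     prob_space.indep_set M (sets (vimage_algebra (space M) X S))
                            (sets (vimage_algebra (space M) Y T))"

definition iid :: "'w measure \<Rightarrow> 'a measure \<Rightarrow> ('i \<Rightarrow> 'w \<Rightarrow> 'a) \<Rightarrow> 'i set \<Rightarrow> bool" where
  "iid M S W I \<longleftrightarrow>
     prob_space.indep_vars M (\<lambda>_. S) W I \<and>
     (\<forall>i\<in>I. \<forall>j\<in>I. distr M S (W i) = distr M S (W j))"

primrec ar_process ::
  "(nat \<Rightarrow> 'w \<Rightarrow> real^'d^'d) \<Rightarrow> (nat \<Rightarrow> 'w \<Rightarrow> real^'d) \<Rightarrow> nat \<Rightarrow> 'w \<Rightarrow> real^'d" where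
  "ar_process A Y 0 \<omega> = Y 0 \<omega>"
| "ar_process A Y (Suc n) \<omega> = A (Suc n) \<omega> *v ar_process A Y n \<omega> + Y (Suc n) \<omega>"

primrec max_ar_process ::
  "(nat \<Rightarrow> 'w \<Rightarrow> real^'d^'d) \<Rightarrow> (nat \<Rightarrow> 'w \<Rightarrow> real^'d) \<Rightarrow> nat \<Rightarrow> 'w \<Rightarrow> real^'d" where
  "max_ar_process A Y 0 \<omega> = Y 0 \<omega>"
| "max_ar_process A Y (Suc n) \<omega> =
     (\<chi> i. max ((A (Suc n) \<omega> *v max_ar_process A Y n \<omega>) $ i) (Y (Suc n) \<omega> $ i))"

definition floor_vec :: "real^'d \<Rightarrow> nat^'d" where
  "floor_vec x = (\<chi> i. nat \<lfloor>x $ i\<rfloor>)"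

text \<open>The numbers \<open>xi m n k i j \<omega>\<close> are the offspring counts \<open>\<xi>\<^bsub>m,n,k\<^esub>\<^bsup>i,j\<^esup>\<close>. The value of
  \<open>immigrant_line xi Y m n\<close> is \<open>B\<^bsub>m,n\<^esub>\<close>, which is only meaningful for \<open>m \<le> n\<close>.\<close>

primrec immigrant_line ::
  "(nat \<Rightarrow> nat \<Rightarrow> nat \<Rightarrow> 'd \<Rightarrow> 'd \<Rightarrow> 'w \<Rightarrow> nat) \<Rightarrow> (nat \<Rightarrow> 'w \<Rightarrow> real^'d) \<Rightarrow>
   nat \<Rightarrow> nat \<Rightarrow> 'w \<Rightarrow> nat^'d::finite" where
  "immigrant_line xi Y m 0 \<omega> = floor_vec (Y m \<omega>)"
| "immigrant_line xi Y m (Suc n) \<omega> =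
     (if m \<le> n
      then (\<chi> i. \<Sum>j\<in>UNIV. \<Sum>k = 1..immigrant_line xi Y m n \<omega> $ j. xi m (Suc n) k i j \<omega>)
      else floor_vec (Y m \<omega>))"

definition branching_process ::
  "(nat \<Rightarrow> nat \<Rightarrow> nat \<Rightarrow> 'd \<Rightarrow> 'd \<Rightarrow> 'w \<Rightarrow> nat) \<Rightarrow> (nat \<Rightarrow> 'w \<Rightarrow> real^'d) \<Rightarrow>
   nat \<Rightarrow> 'w \<Rightarrow> real^'d::finite" where
  "branching_process xi Y n \<omega> = (\<chi> i. \<Sum>m\<le>n. real (immigrant_line xi Y m n \<omega> $ i))"

text \<open>\<open>V\<close> is the process as a function of its input sequence \<open>Y\<close>; the chain is started at \<open>0\<close> by
  replacing \<open>Y\<^sub>0\<close>.\<close>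

definition recurrent ::
  "'w measure \<Rightarrow> ((nat \<Rightarrow> 'w \<Rightarrow> real^'d) \<Rightarrow> nat \<Rightarrow> 'w \<Rightarrow> real^'d) \<Rightarrow> (nat \<Rightarrow> 'w \<Rightarrow> real^'d) \<Rightarrow> bool" where
  "recurrent M V Y \<longleftrightarrow>
     (\<exists>b>0. (\<Sum>n. emeasure M {\<omega> \<in> space M. infnorm (V (Y(0 := (\<lambda>_. 0))) n \<omega>) \<le> b}) = \<infinity>)"

locale autoregressive_setting = prob_space M
  for M :: "'w measure" +
  fixes A :: "nat \<Rightarrow> 'w \<Rightarrow> real^'d^'d"
    and Y :: "nat \<Rightarrow> 'w \<Rightarrow> real^'d"
  assumes A_measurable: "\<And>n. n \<ge> 1 \<Longrightarrow> random_variable borel (A n)"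
    and Y_measurable: "\<And>n. random_variable borel (Y n)"
    and A_nonneg: "\<And>n \<omega>. n \<ge> 1 \<Longrightarrow> \<omega> \<in> space M \<Longrightarrow> nonneg_mat (A n \<omega>)"
    and Y_nonneg: "\<And>n \<omega>. \<omega> \<in> space M \<Longrightarrow> nonneg_vec (Y n \<omega>)"
    and AY_iid: "iid M (borel \<Otimes>\<^sub>M borel) (\<lambda>n \<omega>. (A n \<omega>, Y n \<omega>)) {1..}"
    and AY_indep_initial:
      "indep_rvs M (PiM {1..} (\<lambda>_. borel \<Otimes>\<^sub>M borel)) (\<lambda>\<omega>. \<lambda>n\<in>{1..}. (A n \<omega>, Y n \<omega>))
                   borel (Y 0)"
    and Y_unbounded: "\<not> bounded (measure_support (distr M borel (Y 1)))"

text \<open>\<open>offspring_fns\<close> is the set \<open>\<Phi>\<close> of measurable functions from \<open>[0,1]\<close> to \<open>\<nat>\<^sub>0\<^sup>d\<close>; membership in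
  \<open>extensional\<close> makes such a function determined by its values on \<open>[0,1]\<close>.\<close>

definition offspring_fns :: "(real \<Rightarrow> nat^'d) set" where
  "offspring_fns = measurable (restrict_space borel {0..1}) (count_space UNIV) \<inter> extensional {0..1}"

definition offspring_fn_families :: "('d \<Rightarrow> real \<Rightarrow> nat^'d) set" where
  "offspring_fn_families = {\<phi>. \<forall>j. \<phi> j \<in> offspring_fns}"

definition offspring ::
  "(nat \<Rightarrow> 'w \<Rightarrow> 'd \<Rightarrow> real \<Rightarrow> nat^'d) \<Rightarrow> (nat \<Rightarrow> nat \<Rightarrow> nat \<Rightarrow> 'd \<Rightarrow> 'w \<Rightarrow> real) \<Rightarrow>
   nat \<Rightarrow> nat \<Rightarrow> nat \<Rightarrow> 'd \<Rightarrow> 'd \<Rightarrow> 'w \<Rightarrow> nat" where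
  "offspring Psi U m n k i j \<omega> = Psi n \<omega> j (U m n k j \<omega>) $ i"

text \<open>The space \<open>\<Phi>\<^sup>d\<close> carries no \<open>\<sigma>\<close>-algebra for which evaluation is jointly measurable
  (Aumann), so the \<open>\<sigma>\<close>-algebra used for the environment is an arbitrary parameter \<open>F\<close>, and it is
  required separately that the offspring counts are random variables. Conditional expectations use
  the extended nonnegative version, so that the last assumption includes finiteness of the
  conditional means.\<close>

locale branching_setting = autoregressive_setting M A Y
  for M :: "'w measure"
    and A :: "nat \<Rightarrow> 'w \<Rightarrow> real^'d^'d"
    and Y :: "nat \<Rightarrow> 'w \<Rightarrow> real^'d" +
  fixes F :: "('d \<Rightarrow> real \<Rightarrow> nat^'d) measure"
    and Psi :: "nat \<Rightarrow> 'w \<Rightarrow> 'd \<Rightarrow> real \<Rightarrow> nat^'d"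
    and U :: "nat \<Rightarrow> nat \<Rightarrow> nat \<Rightarrow> 'd \<Rightarrow> 'w \<Rightarrow> real"
  assumes space_F: "space F = offspring_fn_families"
    and Psi_measurable: "\<And>n. n \<ge> 1 \<Longrightarrow> random_variable F (Psi n)"
    and PsiY_iid: "iid M (F \<Otimes>\<^sub>M borel) (\<lambda>n \<omega>. (Psi n \<omega>, Y n \<omega>)) {1..}"
    and PsiY_indep_initial:
      "indep_rvs M (PiM {1..} (\<lambda>_. F \<Otimes>\<^sub>M borel)) (\<lambda>\<omega>. \<lambda>n\<in>{1..}. (Psi n \<omega>, Y n \<omega>))
                   borel (Y 0)"
    and U_range: "\<And>m n k j \<omega>. m < n \<Longrightarrow> k \<ge> 1 \<Longrightarrow> \<omega> \<in> space M \<Longrightarrow> U m n k j \<omega> \<in> {0..1}"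
    and U_indep: "indep_vars (\<lambda>_. borel) (\<lambda>(m, n, k, j). U m n k j) {(m, n, k, j). m < n \<and> k \<ge> 1}"
    and U_uniform: "\<And>m n k j. m < n \<Longrightarrow> k \<ge> 1 \<Longrightarrow>
                      distr M borel (U m n k j) = uniform_measure lborel {0..1}"
    and U_indep_PsiY:
      "indep_rvs M (PiM {(m, n, k, j). m < n \<and> k \<ge> 1} (\<lambda>_. borel))
                   (\<lambda>\<omega>. \<lambda>(m, n, k, j)\<in>{(m, n, k, j). m < n \<and> k \<ge> 1}. U m n k j \<omega>)
                   (PiM {1..} (\<lambda>_. F) \<Otimes>\<^sub>M PiM UNIV (\<lambda>_. borel))
                   (\<lambda>\<omega>. (\<lambda>n\<in>{1..}. Psi n \<omega>, \<lambda>n. Y n \<omega>))"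
    and offspring_measurable: "\<And>m n k i j. m < n \<Longrightarrow> k \<ge> 1 \<Longrightarrow>
           random_variable (count_space UNIV) (offspring Psi U m n k i j)"
    and mean_offspring: "\<And>n. n \<ge> 1 \<Longrightarrow> AE \<omega> in M. \<forall>i j.
           nn_cond_exp M
             (vimage_algebra (space M) (\<lambda>\<omega>. \<lambda>l\<in>{1..}. Psi l \<omega>) (PiM {1..} (\<lambda>_. F)))
             (\<lambda>\<omega>. ennreal (real (offspring Psi U 0 n 1 i j \<omega>))) \<omega> = ennreal (A n \<omega> $ i $ j)"

end

theory Submission
  imports Defs
begin

text \<open>
  Let \<open>u > 0\<close> be a left Perron eigenvector of \<open>A\<close>, \<open>r\<close> its eigenvalue and \<open>p\<^sub>k = P[\<bar>Y\<^sub>1\<bar> \<le> y r\<^sup>-\<^sup>k]\<close>.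
  All three processes \<open>V\<close> satisfy \<open>P[\<bar>V\<^sub>n\<bar> \<le> b] \<asymp> p\<^sub>0 \<cdots> p\<^sub>n\<^sub>-\<^sub>1\<close>, the lower bound for large \<open>b\<close>.

  For \<open>X\<close>, \<open>u \<bullet> X\<^sub>n = \<Sum>\<^sub>l r\<^sup>n\<^sup>-\<^sup>l (u \<bullet> Y\<^sub>l)\<close>. On the event that \<open>r\<^sup>n\<^sup>-\<^sup>l \<bar>Y\<^sub>l\<bar> \<le> y\<close> for all \<open>l\<close> this sum has
  bounded conditional mean, because \<open>\<Sum>\<^sub>k r\<^sup>k x [r\<^sup>k x \<le> y]\<close> is bounded uniformly in \<open>x\<close>; this gives the lower
  bound. Since \<open>M \<le> X\<close>, it remains to bound \<open>M\<close> from above, where \<open>r\<^sup>n\<^sup>-\<^sup>l (u \<bullet> Y\<^sub>l) \<le> u \<bullet> M\<^sub>n\<close>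
  reduces the claim to a change of the threshold \<open>y\<close>.

  For \<open>Z\<close>, conditioning on the immigration turns \<open>E exp (- \<theta> \<bullet> Z\<^sub>n)\<close> into a product of Laplace transforms of
  \<open>\<lfloor>Y\<^sub>l\<rfloor>\<close> at the iterates \<open>L\<^sup>n\<^sup>-\<^sup>l \<theta>\<close> of the Laplace exponent \<open>L\<close> of the offspring law. Jensen's inequality
  gives \<open>L\<^sup>k u \<le> r\<^sup>k u\<close>, and \<open>E[\<xi> ln \<xi>] < \<infinity>\<close> gives \<open>L\<^sup>k \<theta> \<ge> c r\<^sup>k u\<close> for some small multiple \<open>\<theta>\<close> of \<open>u\<close>.
\<close>

section \<open>Perron eigenvectors\<close>

text \<open>Pairing with \<open>u\<close> turns a step of the linear recursion into multiplication
  by \<open>r\<close>, and on nonnegative vectors it is comparable with the norm. What remains are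
  products of independent factors, one per scale \<open>k\<close>, and two such products agree up to
  a constant once the relative errors of the factors are summable in \<open>k\<close>. Passing from
  absolute to relative errors is harmless since p_k >= p_0 > 0. Summability needs no moments of Y_1:
  for each value x the scales beyond the threshold, or those below it, contribute a geometric series
  bounded independently of x. Lower bounds on probabilities come from Laplace transforms restricted
  to the event that all scaled immigrants are small: the transform is at least c times the
  probability of that event, and a \<open>b\<close> with exp(-b) <= c/2 leaves half of it for u.V_n
  <= b. For Z the obstacle is that L is not linear. Its relative deviation from the mean matrix at s
  u is controlled by truncated moments of the type E[xi min(1, s xi)], summable along s = r^k.
  Moreover the environment is constant only almost surely; Z is replaced by a version driven by
  \<open>psi\<close> at every sample point, whose randomness besides the immigration sits in the
  uniforms alone.\<close>

lemma mat_power_Suc: "mat_power A (Suc k) = A ** mat_power A k"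
  by (simp add: mat_power_def)

text \<open>A left eigenvector is encoded by its pairing with all vectors, so no transposed powers
  occur. The value \<open>l = 0\<close> is allowed and serves to refute x A = 0 for a primitive
  matrix.\<close>

lemma mat_power_eigenvector:
  fixes x :: "real^'d"
  assumes "\<And>z. x \<bullet> (A *v z) = l * (x \<bullet> z)"
  shows "x \<bullet> (mat_power A k *v z) = l ^ k * (x \<bullet> z)"
proof (induction k)
  case 0
  then show ?case by (simp add: mat_power_def)
next
  case (Suc k)
  then show ?case
    by (simp add: mat_power_Suc assms flip: matrix_vector_mul_assoc)
qed

lemma nonneg_mat_vec:
  fixes x :: "real^'d"
  assumes "nonneg_mat A" "nonneg_vec x"
  shows "nonneg_vec (A *v x)"
  using assms by (auto simp: nonneg_mat_def nonneg_vec_def matrix_vector_mult_def intro!: sum_nonneg)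

text \<open>Brouwer's theorem for \<open>x \<mapsto> x A / (x A \<bullet> 1)\<close> on the standard simplex.\<close>

lemma primitive_mat_left_eigenvector:
  fixes A :: "real^'d^'d"
  assumes "primitive_mat A"
  obtains u :: "real^'d" and l where "\<And>i. 0 < u $ i" "0 < l" "\<And>z. u \<bullet> (A *v z) = l * (u \<bullet> z)"
proof -
  have nn: "nonneg_mat A" using assms by (simp add: primitive_mat_def)
  obtain K where K1: "K \<ge> 1" and K: "\<And>i j. 0 < mat_power A K $ i $ j"
    using assms by (auto simp: primitive_mat_def)
  define B where "B = transpose A"
  have adj: "(B *v x) \<bullet> z = x \<bullet> (A *v z)" for x z :: "real^'d"
    by (simp add: B_def dot_lmul_matrix)
  define one :: "real^'d" where "one = 1"
  have dot_one: "x \<bullet> one = (\<Sum>i\<in>UNIV. x $ i)" for x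
    by (simp add: one_def inner_vec_def)
  define S where "S = {x :: real^'d. (\<forall>i. 0 \<le> x $ i) \<and> x \<bullet> one = 1}"
  have B_nn: "0 \<le> (B *v x) $ i" if "\<forall>i. 0 \<le> x $ i" for x i
    using that nn by (auto simp: B_def transpose_def nonneg_mat_def matrix_vector_mult_def intro!: sum_nonneg)
  \<comment> \<open>Every point of the simplex has a positive entry and A^K is positive entrywise,
    so x A^K is positive in each coordinate.\<close>
  have pos_dot: "0 < x \<bullet> (mat_power A K *v axis i 1)" if "x \<in> S" for x i
  proof -
    obtain k where k: "x $ k > 0"
    proof (rule ccontr)
      assume "\<not> thesis"
      then have "x $ k = 0" for k using that[of k] \<open>x \<in> S\<close> by (force simp: S_def order.order_iff_strict)
      then show False using \<open>x \<in> S\<close> by (auto simp: S_def dot_one)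
    qed
    have "0 < x $ k * mat_power A K $ k $ i" using k K by simp
    also have "\<dots> \<le> (\<Sum>k\<in>UNIV. x $ k * mat_power A K $ k $ i)"
      using \<open>x \<in> S\<close> K by (intro member_le_sum) (auto simp: S_def less_imp_le)
    finally show ?thesis by (simp add: inner_vec_def matrix_vector_mult_basis column_def)
  qed
  have Bx_pos: "0 < (B *v x) \<bullet> one" if "x \<in> S" for x
  proof (rule ccontr)
    assume "\<not> ?thesis"
    moreover have nonneg: "\<forall>i. 0 \<le> (B *v x) $ i" using B_nn that by (auto simp: S_def)
    ultimately have "(\<Sum>i\<in>UNIV. (B *v x) $ i) = 0"
      by (simp add: dot_one order_antisym sum_nonneg)
    then have "B *v x = 0" using nonneg by (simp add: sum_nonneg_eq_0_iff vec_eq_iff)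
    \<comment> \<open>If x A vanished, \<open>x\<close> would be a left eigenvector for 0, and x A^K
      = 0 because K >= 1.\<close>
    then have z: "x \<bullet> (A *v z) = 0 * (x \<bullet> z)" for z using adj[of x z] by simp
    show False
      using pos_dot[OF that, of undefined] mat_power_eigenvector[OF z, of K] K1 by (simp add: power_0_left)
  qed
  define f where "f x = (B *v x) /\<^sub>R ((B *v x) \<bullet> one)" for x
  have "continuous_on S f"
    unfolding f_def
    by (intro continuous_intros linear_continuous_on_compose[OF continuous_on_id] matrix_vector_mul_linear ballI)
       (use Bx_pos in \<open>metis less_irrefl\<close>)
  moreover have "f \<in> S \<rightarrow> S"
  proof
    fix x assume x: "x \<in> S"
    then show "f x \<in> S"
      using Bx_pos[OF x] B_nn[of x] by (simp add: f_def S_def)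
  qed
  moreover have "compact S"
  proof -
    have "S = {x. \<forall>i. 0 \<le> x $ i} \<inter> {x. x \<bullet> one = 1}" by (auto simp: S_def)
    moreover have "closed {x :: real^'d. \<forall>i. 0 \<le> x $ i}"
      by (intro closed_Collect_all closed_Collect_le continuous_intros)
    moreover have "closed {x. x \<bullet> one = 1}" by (intro closed_Collect_eq continuous_intros)
    moreover have "bounded S"
    proof (rule boundedI)
      fix x assume x: "x \<in> S"
      have "norm x \<le> (\<Sum>i\<in>UNIV. \<bar>x $ i\<bar>)" by (rule norm_le_l1_cart)
      also have "\<dots> = 1" using x by (simp add: S_def dot_one)
      finally show "norm x \<le> 1" .
    qed
    ultimately show ?thesis by (simp add: compact_eq_bounded_closed closed_Int)
  qed
  moreover have "convex S"
    by (auto simp: S_def convex_def inner_add_left)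
  moreover have "S \<noteq> {}"
  proof -
    have "axis undefined 1 \<in> S" by (auto simp: S_def dot_one axis_def)
    then show ?thesis by blast
  qed
  ultimately obtain u where u: "u \<in> S" "f u = u" using brouwer by blast
  define l where "l = (B *v u) \<bullet> one"
  have l: "l > 0" using Bx_pos u by (simp add: l_def)
  have "B *v u = l *\<^sub>R u" using u(2) l by (metis f_def l_def less_irrefl scaleR_one scaleR_scaleR right_inverse)
  then have eig: "u \<bullet> (A *v z) = l * (u \<bullet> z)" for z using adj[of u z] by simp
  \<comment> \<open>Brouwer yields only a nonnegative \<open>u\<close>; strict positivity follows
    from u A^K = l^K u.\<close>
  have "0 < u $ i" for i
  proof -
    have "0 < l ^ K * (u \<bullet> axis i 1)" using pos_dot[OF u(1)] mat_power_eigenvector[OF eig] by simp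
    then show ?thesis using l by (simp add: inner_axis zero_less_mult_iff)
  qed
  then show ?thesis using that l eig by blast
qed

text \<open>The spectral radius is defined by \<open>Max\<close>, which is meaningful only on a
  finite set. Eigenvectors of distinct eigenvalues are linearly independent, so their number is at
  most the dimension.\<close>

lemma finite_complex_eigenvalues:
  fixes A :: "real^'d^'d"
  shows "finite {z. complex_eigenvalue A z}"
proof (rule ccontr)
  define C where "C = (\<chi> i j. complex_of_real (A $ i $ j))"
  define ev where "ev z = (SOME v::complex^'d. v \<noteq> 0 \<and> C *v v = z *s v)" for z
  have ev: "ev z \<noteq> 0" "C *v ev z = z *s ev z" if "complex_eigenvalue A z" for z
    using someI_ex[OF that[unfolded complex_eigenvalue_def, folded C_def]] by (auto simp: ev_def)
  have zero: "\<forall>z\<in>T. c z = 0"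
    if "finite T" "T \<subseteq> {z. complex_eigenvalue A z}" "(\<Sum>z\<in>T. c z *s ev z) = 0" for T c
    using that
  proof (induction T arbitrary: c rule: finite_induct)
    case empty
    then show ?case by simp
  next
    case (insert a T)
    have s: "c a *s ev a + (\<Sum>z\<in>T. c z *s ev z) = 0" using insert by simp
    have "0 = C *v (c a *s ev a + (\<Sum>z\<in>T. c z *s ev z))" using s by simp
    also have "\<dots> = c a *s (a *s ev a) + (\<Sum>z\<in>T. c z *s (z *s ev z))"
      using insert.prems ev(2) by (auto simp: vec.add vec.sum vec.scale intro!: sum.cong)
    \<comment> \<open>Applying \<open>C\<close> to the relation and subtracting \<open>a\<close>
      times it removes \<open>ev a\<close> and multiplies the other coefficients by z - a, which is
      nonzero.\<close>
    also have "\<dots> = a *s (c a *s ev a + (\<Sum>z\<in>T. c z *s ev z)) + (\<Sum>z\<in>T. ((z - a) * c z) *s ev z)"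
      by (simp add: vec.scale_right_distrib vec.scale_sum_right sum.distrib[symmetric]
          vec.scale_left_diff_distrib algebra_simps)
    finally have "(\<Sum>z\<in>T. ((z - a) * c z) *s ev z) = 0" using s by simp
    then have "\<forall>z\<in>T. (z - a) * c z = 0"
      using insert.IH[of "\<lambda>z. (z - a) * c z"] insert.prems(1) by blast
    then have "\<forall>z\<in>T. c z = 0" using insert.hyps by auto
    then have "c a *s ev a = 0" using s by simp
    then show ?case using \<open>\<forall>z\<in>T. c z = 0\<close> ev(1)[of a] insert.prems by auto
  qed
  assume "infinite {z. complex_eigenvalue A z}"
  then obtain T where T: "T \<subseteq> {z. complex_eigenvalue A z}" "finite T" "card T = Suc (CARD('d))"
    by (meson infinite_arbitrarily_large)
  have inj: "inj_on ev T"
  proof (rule inj_onI)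
    fix z w assume "z \<in> T" "w \<in> T" "ev z = ev w"
    then have "z *s ev z = w *s ev z" using T(1) ev(2) by (metis mem_Collect_eq subsetD)
    then show "z = w" using ev(1) T(1) \<open>z \<in> T\<close> by auto
  qed
  have "vec.independent (ev ` T)"
  proof (rule vec.independent_if_scalars_zero)
    show "finite (ev ` T)" using T by simp
    fix g x assume "(\<Sum>v\<in>ev ` T. g v *s v) = 0" "x \<in> ev ` T"
    then show "g x = 0" using zero[OF T(2,1), of "g \<circ> ev"] inj by (auto simp: sum.reindex)
  qed
  then have "card (ev ` T) \<le> CARD('d)"
    using vec.independent_bound_general[of "ev ` T"] vec.dim_subset_UNIV[of "ev ` T"]
    by (simp add: vec.dimension_def card_cart_basis)
  then show False using T inj by (simp add: card_image)
qed

text \<open>Any other eigenvalue \<open>z\<close> with eigenvector \<open>w\<close> satisfies \<open>\<bar>z\<bar> \<bar>w\<bar> \<le> A \<bar>w\<bar>\<close>; pair this with \<open>u\<close>.\<close>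

lemma spectral_radius_left_eigenvector:
  fixes A :: "real^'d^'d"
  assumes nn: "nonneg_mat A" and u: "\<And>i. 0 < u $ i" and l: "0 < l"
    and eig: "\<And>z. u \<bullet> (A *v z) = l * (u \<bullet> z)"
  shows "mat_spectral_radius A = l"
proof -
  \<comment> \<open>The value \<open>l\<close> is also a right eigenvalue: otherwise A - l would be
    invertible, whereas \<open>u\<close> is orthogonal to its range.\<close>
  have "\<exists>w. w \<noteq> 0 \<and> A *v w = l *\<^sub>R w"
  proof (rule ccontr)
    assume "\<not> ?thesis"
    moreover have matl: "mat l *v w = l *\<^sub>R w" for w :: "real^'d"
      by (simp add: vec_eq_iff matrix_vector_mult_def mat_def if_distrib if_distribR sum.delta' cong: if_cong)
    ultimately have "\<forall>w. (A - mat l) *v w = 0 \<longrightarrow> w = 0"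
      by (auto simp: matrix_vector_mult_diff_rdistrib)
    then obtain B where B: "(A - mat l) ** B = mat 1"
      by (metis matrix_left_invertible_ker matrix_left_right_inverse)
    have "u \<bullet> u = u \<bullet> ((A - mat l) *v (B *v u))"
      by (simp add: matrix_vector_mul_assoc B)
    also have "\<dots> = 0"
      by (simp add: matrix_vector_mult_diff_rdistrib inner_diff_right eig matl)
    finally have "u = 0" by simp
    then show False using u by simp
  qed
  then obtain w where w: "w \<noteq> 0" "A *v w = l *\<^sub>R w" by blast
  have "complex_eigenvalue A (complex_of_real l)"
    unfolding complex_eigenvalue_def
  proof (intro exI conjI)
    show "(\<chi> i. complex_of_real (w $ i)) \<noteq> 0" using w by (auto simp: vec_eq_iff)
    show "(\<chi> i j. complex_of_real (A $ i $ j)) *v (\<chi> i. complex_of_real (w $ i)) =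
      complex_of_real l *s (\<chi> i. complex_of_real (w $ i))"
      using w(2) by (simp add: vec_eq_iff matrix_vector_mult_def flip: of_real_mult of_real_sum)
  qed
  moreover have "cmod z \<le> l" if ez: "complex_eigenvalue A z" for z
  proof -
    obtain v :: "complex^'d" where v: "v \<noteq> 0" "(\<chi> i j. complex_of_real (A $ i $ j)) *v v = z *s v"
      using ez by (auto simp: complex_eigenvalue_def)
    define x where "x = (\<chi> i. cmod (v $ i))"
    have "cmod z * x $ i \<le> (A *v x) $ i" for i
    proof -
      have "cmod z * x $ i = cmod (\<Sum>j\<in>UNIV. complex_of_real (A $ i $ j) * v $ j)"
        using v(2) by (simp add: x_def vec_eq_iff matrix_vector_mult_def norm_mult)
      also have "\<dots> \<le> (\<Sum>j\<in>UNIV. cmod (complex_of_real (A $ i $ j) * v $ j))" by (rule norm_sum)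
      also have "\<dots> = (A *v x) $ i"
        using nn by (simp add: x_def matrix_vector_mult_def norm_mult nonneg_mat_def)
      finally show ?thesis .
    qed
    then have "u \<bullet> (cmod z *\<^sub>R x) \<le> u \<bullet> (A *v x)"
      unfolding inner_vec_def using u by (intro sum_mono) (simp add: mult_left_mono less_imp_le)
    then have le: "cmod z * (u \<bullet> x) \<le> l * (u \<bullet> x)" by (simp add: eig)
    obtain k where "v $ k \<noteq> 0" using v(1) by (auto simp: vec_eq_iff)
    then have "0 < u $ k * x $ k" using u by (simp add: x_def)
    also have "\<dots> \<le> u \<bullet> x"
      unfolding inner_vec_def using u by (auto simp: x_def less_imp_le intro!: member_le_sum)
    finally show ?thesis using le by simp
  qed
  moreover have "finite {cmod z |z. complex_eigenvalue A z}"
    using finite_complex_eigenvalues[of A] by (simp add: setcompr_eq_image)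
  ultimately show ?thesis
    unfolding mat_spectral_radius_def using l
    by (intro Max_eqI) (auto intro!: exI[of _ "complex_of_real l"])
qed

section \<open>Products over geometric scales\<close>

lemma sum_geometric_le:
  fixes r :: real
  assumes "0 < r" "r < 1"
  shows "(\<Sum>k<n. r ^ k) \<le> 1 / (1 - r)"
  using assms by (simp add: sum_gp_strict divide_right_mono)

text \<open>The retained terms form a geometric progression starting at most at \<open>y\<close>,
  wherever \<open>x\<close> lies. Generalizing \<open>x\<close> makes the induction work: for x > y
  the first term is dropped and the rest is the sum for r x; for x <= y the k-th term is at most r^k
  y.\<close>

lemma sum_scales_below_le:
  fixes r x y :: real
  assumes r: "0 < r" "r < 1" and "0 < y" "0 \<le> x"
  shows "(\<Sum>k<n. if r ^ k * x \<le> y then r ^ k * x else 0) \<le> y / (1 - r)"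
  using \<open>0 \<le> x\<close>
proof (induction n arbitrary: x)
  case 0
  then show ?case using assms by simp
next
  case (Suc n)
  show ?case
  proof (cases "x \<le> y")
    case True
    have "(\<Sum>k<Suc n. if r ^ k * x \<le> y then r ^ k * x else 0) \<le> (\<Sum>k<Suc n. r ^ k * y)"
      using True r Suc.prems \<open>0 < y\<close> by (intro sum_mono) (auto intro: mult_left_mono)
    also have "\<dots> = y * (\<Sum>k<Suc n. r ^ k)"
      by (simp only: sum_distrib_left mult.commute)
    also have "\<dots> \<le> y * (1 / (1 - r))"
      using sum_geometric_le[OF r, of "Suc n"] \<open>0 < y\<close> by (intro mult_left_mono) simp_all
    finally show ?thesis by simp
  next
    case False
    then have "(\<Sum>k<Suc n. if r ^ k * x \<le> y then r ^ k * x else 0) =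
      (\<Sum>k<n. if r ^ k * (r * x) \<le> y then r ^ k * (r * x) else 0)"
      unfolding sum.lessThan_Suc_shift by (auto simp: mult_ac intro!: sum.cong)
    also have "\<dots> \<le> y / (1 - r)" using Suc.IH[of "r * x"] Suc.prems r by simp
    finally show ?thesis .
  qed
qed

text \<open>The reciprocals grow geometrically in \<open>k\<close> as long as r^k x stays above
  \<open>y\<close>, and the last retained one is below 1/y. Reading the progression backwards from
  that term gives a bound independent of \<open>x\<close> and \<open>n\<close>.\<close>

lemma sum_scales_above_le:
  fixes r x y :: real
  assumes r: "0 < r" "r < 1" and "0 < y" "0 \<le> x"
  shows "(\<Sum>k<n. if r ^ k * x > y then 1 / (r ^ k * x) else 0) \<le> 1 / (y * (1 - r))"
proof (induction n)
  case 0
  then show ?case using assms by simp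
next
  case (Suc n)
  show ?case
  proof (cases "r ^ n * x > y")
    case False
    then show ?thesis using Suc by simp
  next
    case True
    have "(if r ^ k * x > y then 1 / (r ^ k * x) else 0) \<le> r ^ (n - k) / y" if "k \<in> {..<Suc n}" for k
    proof -
      have "r ^ (n - k) * r ^ k = r ^ n"
        unfolding power_add[symmetric] using that by simp
      then have "r ^ (n - k) * (r ^ k * x) = r ^ n * x"
        by (metis mult.assoc)
      then have "y \<le> r ^ (n - k) * (r ^ k * x)" using True by linarith
      then show ?thesis using r \<open>0 < y\<close> by (auto simp: field_simps)
    qed
    then have "(\<Sum>k<Suc n. if r ^ k * x > y then 1 / (r ^ k * x) else 0) \<le> (\<Sum>k<Suc n. r ^ (n - k) / y)"
      by (rule sum_mono)
    also have "\<dots> = (\<Sum>k<Suc n. r ^ k) / y"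
      unfolding sum_divide_distrib[symmetric] using sum.nat_diff_reindex[of "\<lambda>k. r ^ k" "Suc n"] by simp
    also have "\<dots> \<le> (1 / (1 - r)) / y"
      using sum_geometric_le[OF r, of "Suc n"] \<open>0 < y\<close> by (intro divide_right_mono) simp_all
    finally show ?thesis by (simp add: mult.commute)
  qed
qed

context prob_space
begin

text \<open>The expected number of scales \<open>k\<close> at which \<open>g\<close> lets a value beyond the threshold through is
  finite, so that the two products agree up to a constant factor.\<close>

lemma prod_expectation_scaled_le:
  fixes R :: "'a \<Rightarrow> real" and g :: "real \<Rightarrow> real"
  assumes R[measurable]: "random_variable borel R" and R_nn: "\<And>\<omega>. 0 \<le> R \<omega>"
    and r: "0 < r" "r < 1" and y: "0 < y"
    and g[measurable]: "g \<in> borel_measurable borel"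
    and g01: "\<And>x. 0 \<le> x \<Longrightarrow> 0 \<le> g x" "\<And>x. 0 \<le> x \<Longrightarrow> g x \<le> 1"
    and gC: "\<And>x. 0 < x \<Longrightarrow> g x \<le> C / x"
    and a0: "0 < prob {\<omega>\<in>space M. R \<omega> \<le> y}"
  obtains D where "0 < D"
    "\<And>n. (\<Prod>k<n. expectation (\<lambda>\<omega>. g (r ^ k * R \<omega>))) \<le> D * (\<Prod>k<n. prob {\<omega>\<in>space M. r ^ k * R \<omega> \<le> y})"
proof -
  define a where "a k = prob {\<omega>\<in>space M. r ^ k * R \<omega> \<le> y}" for k
  define p where "p = prob {\<omega>\<in>space M. R \<omega> \<le> y}"
  \<comment> \<open>Beyond the threshold \<open>g\<close> is at most \<open>C\<close> times this
    reciprocal; below it \<open>g\<close> is at most 1, the value of the indicator.\<close>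
  define h where "h k x = (if r ^ k * x > y then 1 / (r ^ k * x) else 0)" for k x
  define d where "d k = expectation (\<lambda>\<omega>. h k (R \<omega>))" for k
  have "0 \<le> g 1" "g 1 \<le> C" using g01[of 1] gC[of 1] by auto
  then have C: "0 \<le> C" by simp
  have h_meas[measurable]: "(\<lambda>\<omega>. h k (R \<omega>)) \<in> borel_measurable M" for k
    unfolding h_def by measurable
  have I_int: "integrable M (indicator {\<omega>\<in>space M. r ^ k * R \<omega> \<le> y} :: 'a \<Rightarrow> real)" for k
    by (rule integrable_const_bound[where B=1]) auto
  have h_nn: "0 \<le> h k x" if "0 \<le> x" for k x using that r by (simp add: h_def)
  have h_le: "h k x \<le> 1 / y" if "0 \<le> x" for k x using y by (auto simp: h_def field_simps)
  have h_int: "integrable M (\<lambda>\<omega>. h k (R \<omega>))" for k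
    by (rule integrable_const_bound[where B="1 / y"]) (use h_nn h_le R_nn in auto)
  have g_int: "integrable M (\<lambda>\<omega>. g (r ^ k * R \<omega>))" for k
    by (rule integrable_const_bound[where B=1]) (use g01 r R_nn in auto)
  have a_ge: "p \<le> a k" for k
    unfolding p_def a_def
  proof (rule finite_measure_mono)
    show "{\<omega> \<in> space M. R \<omega> \<le> y} \<subseteq> {\<omega> \<in> space M. r ^ k * R \<omega> \<le> y}"
      using r R_nn by (auto intro: order_trans[OF mult_left_le_one_le] simp: power_le_one)
  qed measurable
  have p: "0 < p" using a0 by (simp add: p_def)
  \<comment> \<open>Splitting at the threshold gives a_k + C d_k. The uniform bound a_k >= p makes
    the error relative, and 1 + x <= exp x makes the errors additive in the exponent.\<close>
  have factor: "expectation (\<lambda>\<omega>. g (r ^ k * R \<omega>)) \<le> a k * exp (C * d k / p)" for k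
  proof -
    have "expectation (\<lambda>\<omega>. g (r ^ k * R \<omega>)) \<le>
      expectation (\<lambda>\<omega>. indicator {\<omega>\<in>space M. r ^ k * R \<omega> \<le> y} \<omega> + C * h k (R \<omega>))"
    proof (rule integral_mono[OF g_int])
      fix \<omega> assume "\<omega> \<in> space M"
      then show "g (r ^ k * R \<omega>) \<le> indicator {\<omega>\<in>space M. r ^ k * R \<omega> \<le> y} \<omega> + C * h k (R \<omega>)"
        using g01[of "r ^ k * R \<omega>"] gC[of "r ^ k * R \<omega>"] r R_nn[of \<omega>] y by (auto simp: h_def)
    qed (intro Bochner_Integration.integrable_add integrable_mult_right I_int h_int)
    also have "\<dots> = a k + C * d k"
      using I_int h_int by (subst Bochner_Integration.integral_add) (auto simp: a_def d_def)
    also have "\<dots> = a k * (1 + C * d k / a k)" using a_ge[of k] p by (simp add: field_simps)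
    also have "\<dots> \<le> a k * (1 + C * d k / p)"
      using a_ge[of k] p C h_nn R_nn
      by (intro mult_left_mono add_left_mono divide_left_mono mult_nonneg_nonneg mult_pos_pos)
        (auto simp: d_def intro!: Bochner_Integration.integral_nonneg)
    also have "\<dots> \<le> a k * exp (C * d k / p)"
      using a_ge[of k] p by (intro mult_left_mono exp_ge_add_one_self) auto
    finally show ?thesis .
  qed
  have d_sum: "(\<Sum>k<n. d k) \<le> 1 / (y * (1 - r))" for n
  proof -
    have "(\<Sum>k<n. d k) = expectation (\<lambda>\<omega>. \<Sum>k<n. h k (R \<omega>))"
      unfolding d_def by (rule Bochner_Integration.integral_sum[symmetric]) (rule h_int)
    also have "\<dots> \<le> expectation (\<lambda>\<omega>. 1 / (y * (1 - r)))"
      using sum_scales_above_le[OF r y R_nn] h_int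
      by (intro integral_mono) (auto simp: h_def)
    finally show ?thesis by (simp add: prob_space)
  qed
  define D where "D = exp (C * (1 / (y * (1 - r))) / p)"
  have "(\<Prod>k<n. expectation (\<lambda>\<omega>. g (r ^ k * R \<omega>))) \<le> D * (\<Prod>k<n. a k)" for n
  proof -
    have "(\<Prod>k<n. expectation (\<lambda>\<omega>. g (r ^ k * R \<omega>))) \<le> (\<Prod>k<n. a k * exp (C * d k / p))"
      using factor g01 r R_nn by (intro prod_mono) (auto intro!: Bochner_Integration.integral_nonneg)
    also have "\<dots> = exp (C * (\<Sum>k<n. d k) / p) * (\<Prod>k<n. a k)"
      by (simp add: prod.distrib exp_sum sum_distrib_left sum_divide_distrib mult.commute)
    also have "\<dots> \<le> D * (\<Prod>k<n. a k)"
      unfolding D_def using d_sum[of n] C p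
      by (intro mult_right_mono iffD2[OF exp_le_cancel_iff] divide_right_mono mult_left_mono prod_nonneg)
        (simp_all add: a_def)
    finally show ?thesis .
  qed
  moreover have "0 < D" by (simp add: D_def)
  ultimately show ?thesis using that by (auto simp: a_def)
qed

text \<open>Jensen's inequality under the law conditioned on r^k R <= y: the exponent has
  conditional mean C d_k / a_k, so the factor is at least a_k exp(-C d_k / a_k). The d_k have
  bounded partial sums by \<open>sum_scales_below_le\<close>, and the a_k are bounded below by the
  value at k = 0.\<close>

lemma prod_expectation_exp_scaled_ge:
  fixes R :: "'a \<Rightarrow> real"
  assumes R[measurable]: "random_variable borel R" and R_nn: "\<And>\<omega>. 0 \<le> R \<omega>"
    and r: "0 < r" "r < 1" and y: "0 < y" and C: "0 \<le> C"
    and a0: "0 < prob {\<omega>\<in>space M. R \<omega> \<le> y}"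
  obtains c where "0 < c"
    "\<And>n. c * (\<Prod>k<n. prob {\<omega>\<in>space M. r ^ k * R \<omega> \<le> y}) \<le>
      (\<Prod>k<n. expectation (\<lambda>\<omega>. indicator {\<omega>\<in>space M. r ^ k * R \<omega> \<le> y} \<omega> * exp (- (C * (r ^ k * R \<omega>)))))"
proof -
  define a where "a k = prob {\<omega>\<in>space M. r ^ k * R \<omega> \<le> y}" for k
  define p where "p = prob {\<omega>\<in>space M. R \<omega> \<le> y}"
  define h where "h k x = (if r ^ k * x \<le> y then r ^ k * x else 0)" for k x
  define d where "d k = expectation (\<lambda>\<omega>. h k (R \<omega>))" for k
  define I where "I k = (indicator {\<omega>\<in>space M. r ^ k * R \<omega> \<le> y} :: 'a \<Rightarrow> real)" for k
  have I_meas[measurable]: "I k \<in> borel_measurable M" for k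
    unfolding I_def by measurable
  have I_int: "integrable M (I k)" for k
    by (rule integrable_const_bound[where B=1]) (auto simp: I_def)
  have h_meas[measurable]: "(\<lambda>\<omega>. h k (R \<omega>)) \<in> borel_measurable M" for k
    unfolding h_def by measurable
  have h_nn: "0 \<le> h k x" if "0 \<le> x" for k x using that r by (simp add: h_def)
  have h_le: "h k x \<le> y" for k x using y by (auto simp: h_def)
  have h_int: "integrable M (\<lambda>\<omega>. h k (R \<omega>))" for k
    by (rule integrable_const_bound[where B=y]) (use h_nn h_le R_nn in auto)
  have a_ge: "p \<le> a k" for k
    unfolding p_def a_def
  proof (rule finite_measure_mono)
    show "{\<omega> \<in> space M. R \<omega> \<le> y} \<subseteq> {\<omega> \<in> space M. r ^ k * R \<omega> \<le> y}"
      using r R_nn by (auto intro: order_trans[OF mult_left_le_one_le] simp: power_le_one)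
  qed measurable
  have p: "0 < p" using a0 by (simp add: p_def)
  have d_nn: "0 \<le> d k" for k
    unfolding d_def using h_nn R_nn by (auto intro!: Bochner_Integration.integral_nonneg)
  have factor: "a k * exp (- (C * d k / p)) \<le> expectation (\<lambda>\<omega>. I k \<omega> * exp (- (C * (r ^ k * R \<omega>))))" for k
  proof -
    have ak: "0 < a k" using a_ge[of k] p by simp
    \<comment> \<open>This is the conditional mean of the exponent. The tangent line of the
      exponential at \<open>m\<close> integrates over the event to exactly a_k exp(-m), which gives
      Jensen's inequality without introducing a conditional measure.\<close>
    define m where "m = C * d k / a k"
    have "a k * exp (- (C * d k / p)) \<le> a k * exp (- m)"
      using a_ge[of k] p C d_nn[of k] ak
      by (auto simp: m_def intro!: mult_left_mono divide_left_mono mult_nonneg_nonneg)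
    also have "\<dots> = expectation (\<lambda>\<omega>. exp (- m) * ((1 + m) * I k \<omega> - C * h k (R \<omega>)))"
    proof -
      have "expectation (I k) = a k" by (simp add: I_def a_def)
      then show ?thesis using ak by (simp add: I_int h_int d_def[symmetric] m_def field_simps)
    qed
    also have "\<dots> \<le> expectation (\<lambda>\<omega>. I k \<omega> * exp (- (C * (r ^ k * R \<omega>))))"
    proof (rule integral_mono)
      show "integrable M (\<lambda>\<omega>. I k \<omega> * exp (- (C * (r ^ k * R \<omega>))))"
        by (rule integrable_const_bound[where B=1]) (use C r R_nn in \<open>auto simp: I_def indicator_def\<close>)
      fix \<omega> assume w: "\<omega> \<in> space M"
      show "exp (- m) * ((1 + m) * I k \<omega> - C * h k (R \<omega>)) \<le> I k \<omega> * exp (- (C * (r ^ k * R \<omega>)))"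
      proof (cases "r ^ k * R \<omega> \<le> y")
        case True
        have "exp (- m) * (1 + (m - C * (r ^ k * R \<omega>))) \<le> exp (- m) * exp (m - C * (r ^ k * R \<omega>))"
          by (intro mult_left_mono exp_ge_add_one_self) auto
        also have "\<dots> = exp (- (C * (r ^ k * R \<omega>)))" by (simp flip: exp_add)
        finally show ?thesis using True w by (simp add: I_def h_def algebra_simps)
      qed (use w in \<open>simp add: I_def h_def\<close>)
    qed (auto intro!: I_int h_int)
    finally show ?thesis .
  qed
  have d_sum: "(\<Sum>k<n. d k) \<le> y / (1 - r)" for n
  proof -
    have "(\<Sum>k<n. d k) = expectation (\<lambda>\<omega>. \<Sum>k<n. h k (R \<omega>))"
      unfolding d_def by (rule Bochner_Integration.integral_sum[symmetric]) (rule h_int)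
    also have "\<dots> \<le> expectation (\<lambda>\<omega>. y / (1 - r))"
      using sum_scales_below_le[OF r y R_nn] h_int
      by (intro integral_mono) (auto simp: h_def)
    finally show ?thesis by (simp add: prob_space)
  qed
  define c where "c = exp (- (C * (y / (1 - r)) / p))"
  have "c * (\<Prod>k<n. a k) \<le> (\<Prod>k<n. expectation (\<lambda>\<omega>. I k \<omega> * exp (- (C * (r ^ k * R \<omega>)))))" for n
  proof -
    have "c * (\<Prod>k<n. a k) \<le> exp (- (C * (\<Sum>k<n. d k) / p)) * (\<Prod>k<n. a k)"
      unfolding c_def using d_sum[of n] C p
      by (intro mult_right_mono iffD2[OF exp_le_cancel_iff] iffD2[OF neg_le_iff_le]
          divide_right_mono mult_left_mono prod_nonneg) (simp_all add: a_def)
    also have "\<dots> = (\<Prod>k<n. a k * exp (- (C * d k / p)))"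
      by (simp add: prod.distrib exp_sum sum_distrib_left sum_divide_distrib mult.commute sum_negf[symmetric])
    also have "\<dots> \<le> (\<Prod>k<n. expectation (\<lambda>\<omega>. I k \<omega> * exp (- (C * (r ^ k * R \<omega>)))))"
      using factor by (intro prod_mono) (auto simp: a_def)
    finally show ?thesis .
  qed
  moreover have "0 < c" by (simp add: c_def)
  ultimately show ?thesis using that by (auto simp: a_def I_def)
qed

end

section \<open>Autoregressive processes\<close>

lemma infnorm_cart_le_iff:
  fixes x :: "real^'d"
  shows "infnorm x \<le> b \<longleftrightarrow> (\<forall>i. \<bar>x $ i\<bar> \<le> b)"
proof
  assume "infnorm x \<le> b"
  then show "\<forall>i. \<bar>x $ i\<bar> \<le> b" by (meson component_le_infnorm_cart order_trans)
next
  assume le: "\<forall>i. \<bar>x $ i\<bar> \<le> b"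
  have "\<bar>x \<bullet> v\<bar> \<le> b" if v: "v \<in> Basis" for v :: "real^'d"
  proof -
    obtain i where "v = axis i 1" using v by (auto simp: Basis_vec_def)
    then show ?thesis using le by (simp add: inner_axis)
  qed
  then show "infnorm x \<le> b"
    unfolding infnorm_Max by (subst Max_le_iff) auto
qed

lemma borel_measurable_infnorm [measurable]: "(infnorm :: real^'d \<Rightarrow> real) \<in> borel_measurable borel"
  by (intro borel_measurable_continuous_onI continuous_intros)

lemma borel_measurable_nth:
  fixes f :: "'a \<Rightarrow> ('b::topological_space)^'d"
  assumes "f \<in> borel_measurable M"
  shows "(\<lambda>x. f x $ i) \<in> borel_measurable M"
  by (rule measurable_compose[OF assms borel_measurable_continuous_onI]) (intro continuous_intros)

lemma borel_measurable_cart_iff: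
  fixes f :: "'a \<Rightarrow> real^'d"
  shows "f \<in> borel_measurable M \<longleftrightarrow> (\<forall>i. (\<lambda>x. f x $ i) \<in> borel_measurable M)"
proof
  assume "f \<in> borel_measurable M"
  then show "\<forall>i. (\<lambda>x. f x $ i) \<in> borel_measurable M" by (blast intro: borel_measurable_nth)
next
  assume *: "\<forall>i. (\<lambda>x. f x $ i) \<in> borel_measurable M"
  show "f \<in> borel_measurable M"
  proof (rule iffD2[OF borel_measurable_euclidean_space], rule ballI)
    fix v :: "real^'d" assume "v \<in> Basis"
    then obtain i where "v = axis i 1" by (auto simp: Basis_vec_def)
    then show "(\<lambda>x. f x \<bullet> v) \<in> borel_measurable M" using * by (simp add: inner_axis)
  qed
qed

lemma borel_measurable_matrix_vector_mult [measurable (raw)]: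
  fixes A :: "'a \<Rightarrow> real^'d^'d"
  assumes A: "A \<in> borel_measurable M" and x: "x \<in> borel_measurable M"
  shows "(\<lambda>\<omega>. A \<omega> *v x \<omega>) \<in> borel_measurable M"
  unfolding borel_measurable_cart_iff
proof
  show "(\<lambda>\<omega>. (A \<omega> *v x \<omega>) $ i) \<in> borel_measurable M" for i
    unfolding matrix_vector_mult_def vec_lambda_beta
    using borel_measurable_nth[OF borel_measurable_nth[OF A]] borel_measurable_nth[OF x]
    by (intro borel_measurable_sum borel_measurable_times) auto
qed

text \<open>This converts between norm bounds and bounds on the scalar u.x. The constants are the
  smallest entry and the sum of the entries of \<open>u\<close>.\<close>

lemma positive_weights_infnorm:
  fixes u :: "real^'d"
  assumes u: "\<And>i. 0 < u $ i"
  obtains c C where "0 < c" "0 < C" "\<And>x. nonneg_vec x \<Longrightarrow> c * infnorm x \<le> u \<bullet> x"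
    "\<And>x. nonneg_vec x \<Longrightarrow> u \<bullet> x \<le> C * infnorm x"
proof -
  define c where "c = Min (range (\<lambda>i. u $ i))"
  define C where "C = (\<Sum>i\<in>UNIV. u $ i)"
  have "c \<in> range (\<lambda>i. u $ i)" unfolding c_def by (rule Min_in) auto
  then have c: "0 < c" using u by force
  have c_le: "c \<le> u $ i" for i unfolding c_def by (rule Min_le) auto
  have C: "0 < C" unfolding C_def by (rule sum_pos) (use u in simp_all)
  have "c * infnorm x \<le> u \<bullet> x" if x: "nonneg_vec x" for x
  proof -
    have "\<bar>x $ i\<bar> \<le> (u \<bullet> x) / c" for i
    proof -
      have "c * x $ i \<le> u $ i * x $ i" using c_le x by (intro mult_right_mono) (simp_all add: nonneg_vec_def)
      also have "\<dots> \<le> u \<bullet> x"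
        unfolding inner_vec_def inner_real_def
        by (rule member_le_sum) (use u x in \<open>simp_all add: nonneg_vec_def less_imp_le\<close>)
      finally show ?thesis using c x by (simp add: nonneg_vec_def pos_le_divide_eq mult.commute)
    qed
    then have "infnorm x \<le> (u \<bullet> x) / c" by (simp add: infnorm_cart_le_iff)
    then show ?thesis using c by (simp add: pos_le_divide_eq mult.commute)
  qed
  moreover have "u \<bullet> x \<le> C * infnorm x" if x: "nonneg_vec x" for x
  proof -
    have "u \<bullet> x \<le> (\<Sum>i\<in>UNIV. u $ i * infnorm x)"
      unfolding inner_vec_def
    proof (rule sum_mono)
      fix i
      have "x $ i \<le> infnorm x" using component_le_infnorm_cart[of x i] by simp
      then show "u $ i \<bullet> x $ i \<le> u $ i * infnorm x"
        unfolding inner_real_def by (rule mult_left_mono) (use u[of i] in simp)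
    qed
    then show ?thesis by (simp add: C_def sum_distrib_right)
  qed
  ultimately show ?thesis by (rule that[OF c C])
qed

lemma suminf_ennreal_infinite_comparison:
  assumes le: "\<And>n. f n \<le> C * g n" and C: "0 < C" and g: "\<And>n. 0 \<le> g n"
    and inf: "(\<Sum>n. ennreal (f n)) = \<infinity>"
  shows "(\<Sum>n. ennreal (g n)) = \<infinity>"
proof -
  have "(\<Sum>n. ennreal (f n)) \<le> (\<Sum>n. ennreal C * ennreal (g n))"
    using le C g by (intro suminf_le) (auto simp: ennreal_mult[symmetric] intro!: ennreal_leI)
  also have "\<dots> = ennreal C * (\<Sum>n. ennreal (g n))" by simp
  finally show ?thesis using inf by (auto simp: top_unique ennreal_mult_eq_top_iff)
qed

text \<open>Where T > b the integrand is at most exp(-b) h, so whatever the moment has beyond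
  exp(-b) E[h] must come from T <= b. Later \<open>h\<close> is the indicator of the event that all
  scaled immigrants are small.\<close>

lemma (in prob_space) prob_le_exp_moment_ge:
  assumes T[measurable]: "random_variable borel T" and h[measurable]: "random_variable borel h"
    and h01: "\<And>\<omega>. 0 \<le> h \<omega>" "\<And>\<omega>. h \<omega> \<le> 1"
    and T_nn: "\<And>\<omega>. \<omega> \<in> space M \<Longrightarrow> 0 \<le> T \<omega>"
  shows "expectation (\<lambda>\<omega>. h \<omega> * exp (- T \<omega>)) - exp (- b) * expectation h \<le> prob {\<omega>\<in>space M. T \<omega> \<le> b}"
proof -
  have h_int: "integrable M h" by (rule integrable_const_bound[where B=1]) (use h01 in auto)
  have "h \<omega> * exp (- T \<omega>) \<le> indicator {\<omega>\<in>space M. T \<omega> \<le> b} \<omega> + exp (- b) * h \<omega>" if "\<omega> \<in> space M" for \<omega>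
  proof (cases "T \<omega> \<le> b")
    case True
    have "h \<omega> * exp (- T \<omega>) \<le> 1 * 1" using h01 T_nn that by (intro mult_mono) auto
    then show ?thesis using True that h01[of \<omega>] by (simp add: add_increasing2)
  next
    case False
    then have "h \<omega> * exp (- T \<omega>) \<le> h \<omega> * exp (- b)" using h01 by (intro mult_left_mono) auto
    then show ?thesis using False by (simp add: mult.commute)
  qed
  moreover have "integrable M (\<lambda>\<omega>. h \<omega> * exp (- T \<omega>))"
    by (rule integrable_const_bound[where B=1]) (use h01 T_nn in \<open>auto intro!: AE_I2 mult_le_one\<close>)
  moreover have "integrable M (\<lambda>\<omega>. indicator {\<omega>\<in>space M. T \<omega> \<le> b} \<omega> :: real)"
    by (rule integrable_const_bound[where B=1]) auto
  ultimately have "expectation (\<lambda>\<omega>. h \<omega> * exp (- T \<omega>)) \<le>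
      expectation (\<lambda>\<omega>. indicator {\<omega>\<in>space M. T \<omega> \<le> b} \<omega> + exp (- b) * h \<omega>)"
    using h_int by (intro integral_mono) auto
  also have "\<dots> = prob {\<omega>\<in>space M. T \<omega> \<le> b} + exp (- b) * expectation h"
    using h_int \<open>integrable M (\<lambda>\<omega>. indicator _ \<omega> :: real)\<close>
    by (subst Bochner_Integration.integral_add) auto
  finally show ?thesis by simp
qed

context autoregressive_setting
begin

lemma Y_indep: "indep_vars (\<lambda>_. borel) Y {1..}"
  using indep_vars_compose2[of "\<lambda>_. borel \<Otimes>\<^sub>M borel" "\<lambda>n \<omega>. (A n \<omega>, Y n \<omega>)" "{1..}" "\<lambda>_. snd" "\<lambda>_. borel"] AY_iid
  by (simp add: iid_def)

lemma Y_distr: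
  assumes "1 \<le> n"
  shows "distr M borel (Y n) = distr M borel (Y 1)"
proof -
  have snd: "distr M borel (Y n) = distr (distr M (borel \<Otimes>\<^sub>M borel) (\<lambda>\<omega>. (A n \<omega>, Y n \<omega>))) borel snd" if "1 \<le> n" for n
    using A_measurable[OF that] Y_measurable[of n] by (subst distr_distr) (auto simp: comp_def)
  have "distr M (borel \<Otimes>\<^sub>M borel) (\<lambda>\<omega>. (A n \<omega>, Y n \<omega>)) = distr M (borel \<Otimes>\<^sub>M borel) (\<lambda>\<omega>. (A 1 \<omega>, Y 1 \<omega>))"
    by (rule AY_iid[unfolded iid_def, THEN conjunct2, THEN bspec, THEN bspec]) (use assms in simp_all)
  then show ?thesis using snd[OF assms] snd[OF order_refl] by (simp only:)
qed

text \<open>Time reversal: an immigrant of time \<open>l\<close> is seen at time \<open>n\<close> at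
  scale n - l. As the immigrants are i.i.d., every factor can be evaluated at \<open>Y 1\<close>,
  and k = n - l runs through 0, ..., n - 1.\<close>

lemma expectation_prod_Y:
  fixes G :: "nat \<Rightarrow> real^'d \<Rightarrow> real"
  assumes G[measurable]: "\<And>k. G k \<in> borel_measurable borel"
    and G01: "\<And>k x. 0 \<le> G k x" "\<And>k x. G k x \<le> 1"
  shows "expectation (\<lambda>\<omega>. \<Prod>l=1..n. G (n - l) (Y l \<omega>)) = (\<Prod>k<n. expectation (\<lambda>\<omega>. G k (Y 1 \<omega>)))"
proof -
  have Ym[measurable]: "random_variable borel (Y l)" for l by (rule Y_measurable)
  have "indep_vars (\<lambda>_. borel) Y {1..n}"
    by (rule indep_vars_subset[OF Y_indep]) auto
  from indep_vars_compose2[OF this, of "\<lambda>l. G (n - l)" "\<lambda>_. borel"]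
  have "indep_vars (\<lambda>_. borel) (\<lambda>l \<omega>. G (n - l) (Y l \<omega>)) {1..n}" by simp
  then have "expectation (\<lambda>\<omega>. \<Prod>l=1..n. G (n - l) (Y l \<omega>)) =
      (\<Prod>l=1..n. expectation (\<lambda>\<omega>. G (n - l) (Y l \<omega>)))"
    using G01 by (intro indep_vars_lebesgue_integral)
      (auto intro!: integrable_const_bound[where B=1])
  also have "\<dots> = (\<Prod>l=1..n. expectation (\<lambda>\<omega>. G (n - l) (Y 1 \<omega>)))"
  proof (rule prod.cong[OF refl])
    fix l assume "l \<in> {1..n}"
    then have l: "1 \<le> l" by simp
    have "expectation (\<lambda>\<omega>. G (n - l) (Y m \<omega>)) = (\<integral>x. G (n - l) x \<partial>distr M borel (Y m))" for m
      by (simp add: integral_distr)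
    then show "expectation (\<lambda>\<omega>. G (n - l) (Y l \<omega>)) = expectation (\<lambda>\<omega>. G (n - l) (Y 1 \<omega>))"
      using Y_distr[OF l] by simp
  qed
  also have "\<dots> = (\<Prod>k<n. expectation (\<lambda>\<omega>. G k (Y 1 \<omega>)))"
    by (rule prod.reindex_bij_witness[of _ "\<lambda>k. n - k" "\<lambda>l. n - l"]) auto
  finally show ?thesis .
qed

end

text \<open>The rate \<open>r\<close> enters only as the eigenvalue of a positive left eigenvector.
  It is identified with the spectral radius once, in the final proof.\<close>

locale constant_matrix_setting = autoregressive_setting M A Y
  for M :: "'w measure"
    and A :: "nat \<Rightarrow> 'w \<Rightarrow> real^'d^'d"
    and Y :: "nat \<Rightarrow> 'w \<Rightarrow> real^'d" +
  fixes A0 :: "real^'d^'d" and u :: "real^'d" and r y :: real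
  assumes A0_nonneg: "nonneg_mat A0"
    and u_pos: "\<And>i. 0 < u $ i"
    and r: "0 < r" "r < 1"
    and eigenvector: "\<And>z. u \<bullet> (A0 *v z) = r * (u \<bullet> z)"
    and A_eq: "AE \<omega> in M. \<forall>n\<ge>1. A n \<omega> = A0"
    and y: "0 < y"
    and Y_small: "0 < prob {\<omega>\<in>space M. infnorm (Y 1 \<omega>) \<le> y}"
begin

abbreviation p :: "nat \<Rightarrow> real" where
  "p k \<equiv> prob {\<omega>\<in>space M. r ^ k * infnorm (Y 1 \<omega>) \<le> y}"

definition Y0 :: "nat \<Rightarrow> 'w \<Rightarrow> real^'d" where
  "Y0 = Y(0 := (\<lambda>_. 0))"

lemma Y0_simps [simp]: "Y0 0 = (\<lambda>_. 0)" "Y0 (Suc n) = Y (Suc n)"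
  by (simp_all add: Y0_def)

lemma recurrent_iff:
  "recurrent M V Y \<longleftrightarrow> (\<exists>b>0. (\<Sum>n. emeasure M {\<omega> \<in> space M. infnorm (V Y0 n \<omega>) \<le> b}) = \<infinity>)"
  by (simp add: recurrent_def Y0_def)

lemma Y_borel [measurable]: "random_variable borel (Y n)"
  by (rule Y_measurable)

lemma Y0_measurable [measurable]: "random_variable borel (Y0 n)"
  by (cases n) auto

lemma infnorm_nonneg: "0 \<le> infnorm (Y n \<omega>)"
  by (rule infnorm_pos_le)

text \<open>The two products differ by the single factor \<open>p n\<close>, which lies between p 0
  > 0 and 1. This reconciles the range 0, ..., n of the criterion with the \<open>n\<close>
  immigrants that act up to time \<open>n\<close>.\<close>

lemma suminf_prod_shift:
  "(\<Sum>n. ennreal (\<Prod>k=0..n. p k)) = \<infinity> \<longleftrightarrow> (\<Sum>n. ennreal (\<Prod>k<n. p k)) = \<infinity>"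
proof -
  have eq: "(\<Prod>k=0..n. p k) = (\<Prod>k<n. p k) * p n" for n
    by (simp add: atLeast0AtMost lessThan_Suc_atMost[symmetric])
  have nn: "0 \<le> (\<Prod>k<n. p k)" for n by (simp add: prod_nonneg)
  have ge: "p 0 \<le> p n" for n
  proof (rule finite_measure_mono)
    show "{\<omega> \<in> space M. r ^ 0 * infnorm (Y 1 \<omega>) \<le> y} \<subseteq> {\<omega> \<in> space M. r ^ n * infnorm (Y 1 \<omega>) \<le> y}"
      using r by (auto intro: order_trans[OF mult_left_le_one_le] simp: power_le_one infnorm_pos_le)
  qed measurable
  have p0: "0 < p 0" using Y_small by simp
  show ?thesis
  proof
    assume "(\<Sum>n. ennreal (\<Prod>k=0..n. p k)) = \<infinity>"
    then show "(\<Sum>n. ennreal (\<Prod>k<n. p k)) = \<infinity>"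
      by (rule suminf_ennreal_infinite_comparison[where C=1, rotated 3])
        (auto simp only: eq mult_1 zero_less_one intro!: nn mult_right_le_one_le prob_le_1 measure_nonneg)
  next
    assume "(\<Sum>n. ennreal (\<Prod>k<n. p k)) = \<infinity>"
    then show "(\<Sum>n. ennreal (\<Prod>k=0..n. p k)) = \<infinity>"
    proof (rule suminf_ennreal_infinite_comparison[where C="1 / p 0", rotated 3])
      fix n
      have "(\<Prod>k<n. p k) * p 0 \<le> (\<Prod>k<n. p k) * p n" using nn ge by (rule mult_left_mono[rotated])
      then show "(\<Prod>k<n. p k) \<le> 1 / p 0 * (\<Prod>k=0..n. p k)"
        unfolding eq times_divide_eq_left mult_1 using p0 by (simp only: pos_le_divide_eq)
    qed (use p0 in \<open>auto intro!: prod_nonneg\<close>)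
  qed
qed

lemma recurrent_imp_sum:
  assumes rec: "recurrent M V Y"
    and bound: "\<And>b. 0 < b \<Longrightarrow> \<exists>D>0. \<forall>n. prob {\<omega>\<in>space M. infnorm (V Y0 n \<omega>) \<le> b} \<le> D * (\<Prod>k<n. p k)"
  shows "(\<Sum>n. ennreal (\<Prod>k<n. p k)) = \<infinity>"
proof -
  obtain b where b: "0 < b" "(\<Sum>n. emeasure M {\<omega> \<in> space M. infnorm (V Y0 n \<omega>) \<le> b}) = \<infinity>"
    using rec by (auto simp: recurrent_iff)
  obtain D where "0 < D" "\<And>n. prob {\<omega>\<in>space M. infnorm (V Y0 n \<omega>) \<le> b} \<le> D * (\<Prod>k<n. p k)"
    using bound[OF b(1)] by blast
  then show ?thesis
    using b(2) unfolding emeasure_eq_measure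
    by (elim suminf_ennreal_infinite_comparison[rotated 3]) (auto intro!: prod_nonneg)
qed

text \<open>The common half for X and Z. Assumption \<open>lower\<close> bounds the Laplace
  transform of u.V_n, restricted to small scaled immigrants, by independent factors; these amount to
  at least \<open>c\<close> times the probability of the restricting event, which is the product of
  the p_k.\<close>

lemma sum_imp_recurrent:
  assumes sum: "(\<Sum>n. ennreal (\<Prod>k<n. p k)) = \<infinity>"
    and V_meas[measurable]: "\<And>n. random_variable borel (V Y0 n)"
    and V_nonneg: "\<And>n \<omega>. \<omega> \<in> space M \<Longrightarrow> nonneg_vec (V Y0 n \<omega>)"
    and C: "0 \<le> C"
    and lower: "\<And>n. (\<Prod>k<n. expectation (\<lambda>\<omega>. indicator {\<omega>\<in>space M. r ^ k * infnorm (Y 1 \<omega>) \<le> y} \<omega> *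
          exp (- (C * (r ^ k * infnorm (Y 1 \<omega>)))))) \<le>
        expectation (\<lambda>\<omega>. (\<Prod>l=1..n. indicator {x. r ^ (n - l) * infnorm x \<le> y} (Y l \<omega>)) * exp (- (u \<bullet> V Y0 n \<omega>)))"
  shows "recurrent M V Y"
proof -
  obtain c where c: "0 < c" "\<And>n. c * (\<Prod>k<n. p k) \<le>
      (\<Prod>k<n. expectation (\<lambda>\<omega>. indicator {\<omega>\<in>space M. r ^ k * infnorm (Y 1 \<omega>) \<le> y} \<omega> *
          exp (- (C * (r ^ k * infnorm (Y 1 \<omega>))))))"
    using prod_expectation_exp_scaled_ge[of "\<lambda>\<omega>. infnorm (Y 1 \<omega>)" r y C] infnorm_nonneg r y C Y_small
    by auto
  obtain cu where cu: "0 < cu" "\<And>x. nonneg_vec x \<Longrightarrow> cu * infnorm x \<le> u \<bullet> x"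
    using positive_weights_infnorm[of u] u_pos by metis
  \<comment> \<open>The choice makes exp(-b) <= c/2, so that half of the lower bound survives the
    subtraction; the maximum with 1 keeps \<open>b\<close> positive.\<close>
  define b where "b = max 1 (- ln (c / 2))"
  have "exp (- b) \<le> exp (ln (c / 2))" by (simp add: b_def)
  then have b: "0 < b" "exp (- b) \<le> c / 2" using c by (simp_all add: b_def)
  have step: "c / 2 * (\<Prod>k<n. p k) \<le> prob {\<omega>\<in>space M. infnorm (V Y0 n \<omega>) \<le> b / cu}" for n
  proof -
    define h where "h \<omega> = (\<Prod>l=1..n. indicator {x. r ^ (n - l) * infnorm x \<le> y} (Y l \<omega>) :: real)" for \<omega>
    have h_meas[measurable]: "random_variable borel h" unfolding h_def by measurable
    have h01: "0 \<le> h \<omega>" "h \<omega> \<le> 1" for \<omega>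
      by (auto simp: h_def intro!: prod_nonneg prod_le_1)
    have "expectation h = (\<Prod>k<n. expectation (\<lambda>\<omega>. indicator {x. r ^ k * infnorm x \<le> y} (Y 1 \<omega>)))"
      unfolding h_def by (rule expectation_prod_Y) auto
    also have "\<dots> = (\<Prod>k<n. p k)"
    proof (rule prod.cong[OF refl])
      fix k
      have "expectation (\<lambda>\<omega>. indicator {x. r ^ k * infnorm x \<le> y} (Y 1 \<omega>)) =
          expectation (indicator {\<omega>\<in>space M. r ^ k * infnorm (Y 1 \<omega>) \<le> y})"
        by (intro Bochner_Integration.integral_cong) (auto simp: indicator_def)
      also have "\<dots> = p k" by simp
      finally show "expectation (\<lambda>\<omega>. indicator {x. r ^ k * infnorm x \<le> y} (Y 1 \<omega>)) = p k" .
    qed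
    finally have Eh: "expectation h = (\<Prod>k<n. p k)" .
    have "c / 2 * (\<Prod>k<n. p k) \<le> (c - exp (- b)) * (\<Prod>k<n. p k)"
      using b by (intro mult_right_mono) (auto intro!: prod_nonneg)
    also have "\<dots> = c * (\<Prod>k<n. p k) - exp (- b) * expectation h"
      by (simp add: Eh algebra_simps)
    also have "\<dots> \<le> expectation (\<lambda>\<omega>. h \<omega> * exp (- (u \<bullet> V Y0 n \<omega>))) - exp (- b) * expectation h"
      using order_trans[OF c(2) lower, of n] by (simp add: h_def)
    also have "\<dots> \<le> prob {\<omega>\<in>space M. u \<bullet> V Y0 n \<omega> \<le> b}"
    proof (rule prob_le_exp_moment_ge)
      show "0 \<le> u \<bullet> V Y0 n \<omega>" if "\<omega> \<in> space M" for \<omega>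
        using V_nonneg[OF that, of n] u_pos by (auto simp: inner_vec_def nonneg_vec_def less_imp_le intro!: sum_nonneg)
    qed (use h01 in auto)
    also have "\<dots> \<le> prob {\<omega>\<in>space M. infnorm (V Y0 n \<omega>) \<le> b / cu}"
    proof (rule finite_measure_mono)
      show "{\<omega>\<in>space M. u \<bullet> V Y0 n \<omega> \<le> b} \<subseteq> {\<omega>\<in>space M. infnorm (V Y0 n \<omega>) \<le> b / cu}"
        using cu(2)[OF V_nonneg] cu(1) by (auto simp: field_simps intro: order_trans)
    qed measurable
    finally show ?thesis .
  qed
  have "(\<Sum>n. ennreal (prob {\<omega>\<in>space M. infnorm (V Y0 n \<omega>) \<le> b / cu})) = \<infinity>"
  proof (rule suminf_ennreal_infinite_comparison[OF _ _ _ sum])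
    show "(\<Prod>k<n. p k) \<le> 2 / c * prob {\<omega>\<in>space M. infnorm (V Y0 n \<omega>) \<le> b / cu}" for n
      using step[of n] c(1) by (simp add: field_simps)
  qed (use c in auto)
  then show ?thesis
    unfolding recurrent_iff emeasure_eq_measure using b(1) cu(1) by (intro exI[of _ "b / cu"]) auto
qed

section \<open>Measurability, positivity and the scalar recursions along \<open>u\<close>\<close>

lemma ar_process_measurable [measurable]: "random_variable borel (ar_process A Y0 n)"
proof (induction n)
  case 0
  then show ?case by simp
next
  case (Suc n)
  have "random_variable borel (\<lambda>\<omega>. A (Suc n) \<omega> *v ar_process A Y0 n \<omega>)"
    using A_measurable[of "Suc n"] Suc by (intro borel_measurable_matrix_vector_mult) auto
  then show ?case using Y_borel[of "Suc n"] by (auto intro!: borel_measurable_add)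
qed

lemma max_ar_process_measurable [measurable]: "random_variable borel (max_ar_process A Y0 n)"
proof (induction n)
  case 0
  then show ?case by simp
next
  case (Suc n)
  have "random_variable borel (\<lambda>\<omega>. A (Suc n) \<omega> *v max_ar_process A Y0 n \<omega>)"
    using A_measurable[of "Suc n"] Suc by (intro borel_measurable_matrix_vector_mult) auto
  then show ?case
    unfolding borel_measurable_cart_iff max_ar_process.simps vec_lambda_beta
    using borel_measurable_nth[OF Y0_measurable[of "Suc n"]]
    by (auto simp: borel_measurable_cart_iff intro!: borel_measurable_max)
qed

lemma ar_process_nonneg: "\<omega> \<in> space M \<Longrightarrow> nonneg_vec (ar_process A Y0 n \<omega>)"
proof (induction n)
  case (Suc n)
  then show ?case
    using nonneg_mat_vec[OF A_nonneg[of "Suc n" \<omega>], of "ar_process A Y0 n \<omega>"] Y_nonneg[of \<omega> "Suc n"]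
    by (simp add: nonneg_vec_def)
qed (simp add: nonneg_vec_def)

lemma max_ar_process_nonneg: "\<omega> \<in> space M \<Longrightarrow> nonneg_vec (max_ar_process A Y0 n \<omega>)"
proof (induction n)
  case (Suc n)
  then show ?case
    using Y_nonneg[of \<omega> "Suc n"]
    by (simp add: nonneg_vec_def le_max_iff_disj)
qed (simp add: nonneg_vec_def)

lemma max_ar_process_le_ar_process:
  "\<omega> \<in> space M \<Longrightarrow> max_ar_process A Y0 n \<omega> $ i \<le> ar_process A Y0 n \<omega> $ i"
proof (induction n arbitrary: i)
  case (Suc n)
  have "(A (Suc n) \<omega> *v max_ar_process A Y0 n \<omega>) $ i \<le> (A (Suc n) \<omega> *v ar_process A Y0 n \<omega>) $ i"
    using Suc A_nonneg[of "Suc n" \<omega>]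
    by (auto simp: matrix_vector_mult_def nonneg_mat_def intro!: sum_mono mult_left_mono)
  moreover have "0 \<le> (A (Suc n) \<omega> *v ar_process A Y0 n \<omega>) $ i"
    using nonneg_mat_vec[OF A_nonneg[of "Suc n" \<omega>] ar_process_nonneg] Suc.prems by (simp add: nonneg_vec_def)
  ultimately show ?case
    using Y_nonneg[OF Suc.prems, of "Suc n"] by (auto simp: nonneg_vec_def add_increasing add_increasing2)
qed simp

lemma ar_process_eigenvector:
  assumes "\<forall>n\<ge>1. A n \<omega> = A0"
  shows "u \<bullet> ar_process A Y0 n \<omega> = (\<Sum>l=1..n. r ^ (n - l) * (u \<bullet> Y l \<omega>))"
proof (induction n)
  case (Suc n)
  have "u \<bullet> ar_process A Y0 (Suc n) \<omega> = r * (\<Sum>l=1..n. r ^ (n - l) * (u \<bullet> Y l \<omega>)) + u \<bullet> Y (Suc n) \<omega>"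
    using assms Suc by (simp add: eigenvector inner_add_right)
  also have "r * (\<Sum>l=1..n. r ^ (n - l) * (u \<bullet> Y l \<omega>)) = (\<Sum>l=1..n. r ^ (Suc n - l) * (u \<bullet> Y l \<omega>))"
    unfolding sum_distrib_left by (intro sum.cong) (auto simp: Suc_diff_le)
  finally show ?case by simp
qed simp

text \<open>The maximum dominates each of its arguments: Y_l at time \<open>l\<close>, and
  afterwards A M, whose pairing with \<open>u\<close> is \<open>r\<close> times the previous
  one.\<close>

lemma max_ar_process_eigenvector:
  assumes "\<forall>n\<ge>1. A n \<omega> = A0" and "1 \<le> l" "l \<le> n"
  shows "r ^ (n - l) * (u \<bullet> Y l \<omega>) \<le> u \<bullet> max_ar_process A Y0 n \<omega>"
  using assms(3)
proof (induction n rule: dec_induct)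
  case base
  obtain m where "l = Suc m" using assms(2) by (cases l) auto
  then have "Y l \<omega> $ i \<le> max_ar_process A Y0 l \<omega> $ i" for i by simp
  then show ?case
    unfolding inner_vec_def inner_real_def diff_self_eq_0 power_0 mult_1
    by (intro sum_mono mult_left_mono) (use u_pos in \<open>simp_all add: less_imp_le\<close>)
next
  case (step n)
  have "r ^ (Suc n - l) * (u \<bullet> Y l \<omega>) = r * (r ^ (n - l) * (u \<bullet> Y l \<omega>))"
    using step by (simp add: Suc_diff_le)
  also have "\<dots> \<le> r * (u \<bullet> max_ar_process A Y0 n \<omega>)"
    using step r by (intro mult_left_mono) auto
  also have "\<dots> = u \<bullet> (A (Suc n) \<omega> *v max_ar_process A Y0 n \<omega>)"
    using assms(1) by (simp add: eigenvector)
  also have "\<dots> \<le> u \<bullet> max_ar_process A Y0 (Suc n) \<omega>"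
    unfolding inner_vec_def inner_real_def
    by (intro sum_mono mult_left_mono) (use u_pos in \<open>simp_all add: less_imp_le\<close>)
  finally show ?case .
qed

section \<open>Recurrence of X and M against divergence of the series\<close>

lemma ar_recurrent_imp_max_ar_recurrent:
  assumes "recurrent M (ar_process A) Y"
  shows "recurrent M (max_ar_process A) Y"
proof -
  obtain b where b: "0 < b" "(\<Sum>n. emeasure M {\<omega> \<in> space M. infnorm (ar_process A Y0 n \<omega>) \<le> b}) = \<infinity>"
    using assms by (auto simp: recurrent_iff)
  have "emeasure M {\<omega> \<in> space M. infnorm (ar_process A Y0 n \<omega>) \<le> b} \<le>
      emeasure M {\<omega> \<in> space M. infnorm (max_ar_process A Y0 n \<omega>) \<le> b}" for n
  proof (rule emeasure_mono)
    have "infnorm (max_ar_process A Y0 n \<omega>) \<le> infnorm (ar_process A Y0 n \<omega>)" if w: "\<omega> \<in> space M" for \<omega>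
      unfolding infnorm_cart_le_iff
    proof
      fix i
      have "\<bar>max_ar_process A Y0 n \<omega> $ i\<bar> \<le> \<bar>ar_process A Y0 n \<omega> $ i\<bar>"
        using max_ar_process_le_ar_process[OF w, of n i] max_ar_process_nonneg[OF w, of n]
        by (simp add: nonneg_vec_def)
      also have "\<dots> \<le> infnorm (ar_process A Y0 n \<omega>)" by (rule component_le_infnorm_cart)
      finally show "\<bar>max_ar_process A Y0 n \<omega> $ i\<bar> \<le> infnorm (ar_process A Y0 n \<omega>)" .
    qed
    then show "{\<omega> \<in> space M. infnorm (ar_process A Y0 n \<omega>) \<le> b} \<subseteq>
        {\<omega> \<in> space M. infnorm (max_ar_process A Y0 n \<omega>) \<le> b}"
      by (auto intro: order_trans)
  qed measurable
  then have "\<infinity> \<le> (\<Sum>n. emeasure M {\<omega> \<in> space M. infnorm (max_ar_process A Y0 n \<omega>) \<le> b})"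
    unfolding b(2)[symmetric] by (rule suminf_le) auto
  then have "(\<Sum>n. emeasure M {\<omega> \<in> space M. infnorm (max_ar_process A Y0 n \<omega>) \<le> b}) = \<infinity>"
    by (simp add: top_unique)
  then show ?thesis using b(1) by (auto simp: recurrent_iff)
qed

lemma max_ar_recurrent_imp_sum:
  assumes rec: "recurrent M (max_ar_process A) Y"
  shows "(\<Sum>n. ennreal (\<Prod>k<n. p k)) = \<infinity>"
  using rec
proof (rule recurrent_imp_sum)
  fix b :: real assume b: "0 < b"
  obtain c C where u: "0 < c" "0 < C" "\<And>x. nonneg_vec x \<Longrightarrow> c * infnorm x \<le> u \<bullet> x"
    "\<And>x. nonneg_vec x \<Longrightarrow> u \<bullet> x \<le> C * infnorm x"
    using positive_weights_infnorm[of u] u_pos by metis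
  \<comment> \<open>If the norm of M_n is at most \<open>b\<close>, then c r^(n-l) times the norm of
    Y_l is at most u.M_n <= C b for every l in 1..n; so all scaled immigrants are at most
    \<open>t\<close>.\<close>
  define t where "t = C * b / c"
  \<comment> \<open>An indicator of x <= t satisfies g x <= t / x, so the product comparison
    replaces the threshold \<open>t\<close> by \<open>y\<close> at the cost of a constant.\<close>
  define g where "g x = (indicator {..t} x :: real)" for x
  have [measurable]: "g \<in> borel_measurable borel" unfolding g_def by measurable
  obtain D where D: "0 < D" "\<And>n. (\<Prod>k<n. expectation (\<lambda>\<omega>. g (r ^ k * infnorm (Y 1 \<omega>)))) \<le> D * (\<Prod>k<n. p k)"
  proof (rule prod_expectation_scaled_le[of "\<lambda>\<omega>. infnorm (Y 1 \<omega>)" r y g t])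
    show "g x \<le> t / x" if "0 < x" for x using that u b by (auto simp: g_def t_def indicator_def field_simps)
  qed (use infnorm_nonneg r y Y_small in \<open>auto simp: g_def indicator_def\<close>)
  have "prob {\<omega>\<in>space M. infnorm (max_ar_process A Y0 n \<omega>) \<le> b} \<le> D * (\<Prod>k<n. p k)" for n
  proof -
    have "prob {\<omega>\<in>space M. infnorm (max_ar_process A Y0 n \<omega>) \<le> b} =
        expectation (indicator {\<omega>\<in>space M. infnorm (max_ar_process A Y0 n \<omega>) \<le> b})" by simp
    also have "\<dots> \<le> expectation (\<lambda>\<omega>. \<Prod>l=1..n. g (r ^ (n - l) * infnorm (Y l \<omega>)))"
    proof (rule integral_mono_AE)
      show "AE \<omega> in M. indicator {\<omega>\<in>space M. infnorm (max_ar_process A Y0 n \<omega>) \<le> b} \<omega> \<le>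
          (\<Prod>l=1..n. g (r ^ (n - l) * infnorm (Y l \<omega>)))"
        using A_eq
      proof (rule AE_mp, intro AE_I2 impI)
        fix \<omega> assume w: "\<omega> \<in> space M" and A: "\<forall>n\<ge>1. A n \<omega> = A0"
        show "indicator {\<omega>\<in>space M. infnorm (max_ar_process A Y0 n \<omega>) \<le> b} \<omega> \<le>
          (\<Prod>l=1..n. g (r ^ (n - l) * infnorm (Y l \<omega>)))"
        proof (cases "infnorm (max_ar_process A Y0 n \<omega>) \<le> b")
          case True
          have "r ^ (n - l) * infnorm (Y l \<omega>) \<le> t" if l: "l \<in> {1..n}" for l
          proof -
            have "c * (r ^ (n - l) * infnorm (Y l \<omega>)) \<le> r ^ (n - l) * (u \<bullet> Y l \<omega>)"
              using u(3)[OF Y_nonneg[OF w], of l] r by (simp add: mult.left_commute mult_left_mono)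
            also have "\<dots> \<le> u \<bullet> max_ar_process A Y0 n \<omega>"
              using max_ar_process_eigenvector[OF A] l by simp
            also have "\<dots> \<le> C * infnorm (max_ar_process A Y0 n \<omega>)"
              by (rule u(4)[OF max_ar_process_nonneg[OF w]])
            also have "\<dots> \<le> C * b" using u True by (intro mult_left_mono) auto
            finally show ?thesis using u by (simp add: t_def field_simps)
          qed
          then show ?thesis by (simp add: g_def indicator_def)
        qed (auto simp: g_def intro!: prod_nonneg)
      qed
      show "integrable M (\<lambda>\<omega>. \<Prod>l=1..n. g (r ^ (n - l) * infnorm (Y l \<omega>)))"
        by (rule integrable_const_bound[where B=1])
          (auto simp: g_def abs_prod intro!: AE_I2 prod_le_1)
    qed (auto intro!: integrable_const_bound[where B=1])
    also have "\<dots> = (\<Prod>k<n. expectation (\<lambda>\<omega>. g (r ^ k * infnorm (Y 1 \<omega>))))"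
      using expectation_prod_Y[of "\<lambda>k x. g (r ^ k * infnorm x)" n] by (simp add: g_def)
    also have "\<dots> \<le> D * (\<Prod>k<n. p k)" by (rule D)
    finally show ?thesis .
  qed
  then show "\<exists>D>0. \<forall>n. prob {\<omega>\<in>space M. infnorm (max_ar_process A Y0 n \<omega>) \<le> b} \<le> D * (\<Prod>k<n. p k)"
    using D(1) by blast
qed

lemma sum_imp_ar_recurrent:
  assumes sum: "(\<Sum>n. ennreal (\<Prod>k<n. p k)) = \<infinity>"
  shows "recurrent M (ar_process A) Y"
proof -
  obtain C where C: "0 < C" "\<And>x. nonneg_vec x \<Longrightarrow> u \<bullet> x \<le> C * infnorm x"
    using positive_weights_infnorm[of u] u_pos by metis
  show ?thesis
  proof (rule sum_imp_recurrent[OF sum])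
    fix n
    define G where "G k x = (indicator {x. r ^ k * infnorm x \<le> y} x * exp (- (C * (r ^ k * infnorm x))) :: real)"
      for k and x :: "real^'d"
    have G[measurable]: "G k \<in> borel_measurable borel" for k unfolding G_def by measurable
    have G01: "0 \<le> G k x" "G k x \<le> 1" for k x
      using C r by (auto simp: G_def indicator_def infnorm_pos_le)
    have "(\<Prod>k<n. expectation (\<lambda>\<omega>. indicator {\<omega>\<in>space M. r ^ k * infnorm (Y 1 \<omega>) \<le> y} \<omega> *
          exp (- (C * (r ^ k * infnorm (Y 1 \<omega>)))))) = (\<Prod>k<n. expectation (\<lambda>\<omega>. G k (Y 1 \<omega>)))"
      by (intro prod.cong Bochner_Integration.integral_cong refl) (auto simp: G_def indicator_def)
    also have "\<dots> = expectation (\<lambda>\<omega>. \<Prod>l=1..n. G (n - l) (Y l \<omega>))"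
      by (rule expectation_prod_Y[symmetric]) (use G01 in auto)
    also have "\<dots> \<le> expectation (\<lambda>\<omega>. (\<Prod>l=1..n. indicator {x. r ^ (n - l) * infnorm x \<le> y} (Y l \<omega>)) *
        exp (- (u \<bullet> ar_process A Y0 n \<omega>)))"
    proof (rule integral_mono_AE)
      show "AE \<omega> in M. (\<Prod>l=1..n. G (n - l) (Y l \<omega>)) \<le>
          (\<Prod>l=1..n. indicator {x. r ^ (n - l) * infnorm x \<le> y} (Y l \<omega>)) * exp (- (u \<bullet> ar_process A Y0 n \<omega>))"
        using A_eq
      proof (rule AE_mp, intro AE_I2 impI)
        fix \<omega> assume w: "\<omega> \<in> space M" and A: "\<forall>n\<ge>1. A n \<omega> = A0"
        \<comment> \<open>The exponent is dominated by a sum over \<open>l\<close>, so the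
          exponential splits into factors each depending on one immigrant.\<close>
        have "u \<bullet> ar_process A Y0 n \<omega> \<le> (\<Sum>l=1..n. C * (r ^ (n - l) * infnorm (Y l \<omega>)))"
          unfolding ar_process_eigenvector[OF A]
          using C(2)[OF Y_nonneg[OF w]] r by (intro sum_mono) (simp add: mult.left_commute[of C] mult_left_mono)
        then have "exp (- (\<Sum>l=1..n. C * (r ^ (n - l) * infnorm (Y l \<omega>)))) \<le> exp (- (u \<bullet> ar_process A Y0 n \<omega>))"
          by simp
        then show "(\<Prod>l=1..n. G (n - l) (Y l \<omega>)) \<le>
          (\<Prod>l=1..n. indicator {x. r ^ (n - l) * infnorm x \<le> y} (Y l \<omega>)) * exp (- (u \<bullet> ar_process A Y0 n \<omega>))"
          unfolding G_def prod.distrib sum_negf[symmetric] exp_sum[OF finite_atLeastAtMost]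
          by (intro mult_left_mono prod_nonneg) auto
      qed
      show "integrable M (\<lambda>\<omega>. \<Prod>l=1..n. G (n - l) (Y l \<omega>))"
        by (rule integrable_const_bound[where B=1]) (use G01 in \<open>auto simp: abs_prod intro!: AE_I2 prod_le_1\<close>)
      have "0 \<le> u \<bullet> ar_process A Y0 n \<omega>" if "\<omega> \<in> space M" for \<omega>
        using ar_process_nonneg[OF that, of n] u_pos
        by (auto simp: inner_vec_def nonneg_vec_def less_imp_le intro!: sum_nonneg)
      then show "integrable M (\<lambda>\<omega>. (\<Prod>l=1..n. indicator {x. r ^ (n - l) * infnorm x \<le> y} (Y l \<omega>)) *
          exp (- (u \<bullet> ar_process A Y0 n \<omega>)))"
        by (intro integrable_const_bound[where B=1])
          (auto simp: abs_mult abs_prod intro!: AE_I2 mult_le_one prod_le_1 prod_nonneg)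
    qed
    finally show "(\<Prod>k<n. expectation (\<lambda>\<omega>. indicator {\<omega>\<in>space M. r ^ k * infnorm (Y 1 \<omega>) \<le> y} \<omega> *
          exp (- (C * (r ^ k * infnorm (Y 1 \<omega>)))))) \<le>
        expectation (\<lambda>\<omega>. (\<Prod>l=1..n. indicator {x. r ^ (n - l) * infnorm x \<le> y} (Y l \<omega>)) *
          exp (- (u \<bullet> ar_process A Y0 n \<omega>)))" .
  qed (use C ar_process_nonneg in auto)
qed

end

section \<open>Laplace exponents of offspring laws\<close>

text \<open>The minimum equals 1 at roughly ln N / ln (1/r) scales, those with r^k N > 1, and decays
  geometrically from 1 afterwards. With the factor \<open>N\<close> in front, the first group
  produces N ln N.\<close>

lemma sum_truncated_scales_le:
  fixes r :: real and N :: nat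
  assumes r: "0 < r" "r < 1"
  shows "(\<Sum>k<n. real N * min 1 (r ^ k * real N)) \<le>
    real N * ln (real N) / ln (1 / r) + real N * (1 + 1 / (1 - r))"
proof (cases "N = 0")
  case False
  define a where "a = ln (real N) / ln (1 / r)"
  have lr: "0 < ln (1 / r)" using r by (simp add: ln_div)
  have a: "0 \<le> a" using False lr by (simp add: a_def)
  have "real k < a" if "1 < r ^ k * real N" for k
  proof -
    have "0 < ln (r ^ k * real N)" using that by simp
    also have "\<dots> = real k * ln r + ln (real N)" using r False by (simp add: ln_mult ln_realpow)
    finally have "real k * ln (1 / r) < ln (real N)" using r by (simp add: ln_div)
    then show ?thesis using lr by (simp only: a_def pos_less_divide_eq)
  qed
  then have sub: "{k\<in>{..<n}. 1 < r ^ k * real N} \<subseteq> {..nat \<lfloor>a\<rfloor>}"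
    by (auto simp: le_nat_floor less_imp_le)
  have "(\<Sum>k<n. if 1 < r ^ k * real N then 1 else 0) = real (card {k\<in>{..<n}. 1 < r ^ k * real N})"
    by (simp add: sum.If_cases Int_def)
  also have "\<dots> \<le> real (nat \<lfloor>a\<rfloor> + 1)"
    using card_mono[OF _ sub] by simp
  also have "\<dots> \<le> a + 1" using a by simp
  finally have count: "(\<Sum>k<n. if 1 < r ^ k * real N then 1 else 0) \<le> a + 1" .
  have "(\<Sum>k<n. min 1 (r ^ k * real N)) =
      (\<Sum>k<n. if 1 < r ^ k * real N then 1 else 0) + (\<Sum>k<n. if r ^ k * real N \<le> 1 then r ^ k * real N else 0)"
    unfolding sum.distrib[symmetric] by (intro sum.cong) auto
  also have "\<dots> \<le> a + 1 + 1 / (1 - r)"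
    using count sum_scales_below_le[OF r, of 1 "real N" n] by simp
  finally have "real N * (\<Sum>k<n. min 1 (r ^ k * real N)) \<le> real N * (a + 1 + 1 / (1 - r))"
    by (rule mult_left_mono) simp
  then show ?thesis by (simp add: sum_distrib_left a_def distrib_left algebra_simps)
qed simp

text \<open>Here \<open>xi i j\<close> counts children of type \<open>i\<close> of one parent of
  type \<open>j\<close>. For fixed \<open>j\<close> these counts may be dependent; nothing about
  independence is assumed.\<close>

locale offspring_law = prob_space M
  for M :: "'a measure" +
  fixes xi :: "'d::finite \<Rightarrow> 'd \<Rightarrow> 'a \<Rightarrow> nat" and A0 :: "real^'d^'d" and u :: "real^'d" and r :: real
  assumes xi_measurable [measurable]: "\<And>i j. xi i j \<in> measurable M (count_space UNIV)"
    and xi_mean: "\<And>i j. (\<integral>\<^sup>+\<omega>. ennreal (real (xi i j \<omega>)) \<partial>M) = ennreal (A0 $ i $ j)"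
    and xi_ln_xi: "\<And>i j. (\<integral>\<^sup>+\<omega>. ennreal (real (xi i j \<omega>) * ln (real (xi i j \<omega>))) \<partial>M) < \<infinity>"
    and mean_nonneg: "nonneg_mat A0"
    and weight_pos: "\<And>i. 0 < u $ i"
    and rate: "0 < r" "r < 1"
    and mean_eigenvector: "\<And>z. u \<bullet> (A0 *v z) = r * (u \<bullet> z)"
begin

definition weight :: "real^'d \<Rightarrow> 'd \<Rightarrow> 'a \<Rightarrow> real" where
  "weight \<theta> j \<omega> = (\<Sum>i\<in>UNIV. \<theta> $ i * real (xi i j \<omega>))"

definition laplace :: "real^'d \<Rightarrow> 'd \<Rightarrow> real" where
  "laplace \<theta> j = expectation (\<lambda>\<omega>. exp (- weight \<theta> j \<omega>))"

text \<open>The logarithmic form of the generating function: x parents reproducing independently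
  turn E exp(-theta . children) into exp(-L theta . x), so composing generations means iterating
  this map.\<close>

definition laplace_exponent :: "real^'d \<Rightarrow> real^'d" where
  "laplace_exponent \<theta> = (\<chi> j. - ln (laplace \<theta> j))"

lemma weight_measurable [measurable]: "weight \<theta> j \<in> borel_measurable M"
  unfolding weight_def by measurable

lemma xi_integrable: "integrable M (\<lambda>\<omega>. real (xi i j \<omega>))"
  by (rule integrableI_nonneg) (auto simp: xi_mean)

lemma xi_expectation: "expectation (\<lambda>\<omega>. real (xi i j \<omega>)) = A0 $ i $ j"
  using mean_nonneg by (simp add: integral_eq_nn_integral xi_mean nonneg_mat_def)

lemma weight_integrable: "integrable M (weight \<theta> j)"
  unfolding weight_def by (intro Bochner_Integration.integrable_sum integrable_mult_right xi_integrable)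

lemma weight_expectation: "expectation (weight \<theta> j) = (\<Sum>i\<in>UNIV. \<theta> $ i * A0 $ i $ j)"
  unfolding weight_def
  by (subst Bochner_Integration.integral_sum) (auto intro!: xi_integrable simp: xi_expectation)

lemma eigenvector_sum: "(\<Sum>i\<in>UNIV. u $ i * A0 $ i $ j) = r * u $ j"
proof -
  have "u \<bullet> column j A0 = r * (u \<bullet> axis j 1)"
    using mean_eigenvector[of "axis j 1"] by (simp add: matrix_vector_mult_basis)
  then show ?thesis by (simp add: inner_axis) (simp add: inner_vec_def column_def)
qed

lemma weight_nonneg: "nonneg_vec \<theta> \<Longrightarrow> 0 \<le> weight \<theta> j \<omega>"
  unfolding weight_def nonneg_vec_def by (intro sum_nonneg) simp

lemma weight_mono: "(\<And>i. \<theta> $ i \<le> \<theta>' $ i) \<Longrightarrow> weight \<theta> j \<omega> \<le> weight \<theta>' j \<omega>"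
  unfolding weight_def by (intro sum_mono mult_right_mono) simp_all

lemma exp_weight_integrable: "nonneg_vec \<theta> \<Longrightarrow> integrable M (\<lambda>\<omega>. exp (- weight \<theta> j \<omega>))"
  by (rule integrable_const_bound[where B=1]) (auto simp: weight_nonneg)

text \<open>Jensen's inequality, written with the tangent line of the exponential at the mean
  \<open>m\<close>.\<close>

lemma laplace_ge:
  assumes "nonneg_vec \<theta>"
  shows "exp (- (\<Sum>i\<in>UNIV. \<theta> $ i * A0 $ i $ j)) \<le> laplace \<theta> j"
proof -
  define m where "m = expectation (weight \<theta> j)"
  have "exp (- m) = expectation (\<lambda>\<omega>. exp (- m) * (1 + (m - weight \<theta> j \<omega>)))"
    using weight_integrable[of \<theta> j] by (simp add: m_def prob_space)
  also have "\<dots> \<le> laplace \<theta> j"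
    unfolding laplace_def
  proof (rule integral_mono)
    fix \<omega>
    have "exp (- m) * (1 + (m - weight \<theta> j \<omega>)) \<le> exp (- m) * exp (m - weight \<theta> j \<omega>)"
      by (intro mult_left_mono exp_ge_add_one_self) auto
    then show "exp (- m) * (1 + (m - weight \<theta> j \<omega>)) \<le> exp (- weight \<theta> j \<omega>)" by (simp flip: exp_add)
  qed (use weight_integrable exp_weight_integrable[OF assms] in auto)
  finally show ?thesis by (simp add: m_def weight_expectation)
qed

lemma laplace_pos: "nonneg_vec \<theta> \<Longrightarrow> 0 < laplace \<theta> j"
  using laplace_ge[of \<theta> j] by (meson exp_gt_zero less_le_trans)

lemma laplace_le_1: "nonneg_vec \<theta> \<Longrightarrow> laplace \<theta> j \<le> 1"
  unfolding laplace_def using integral_mono[OF exp_weight_integrable, of \<theta> "\<lambda>_. 1" j]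
  by (simp add: weight_nonneg prob_space)

lemma laplace_exponent_nonneg: "nonneg_vec \<theta> \<Longrightarrow> nonneg_vec (laplace_exponent \<theta>)"
  using laplace_pos laplace_le_1 by (auto simp: nonneg_vec_def laplace_exponent_def ln_le_zero_iff)

lemma laplace_eq_exp: "nonneg_vec \<theta> \<Longrightarrow> laplace \<theta> j = exp (- laplace_exponent \<theta> $ j)"
  using laplace_pos[of \<theta> j] by (simp add: laplace_exponent_def)

lemma laplace_exponent_le_mean:
  assumes "nonneg_vec \<theta>"
  shows "laplace_exponent \<theta> $ j \<le> (\<Sum>i\<in>UNIV. \<theta> $ i * A0 $ i $ j)"
  using laplace_ge[OF assms, of j] by (simp add: laplace_eq_exp[OF assms])

lemma laplace_exponent_mono:
  assumes nn: "nonneg_vec \<theta>" and le: "\<And>i. \<theta> $ i \<le> \<theta>' $ i"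
  shows "laplace_exponent \<theta> $ j \<le> laplace_exponent \<theta>' $ j"
proof -
  have nn': "nonneg_vec \<theta>'" using assms by (auto simp: nonneg_vec_def intro: order_trans)
  have "laplace \<theta>' j \<le> laplace \<theta> j"
    unfolding laplace_def
    by (rule integral_mono) (use exp_weight_integrable nn nn' weight_mono[OF le] in auto)
  then show ?thesis by (simp add: laplace_eq_exp nn nn')
qed

lemma funpow_laplace_exponent_nonneg:
  "nonneg_vec \<theta> \<Longrightarrow> nonneg_vec ((laplace_exponent ^^ k) \<theta>)"
  by (induction k) (auto intro: laplace_exponent_nonneg)

text \<open>By Jensen's inequality the exponent stays below the linear map theta -> theta A0, which
  has nonnegative entries and multiplies \<open>u\<close> by \<open>r\<close>.\<close>

lemma funpow_laplace_exponent_le: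
  assumes nn: "nonneg_vec \<theta>" and le: "\<And>i. \<theta> $ i \<le> u $ i"
  shows "(laplace_exponent ^^ k) \<theta> $ j \<le> r ^ k * u $ j"
proof (induction k arbitrary: j)
  case (Suc k)
  have "(laplace_exponent ^^ Suc k) \<theta> $ j \<le> (\<Sum>i\<in>UNIV. (laplace_exponent ^^ k) \<theta> $ i * A0 $ i $ j)"
    using laplace_exponent_le_mean[OF funpow_laplace_exponent_nonneg[OF nn]] by simp
  also have "\<dots> \<le> (\<Sum>i\<in>UNIV. (r ^ k * u $ i) * A0 $ i $ j)"
    using Suc mean_nonneg by (intro sum_mono mult_right_mono) (auto simp: nonneg_mat_def)
  also have "\<dots> = r ^ k * (\<Sum>i\<in>UNIV. u $ i * A0 $ i $ j)"
    by (simp add: sum_distrib_left mult.assoc)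
  finally show ?case by (simp add: eigenvector_sum mult.commute mult.left_commute)
qed (use le in simp)

text \<open>With W = \<open>weight u j\<close> and s <= delta, replacing exp(-s W) by 1 - s W costs
  at most s times this variable. It is dominated by W, hence integrable.\<close>

definition truncated :: "real \<Rightarrow> 'd \<Rightarrow> 'a \<Rightarrow> real" where
  "truncated \<delta> j \<omega> = weight u j \<omega> * min 1 (\<delta> * weight u j \<omega>)"

text \<open>Division by r u_j, the mean of \<open>weight u j\<close>, makes the error relative;
  summing over \<open>j\<close> gives a single bound valid for all types.\<close>

definition truncation_error :: "real \<Rightarrow> real" where
  "truncation_error \<delta> = (\<Sum>j\<in>UNIV. expectation (truncated \<delta> j) / (r * u $ j))"

lemma nonneg_u: "nonneg_vec u"
  using weight_pos by (simp add: nonneg_vec_def less_imp_le)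

lemma truncated_nonneg: "0 \<le> \<delta> \<Longrightarrow> 0 \<le> truncated \<delta> j \<omega>"
  using weight_nonneg[OF nonneg_u, of j \<omega>] by (simp add: truncated_def)

lemma truncated_measurable [measurable]: "truncated \<delta> j \<in> borel_measurable M"
  unfolding truncated_def by measurable

lemma truncated_integrable: "0 \<le> \<delta> \<Longrightarrow> integrable M (truncated \<delta> j)"
proof (rule Bochner_Integration.integrable_bound[OF weight_integrable[of u j]])
  assume "0 \<le> \<delta>"
  then show "AE \<omega> in M. norm (truncated \<delta> j \<omega>) \<le> norm (weight u j \<omega>)"
    using weight_nonneg[OF nonneg_u, of j]
    by (auto simp: truncated_def abs_mult intro!: mult_left_le)
qed simp

lemma truncation_error_nonneg: "0 \<le> \<delta> \<Longrightarrow> 0 \<le> truncation_error \<delta>"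
  unfolding truncation_error_def using rate weight_pos
  by (intro sum_nonneg divide_nonneg_nonneg Bochner_Integration.integral_nonneg truncated_nonneg)
    (auto simp: less_imp_le)

text \<open>For z <= 1 this is exp(-z) <= 1/(1+z) <= 1 - z + z^2; for z > 1 the right-hand side
  equals 1. The truncated quadratic term needs only first moments.\<close>

lemma exp_minus_le: "exp (- z) \<le> 1 - z + z * min 1 z" if "0 \<le> z" for z :: real
proof (cases "z \<le> 1")
  case True
  have "exp (- z) \<le> 1 / (1 + z)"
    using exp_ge_add_one_self[of z] that by (simp add: exp_minus divide_simps)
  also have "\<dots> \<le> 1 - z + z * z"
    using that by (simp add: divide_simps algebra_simps power2_eq_square)
  finally show ?thesis using True by simp
qed (use that in simp)

text \<open>Since -ln x >= 1 - x, it suffices to bound the transform itself from above; its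
  first-order term is s r u_j by the eigenvector equation, and the remainder is the truncation
  error.\<close>

lemma laplace_exponent_ge:
  assumes s: "0 \<le> s" "s \<le> \<delta>"
  shows "s * r * u $ j * (1 - truncation_error \<delta>) \<le> laplace_exponent (s *\<^sub>R u) $ j"
proof -
  have nn: "nonneg_vec (s *\<^sub>R u)" using nonneg_u s by (simp add: nonneg_vec_def)
  have w: "weight (s *\<^sub>R u) j \<omega> = s * weight u j \<omega>" for \<omega>
    by (simp add: weight_def sum_distrib_left mult.assoc)
  have "laplace (s *\<^sub>R u) j \<le> expectation (\<lambda>\<omega>. 1 - s * weight u j \<omega> + s * truncated \<delta> j \<omega>)"
    unfolding laplace_def
  proof (rule integral_mono)
    fix \<omega>
    define x where "x = weight u j \<omega>"
    have x: "0 \<le> x" using weight_nonneg[OF nonneg_u] by (simp add: x_def)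
    have "exp (- (s * x)) \<le> 1 - s * x + s * x * min 1 (s * x)"
      using x s by (intro exp_minus_le) simp
    also have "\<dots> \<le> 1 - s * x + s * x * min 1 (\<delta> * x)"
      using x s by (intro add_left_mono mult_left_mono min.mono mult_right_mono) auto
    finally show "exp (- weight (s *\<^sub>R u) j \<omega>) \<le> 1 - s * weight u j \<omega> + s * truncated \<delta> j \<omega>"
      by (simp add: w truncated_def x_def mult.assoc)
  qed (use exp_weight_integrable[OF nn] weight_integrable truncated_integrable s in auto)
  also have "\<dots> = 1 - s * (r * u $ j) + s * expectation (truncated \<delta> j)"
    using weight_integrable[of u j] truncated_integrable[of \<delta> j] s
    by (simp add: prob_space weight_expectation eigenvector_sum)
  also have "\<dots> \<le> 1 - s * (r * u $ j) + s * (r * u $ j * truncation_error \<delta>)"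
  proof -
    have "expectation (truncated \<delta> j) / (r * u $ j) \<le> truncation_error \<delta>"
      unfolding truncation_error_def using rate weight_pos s
      by (intro member_le_sum divide_nonneg_nonneg Bochner_Integration.integral_nonneg truncated_nonneg)
        (auto simp: less_imp_le)
    then have "expectation (truncated \<delta> j) \<le> r * u $ j * truncation_error \<delta>"
      using rate weight_pos[of j] by (simp add: pos_divide_le_eq mult.commute)
    then show ?thesis using s by (intro add_left_mono mult_left_mono)
  qed
  finally have "laplace (s *\<^sub>R u) j \<le> 1 - s * r * u $ j * (1 - truncation_error \<delta>)"
    by (simp add: algebra_simps)
  moreover have "ln (laplace (s *\<^sub>R u) j) \<le> laplace (s *\<^sub>R u) j - 1"
    using laplace_pos[OF nn] by (rule ln_le_minus_one)
  ultimately show ?thesis by (simp add: laplace_exponent_def)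
qed

text \<open>The number of scales \<open>k\<close> with \<open>r\<^sup>k \<xi> > 1\<close> is of order \<open>ln \<xi>\<close>; this is where \<open>E[\<xi> ln \<xi>] < \<infinity>\<close>
  enters.\<close>

lemma summable_truncation_error: "summable (\<lambda>k. truncation_error (r ^ k))"
proof -
  \<comment> \<open>The summand 1 ensures S >= 1, so that a factor \<open>S\<close> can be moved out
    of the minimum.\<close>
  define S where "S = 1 + (\<Sum>i\<in>UNIV. u $ i)"
  define g where "g k i j \<omega> = real (xi i j \<omega>) * min 1 (r ^ k * real (xi i j \<omega>))" for k i j \<omega>
  define B where "B i j \<omega> = real (xi i j \<omega>) * ln (real (xi i j \<omega>)) / ln (1 / r) +
    real (xi i j \<omega>) * (1 + 1 / (1 - r))" for i j \<omega>
  have S: "1 \<le> S" using weight_pos by (auto simp: S_def less_imp_le intro!: sum_nonneg)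
  have g_nn: "0 \<le> g k i j \<omega>" for k i j \<omega> using rate by (simp add: g_def)
  have trunc_le: "truncated (r ^ k) j \<omega> \<le> S\<^sup>2 * (\<Sum>i\<in>UNIV. g k i j \<omega>)" for k j \<omega>
  proof -
    \<comment> \<open>The largest coordinate controls the whole weight and is attained at some
      \<open>i0\<close>, which reduces the estimate to a single count.\<close>
    define N where "N = Max (range (\<lambda>i. xi i j \<omega>))"
    have "N \<in> range (\<lambda>i. xi i j \<omega>)" unfolding N_def by (rule Max_in) auto
    then obtain i0 where i0: "N = xi i0 j \<omega>" by auto
    have "weight u j \<omega> \<le> (\<Sum>i\<in>UNIV. u $ i * real N)"
      unfolding weight_def using weight_pos
      by (intro sum_mono mult_left_mono) (simp_all add: N_def less_imp_le)
    also have "\<dots> \<le> S * real N" by (simp add: S_def sum_distrib_right[symmetric] distrib_right)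
    finally have w: "weight u j \<omega> \<le> S * real N" .
    have w0: "0 \<le> weight u j \<omega>" by (rule weight_nonneg[OF nonneg_u])
    have "truncated (r ^ k) j \<omega> \<le> (S * real N) * (S * min 1 (r ^ k * real N))"
      unfolding truncated_def
    proof (rule mult_mono[OF w])
      have "r ^ k * weight u j \<omega> \<le> r ^ k * (S * real N)"
        using w rate by (intro mult_left_mono) auto
      then show "min 1 (r ^ k * weight u j \<omega>) \<le> S * min 1 (r ^ k * real N)"
        using S by (auto simp: min_def mult_ac)
    qed (use S w0 rate in auto)
    also have "\<dots> = S\<^sup>2 * g k i0 j \<omega>" by (simp add: g_def i0 power2_eq_square)
    also have "\<dots> \<le> S\<^sup>2 * (\<Sum>i\<in>UNIV. g k i j \<omega>)"
      using g_nn by (intro mult_left_mono member_le_sum) auto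
    finally show ?thesis .
  qed
  have B_int: "integrable M (B i j)" for i j
  proof -
    have "integrable M (\<lambda>\<omega>. real (xi i j \<omega>) * ln (real (xi i j \<omega>)))"
    proof (rule integrableI_nonneg)
      show "AE \<omega> in M. 0 \<le> real (xi i j \<omega>) * ln (real (xi i j \<omega>))"
      proof (rule AE_I2)
        fix \<omega> show "0 \<le> real (xi i j \<omega>) * ln (real (xi i j \<omega>))"
          by (cases "xi i j \<omega> = 0") auto
      qed
    qed (use xi_ln_xi in auto)
    then show ?thesis
      unfolding B_def by (intro Bochner_Integration.integrable_add integrable_divide integrable_mult_left xi_integrable)
  qed
  define T where "T = (\<Sum>j\<in>UNIV. expectation (\<lambda>\<omega>. S\<^sup>2 * (\<Sum>i\<in>UNIV. B i j \<omega>)) / (r * u $ j))"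
  have bound: "(\<Sum>k<n. truncation_error (r ^ k)) \<le> T" for n
  proof -
    have "(\<Sum>k<n. truncation_error (r ^ k)) = (\<Sum>j\<in>UNIV. (\<Sum>k<n. expectation (truncated (r ^ k) j)) / (r * u $ j))"
      unfolding truncation_error_def by (subst sum.swap) (simp add: sum_divide_distrib)
    also have "\<dots> \<le> T"
      unfolding T_def
    proof (intro sum_mono divide_right_mono)
      fix j
      have "(\<Sum>k<n. expectation (truncated (r ^ k) j)) = expectation (\<lambda>\<omega>. \<Sum>k<n. truncated (r ^ k) j \<omega>)"
        using truncated_integrable rate by (intro Bochner_Integration.integral_sum[symmetric]) simp
      also have "\<dots> \<le> expectation (\<lambda>\<omega>. S\<^sup>2 * (\<Sum>i\<in>UNIV. B i j \<omega>))"
      proof (rule integral_mono)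
        fix \<omega>
        have "(\<Sum>k<n. truncated (r ^ k) j \<omega>) \<le> (\<Sum>k<n. S\<^sup>2 * (\<Sum>i\<in>UNIV. g k i j \<omega>))"
          by (intro sum_mono trunc_le)
        also have "\<dots> = S\<^sup>2 * (\<Sum>i\<in>UNIV. \<Sum>k<n. g k i j \<omega>)"
          by (subst sum.swap) (simp add: sum_distrib_left)
        also have "\<dots> \<le> S\<^sup>2 * (\<Sum>i\<in>UNIV. B i j \<omega>)"
          unfolding g_def B_def using sum_truncated_scales_le[OF rate]
          by (intro mult_left_mono sum_mono) auto
        finally show "(\<Sum>k<n. truncated (r ^ k) j \<omega>) \<le> S\<^sup>2 * (\<Sum>i\<in>UNIV. B i j \<omega>)" .
      qed (use truncated_integrable rate B_int in auto)
      finally show "(\<Sum>k<n. expectation (truncated (r ^ k) j)) \<le> expectation (\<lambda>\<omega>. S\<^sup>2 * (\<Sum>i\<in>UNIV. B i j \<omega>))" .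
      show "0 \<le> r * u $ j" using rate weight_pos[of j] by simp
    qed
    finally show ?thesis .
  qed
  show ?thesis
    by (rule bounded_imp_summable[of _ T])
      (use truncation_error_nonneg rate bound[of "Suc _"] in \<open>simp_all add: lessThan_Suc_atMost\<close>)
qed

text \<open>The k-th application loses at most the relative error e(K+k), and a product of factors 1
  - e is at least 1 minus their sum. Starting at r^K u, with \<open>K\<close> so large that the tail
  of the errors is below 1/2, keeps half of the linear growth r^k.\<close>

lemma funpow_laplace_exponent_ge:
  obtains K where "\<And>k j. r ^ (K + k) * u $ j / 2 \<le> (laplace_exponent ^^ k) (r ^ K *\<^sub>R u) $ j"
proof -
  define e where "e k = truncation_error (r ^ k)" for k
  have e_nn: "0 \<le> e k" for k using truncation_error_nonneg rate by (simp add: e_def)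
  obtain K where K: "norm (\<Sum>i. e (i + K)) < 1 / 2"
    using suminf_exist_split[OF _ summable_truncation_error, of "1/2"] by (auto simp: e_def)
  have tail: "(\<Sum>i<k. e (K + i)) \<le> 1 / 2" for k
  proof -
    have "(\<Sum>i<k. e (i + K)) \<le> (\<Sum>i. e (i + K))"
      using summable_ignore_initial_segment[OF summable_truncation_error, of K] e_nn
      by (intro sum_le_suminf) (auto simp: e_def)
    then show ?thesis using K by (simp add: add.commute)
  qed
  have ge: "(1 - (\<Sum>i<k. e (K + i))) * (r ^ (K + k) * u $ j) \<le> (laplace_exponent ^^ k) (r ^ K *\<^sub>R u) $ j" for k j
  proof (induction k arbitrary: j)
    case (Suc k)
    define s where "s = 1 - (\<Sum>i<k. e (K + i))"
    have s: "0 \<le> s" "s \<le> 1" using tail[of k] e_nn by (auto simp: s_def sum_nonneg)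
    have nn: "nonneg_vec ((s * r ^ (K + k)) *\<^sub>R u)"
      using s rate nonneg_u by (simp add: nonneg_vec_def)
    have "(1 - (\<Sum>i<Suc k. e (K + i))) * (r ^ (K + Suc k) * u $ j) = (s - e (K + k)) * (r ^ (K + Suc k) * u $ j)"
      by (simp add: s_def algebra_simps)
    \<comment> \<open>Because s <= 1, subtracting the full error is the weaker claim; this is how
      the product of factors 1 - e becomes one minus a sum.\<close>
    also have "\<dots> \<le> (s - s * e (K + k)) * (r ^ (K + Suc k) * u $ j)"
    proof (rule mult_right_mono)
      show "s - e (K + k) \<le> s - s * e (K + k)" using s e_nn[of "K + k"] by (simp add: mult_left_le_one_le)
    qed (use rate weight_pos[of j] in simp)
    also have "\<dots> = (s * r ^ (K + k)) * r * u $ j * (1 - truncation_error (r ^ (K + k)))"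
      by (simp add: e_def algebra_simps)
    also have "\<dots> \<le> laplace_exponent ((s * r ^ (K + k)) *\<^sub>R u) $ j"
      using s rate by (intro laplace_exponent_ge) (auto simp: mult_left_le_one_le)
    also have "\<dots> \<le> laplace_exponent ((laplace_exponent ^^ k) (r ^ K *\<^sub>R u)) $ j"
      using Suc by (intro laplace_exponent_mono nn) (simp add: s_def mult.assoc)
    finally show ?case by simp
  qed simp
  have "r ^ (K + k) * u $ j / 2 \<le> (1 - (\<Sum>i<k. e (K + i))) * (r ^ (K + k) * u $ j)" for k j
    using mult_right_mono[of "1 / 2" "1 - (\<Sum>i<k. e (K + i))" "r ^ (K + k) * u $ j"] tail[of k]
      rate weight_pos[of j] by simp
  from order_trans[OF this ge] show ?thesis by (rule that)
qed

end

section \<open>Branching processes with immigration\<close>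

text \<open>Adjoins one family to an independent one, under the new index \<open>None\<close>. It is
  applied with the immigration events as \<open>G\<close> and the events of the single uniforms as
  \<open>F\<close>.\<close>

lemma (in prob_space) indep_sets_insert_option:
  assumes F: "indep_sets F I"
    and G: "G \<subseteq> events" "\<And>a J A. a \<in> G \<Longrightarrow> finite J \<Longrightarrow> J \<noteq> {} \<Longrightarrow> J \<subseteq> I \<Longrightarrow> (\<And>j. j \<in> J \<Longrightarrow> A j \<in> F j) \<Longrightarrow>
      prob (a \<inter> (\<Inter>j\<in>J. A j)) = prob a * prob (\<Inter>j\<in>J. A j)"
  shows "indep_sets (case_option G F) (insert None (Some ` I))"
proof (rule indep_setsI)
  fix i assume "i \<in> insert None (Some ` I)"
  moreover have "F j \<subseteq> events" if "j \<in> I" for j using F that unfolding indep_sets_def by blast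
  ultimately show "case_option G F i \<subseteq> events" using G(1) by (cases i) auto
next
  fix A J assume J: "J \<noteq> {}" "J \<subseteq> insert None (Some ` I)" "finite J" and A: "\<forall>j\<in>J. A j \<in> case_option G F j"
  define K where "K = {i. Some i \<in> J}"
  have K_vimage: "K = Some -` J" by (auto simp: K_def)
  have K: "finite K" "K \<subseteq> I" "J - {None} = Some ` K"
  proof -
    show "finite K" unfolding K_vimage using J(3) by (rule finite_vimageI) simp
    show "K \<subseteq> I" using J(2) by (auto simp: K_def)
    show "J - {None} = Some ` K"
    proof (rule set_eqI)
      fix t show "t \<in> J - {None} \<longleftrightarrow> t \<in> Some ` K" by (cases t) (auto simp: K_def)
    qed
  qed
  have AK: "A (Some i) \<in> F i" if "i \<in> K" for i using A that by (force simp: K_def)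
  have pK: "prob (\<Inter>j\<in>K. A (Some j)) = (\<Prod>j\<in>K. prob (A (Some j)))" if "K \<noteq> {}"
    using indep_setsD[OF F K(2) that K(1), of "\<lambda>i. A (Some i)"] AK by auto
  show "prob (\<Inter>j\<in>J. A j) = (\<Prod>j\<in>J. prob (A j))"
  proof (cases "None \<in> J")
    case False
    then have "J = Some ` K" using K(3) by simp
    then show ?thesis using pK J(1) by (auto simp: prod.reindex)
  next
    case True
    then have J_eq: "J = insert None (Some ` K)" using K(3) by auto
    show ?thesis
    proof (cases "K = {}")
      case False
      have "A None \<in> G" using A True by force
      then have "prob (A None \<inter> (\<Inter>j\<in>K. A (Some j))) = prob (A None) * prob (\<Inter>j\<in>K. A (Some j))"
        using G(2)[OF _ K(1) False K(2), of "A None" "\<lambda>i. A (Some i)"] AK by simp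
      then show ?thesis using pK[OF False] K(1) unfolding J_eq by (simp add: prod.reindex)
    qed (simp add: J_eq)
  qed
qed

text \<open>A random finite subset of a countable set takes countably many values. On each event N =
  J the product has a fixed index set, so its factors may be integrated out and the pieces
  reassembled. This replaces conditioning on the past.\<close>

lemma (in prob_space) nn_integral_random_prod:
  fixes N :: "'a \<Rightarrow> ('i::countable) set" and q :: "'i \<Rightarrow> 'a \<Rightarrow> ennreal" and c :: "'i \<Rightarrow> ennreal"
  assumes N: "\<And>\<omega>. \<omega> \<in> space M \<Longrightarrow> finite (N \<omega>) \<and> N \<omega> \<subseteq> I"
    and N_sets[measurable]: "\<And>J. {\<omega>\<in>space M. N \<omega> = J} \<in> events"
    and h[measurable]: "h \<in> borel_measurable M"
    and q: "\<And>i. i \<in> I \<Longrightarrow> q i \<in> borel_measurable M"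
    and indep: "\<And>J. finite J \<Longrightarrow> J \<subseteq> I \<Longrightarrow>
      (\<integral>\<^sup>+\<omega>. h \<omega> * indicator {\<omega>\<in>space M. N \<omega> = J} \<omega> * (\<Prod>i\<in>J. q i \<omega>) \<partial>M) =
      (\<integral>\<^sup>+\<omega>. h \<omega> * indicator {\<omega>\<in>space M. N \<omega> = J} \<omega> \<partial>M) * (\<Prod>i\<in>J. c i)"
  shows "(\<integral>\<^sup>+\<omega>. h \<omega> * (\<Prod>i\<in>N \<omega>. q i \<omega>) \<partial>M) = (\<integral>\<^sup>+\<omega>. h \<omega> * (\<Prod>i\<in>N \<omega>. c i) \<partial>M)"
proof -
  define S where "S = {J :: 'i set. finite J \<and> J \<subseteq> I}"
  have S: "countable S"
    using countable_Collect_finite by (rule countable_subset[rotated]) (auto simp: S_def)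
  have decomp: "(\<integral>\<^sup>+\<omega>. h \<omega> * (\<Prod>i\<in>N \<omega>. f i \<omega>) \<partial>M) =
      (\<integral>\<^sup>+J. (\<integral>\<^sup>+\<omega>. h \<omega> * indicator {\<omega>\<in>space M. N \<omega> = J} \<omega> * (\<Prod>i\<in>J. f i \<omega>) \<partial>M) \<partial>count_space S)"
    if f: "\<And>i. i \<in> I \<Longrightarrow> f i \<in> borel_measurable M" for f :: "'i \<Rightarrow> 'a \<Rightarrow> ennreal"
  proof -
    have "h \<omega> * (\<Prod>i\<in>N \<omega>. f i \<omega>) =
        (\<integral>\<^sup>+J. h \<omega> * indicator {\<omega>\<in>space M. N \<omega> = J} \<omega> * (\<Prod>i\<in>J. f i \<omega>) \<partial>count_space S)"
      if w: "\<omega> \<in> space M" for \<omega>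
    proof -
      have "(\<integral>\<^sup>+J. h \<omega> * indicator {\<omega>\<in>space M. N \<omega> = J} \<omega> * (\<Prod>i\<in>J. f i \<omega>) \<partial>count_space S) =
          (\<integral>\<^sup>+J. (h \<omega> * (\<Prod>i\<in>N \<omega>. f i \<omega>)) * indicator {N \<omega>} J \<partial>count_space S)"
        by (intro nn_integral_cong) (use w in \<open>auto simp: indicator_def\<close>)
      also have "\<dots> = h \<omega> * (\<Prod>i\<in>N \<omega>. f i \<omega>)"
        using N[OF w] by (subst nn_integral_cmult_indicator) (auto simp: S_def)
      finally show ?thesis by simp
    qed
    then have "(\<integral>\<^sup>+\<omega>. h \<omega> * (\<Prod>i\<in>N \<omega>. f i \<omega>) \<partial>M) =
        (\<integral>\<^sup>+\<omega>. \<integral>\<^sup>+J. h \<omega> * indicator {\<omega>\<in>space M. N \<omega> = J} \<omega> * (\<Prod>i\<in>J. f i \<omega>) \<partial>count_space S \<partial>M)"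
      by (rule nn_integral_cong)
    also have "\<dots> = (\<integral>\<^sup>+J. (\<integral>\<^sup>+\<omega>. h \<omega> * indicator {\<omega>\<in>space M. N \<omega> = J} \<omega> * (\<Prod>i\<in>J. f i \<omega>) \<partial>M) \<partial>count_space S)"
      using f by (intro nn_integral_count_space_nn_integral S borel_measurable_times_ennreal borel_measurable_prod_ennreal
          borel_measurable_indicator N_sets h) (auto simp: S_def)
    finally show ?thesis .
  qed
  have "(\<integral>\<^sup>+\<omega>. h \<omega> * (\<Prod>i\<in>N \<omega>. q i \<omega>) \<partial>M) =
      (\<integral>\<^sup>+J. (\<integral>\<^sup>+\<omega>. h \<omega> * indicator {\<omega>\<in>space M. N \<omega> = J} \<omega> * (\<Prod>i\<in>J. q i \<omega>) \<partial>M) \<partial>count_space S)"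
    by (rule decomp) (rule q)
  also have "\<dots> = (\<integral>\<^sup>+J. (\<integral>\<^sup>+\<omega>. h \<omega> * indicator {\<omega>\<in>space M. N \<omega> = J} \<omega> * (\<Prod>i\<in>J. c i) \<partial>M) \<partial>count_space S)"
  proof (rule nn_integral_cong)
    fix J assume "J \<in> space (count_space S)"
    then have "finite J" "J \<subseteq> I" by (auto simp: S_def)
    then show "(\<integral>\<^sup>+\<omega>. h \<omega> * indicator {\<omega>\<in>space M. N \<omega> = J} \<omega> * (\<Prod>i\<in>J. q i \<omega>) \<partial>M) =
        (\<integral>\<^sup>+\<omega>. h \<omega> * indicator {\<omega>\<in>space M. N \<omega> = J} \<omega> * (\<Prod>i\<in>J. c i) \<partial>M)"
      by (simp add: indep nn_integral_multc)
  qed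
  also have "\<dots> = (\<integral>\<^sup>+\<omega>. h \<omega> * (\<Prod>i\<in>N \<omega>. c i) \<partial>M)"
    by (rule decomp[symmetric]) simp
  finally show ?thesis .
qed

lemma measurable_sum_nat [measurable (raw)]:
  fixes f :: "'i \<Rightarrow> 'a \<Rightarrow> nat"
  assumes "\<And>i. i \<in> S \<Longrightarrow> f i \<in> measurable M (count_space UNIV)"
  shows "(\<lambda>\<omega>. \<Sum>i\<in>S. f i \<omega>) \<in> measurable M (count_space UNIV)"
proof -
  have "(\<lambda>\<omega>. \<Sum>i\<in>S. f i \<omega>) \<in> measurable M borel"
    using assms by (intro borel_measurable_sum) (simp add: measurable_def sets_borel_eq_count_space)
  then show ?thesis by (simp add: measurable_def sets_borel_eq_count_space)
qed

lemma floor_vec_measurable: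
  assumes "f \<in> borel_measurable N"
  shows "(\<lambda>\<omega>. floor_vec (f \<omega>) $ j) \<in> measurable N (count_space UNIV)"
proof -
  have [measurable]: "(\<lambda>\<omega>. f \<omega> $ j) \<in> borel_measurable N" by (rule borel_measurable_nth[OF assms])
  show ?thesis unfolding floor_vec_def vec_lambda_beta by measurable
qed

text \<open>Only counts of generations up to \<open>n\<close> are required to be measurable, so that
  \<open>N\<close> may be the sigma-algebra of the past as well as the whole space.\<close>

lemma immigrant_line_measurable:
  fixes xi :: "nat \<Rightarrow> nat \<Rightarrow> nat \<Rightarrow> 'd::finite \<Rightarrow> 'd \<Rightarrow> 'w \<Rightarrow> nat"
  assumes xi: "\<And>m l k i j. m < l \<Longrightarrow> l \<le> n \<Longrightarrow> 1 \<le> k \<Longrightarrow> xi m l k i j \<in> measurable N (count_space UNIV)"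
    and Y: "\<And>m. Y m \<in> borel_measurable N"
  shows "(\<lambda>\<omega>. immigrant_line xi Y m n \<omega> $ j) \<in> measurable N (count_space UNIV)"
  using xi
proof (induction n arbitrary: j)
  case 0
  then show ?case using floor_vec_measurable[OF Y] by simp
next
  case (Suc n)
  show ?case
  proof (cases "m \<le> n")
    case True
    have "(\<lambda>\<omega>. \<Sum>k = 1..immigrant_line xi Y m n \<omega> $ l. xi m (Suc n) k j l \<omega>) \<in> measurable N (count_space UNIV)" for l
    \<comment> \<open>The random upper limit takes countably many values, so fixed limits
      suffice.\<close>
    proof (rule measurable_compose_countable[where g="\<lambda>\<omega>. immigrant_line xi Y m n \<omega> $ l"
            and f="\<lambda>b \<omega>. \<Sum>k = 1..b. xi m (Suc n) k j l \<omega>"])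
      show "(\<lambda>\<omega>. immigrant_line xi Y m n \<omega> $ l) \<in> measurable N (count_space UNIV)"
        using Suc by simp
      show "(\<lambda>\<omega>. \<Sum>k = 1..b. xi m (Suc n) k j l \<omega>) \<in> measurable N (count_space UNIV)" for b
        using True by (intro measurable_sum_nat Suc.prems) auto
    qed
    then show ?thesis using True by (simp add: measurable_sum_nat)
  next
    case False
    then show ?thesis using floor_vec_measurable[OF Y] by simp
  qed
qed

locale deterministic_branching_setting =
  constant_matrix_setting M A Y A0 u r y + branching_setting M A Y F Psi U
  for M :: "'w measure"
    and A :: "nat \<Rightarrow> 'w \<Rightarrow> real^'d^'d"
    and Y :: "nat \<Rightarrow> 'w \<Rightarrow> real^'d"
    and A0 :: "real^'d^'d" and u :: "real^'d" and r y :: real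
    and F :: "('d \<Rightarrow> real \<Rightarrow> nat^'d) measure"
    and Psi :: "nat \<Rightarrow> 'w \<Rightarrow> 'd \<Rightarrow> real \<Rightarrow> nat^'d"
    and U :: "nat \<Rightarrow> nat \<Rightarrow> nat \<Rightarrow> 'd \<Rightarrow> 'w \<Rightarrow> real" +
  fixes psi :: "'d \<Rightarrow> real \<Rightarrow> nat^'d"
  assumes psi: "psi \<in> offspring_fn_families"
    and Psi_eq: "AE \<omega> in M. \<forall>n\<ge>1. Psi n \<omega> = psi"
    and offspring_ln_offspring: "\<And>i j. (\<integral>\<^sup>+ \<omega>. ennreal (real (offspring Psi U 0 1 1 i j \<omega>) *
      ln (real (offspring Psi U 0 1 1 i j \<omega>))) \<partial>M) < \<infinity>"
begin

definition index :: "(nat \<times> nat \<times> nat \<times> 'd) set" where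
  "index = {(m, n, k, j). m < n \<and> k \<ge> 1}"

definition UU :: "nat \<times> nat \<times> nat \<times> 'd \<Rightarrow> 'w \<Rightarrow> real" where
  "UU = (\<lambda>(m, n, k, j). U m n k j)"

text \<open>Offspring counts with \<open>psi\<close> inserted at every sample point. They are
  functions of the uniforms alone and differ from the given counts only on a null set.\<close>

definition xi :: "nat \<Rightarrow> nat \<Rightarrow> nat \<Rightarrow> 'd \<Rightarrow> 'd \<Rightarrow> 'w \<Rightarrow> nat" where
  "xi = offspring (\<lambda>_ _. psi) U"

lemma xi_eq: "xi m n k i j \<omega> = psi j (UU (m, n, k, j) \<omega>) $ i"
  by (simp add: xi_def offspring_def UU_def)

lemma UU_range: "t \<in> index \<Longrightarrow> \<omega> \<in> space M \<Longrightarrow> UU t \<omega> \<in> {0..1}"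
  using U_range by (force simp: index_def UU_def)

lemma UU_indep: "indep_vars (\<lambda>_. borel) UU index"
  using U_indep by (simp add: index_def UU_def)

lemma UU_measurable: "t \<in> index \<Longrightarrow> random_variable borel (UU t)"
  using UU_indep by (auto simp: indep_vars_def)

lemma psi_measurable: "psi j \<in> measurable (restrict_space borel {0..1}) (count_space UNIV)"
  using psi by (auto simp: offspring_fn_families_def offspring_fns_def)

lemma psi_compose_measurable:
  assumes "V \<in> borel_measurable N" "\<And>\<omega>. \<omega> \<in> space N \<Longrightarrow> V \<omega> \<in> {0..1}"
  shows "(\<lambda>\<omega>. psi j (V \<omega>) $ i) \<in> measurable N (count_space UNIV)"
proof -
  have "V \<in> measurable N (restrict_space borel {0..1})"
    using assms by (intro measurable_restrict_space2) auto
  then have "(\<lambda>\<omega>. psi j (V \<omega>)) \<in> measurable N (count_space UNIV)"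
    using psi_measurable by (rule measurable_compose)
  then show ?thesis by (rule measurable_compose) simp
qed

lemma xi_measurable:
  assumes "m < n" "1 \<le> k"
  shows "xi m n k i j \<in> measurable M (count_space UNIV)"
proof -
  have "(m, n, k, j) \<in> index" using assms by (simp add: index_def)
  from psi_compose_measurable[OF UU_measurable[OF this] UU_range[OF this]]
  show ?thesis by (simp add: xi_eq[abs_def])
qed

lemma offspring_AE: "AE \<omega> in M. \<forall>m n k i j. 1 \<le> n \<longrightarrow> offspring Psi U m n k i j \<omega> = xi m n k i j \<omega>"
  using Psi_eq by eventually_elim (simp add: offspring_def xi_def)

text \<open>Integrating the conditional mean over the whole space removes the conditioning, and the
  conditional mean is almost surely the constant \<open>A0\<close>.\<close>

lemma xi_mean: "(\<integral>\<^sup>+\<omega>. ennreal (real (xi 0 1 1 i j \<omega>)) \<partial>M) = ennreal (A0 $ i $ j)"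
proof -
  define S where "S = vimage_algebra (space M) (\<lambda>\<omega>. \<lambda>l\<in>{1::nat..}. Psi l \<omega>) (PiM {1..} (\<lambda>_. F))"
  have "(\<lambda>\<omega>. \<lambda>l\<in>{1::nat..}. Psi l \<omega>) \<in> measurable M (PiM {1..} (\<lambda>_. F))"
    using Psi_measurable by (intro measurable_restrict) auto
  then have "subalgebra M S"
    unfolding subalgebra_def S_def by (auto intro: sets_image_in_sets[THEN subsetD])
  then interpret S: finite_measure_subalgebra M S
    by unfold_locales
  have "offspring Psi U 0 1 1 i j \<in> measurable M (count_space UNIV)"
    by (rule offspring_measurable) auto
  then have off: "random_variable borel (\<lambda>\<omega>. ennreal (real (offspring Psi U 0 1 1 i j \<omega>)))"
    by measurable
  have "(\<integral>\<^sup>+\<omega>. ennreal (real (xi 0 1 1 i j \<omega>)) \<partial>M) = (\<integral>\<^sup>+\<omega>. 1 * ennreal (real (offspring Psi U 0 1 1 i j \<omega>)) \<partial>M)"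
    using offspring_AE by (intro nn_integral_cong_AE) (auto elim!: eventually_mono)
  also have "\<dots> = (\<integral>\<^sup>+\<omega>. 1 * nn_cond_exp M S (\<lambda>\<omega>. ennreal (real (offspring Psi U 0 1 1 i j \<omega>))) \<omega> \<partial>M)"
    by (rule S.nn_cond_exp_intg[symmetric, OF _ off]) simp
  also have "\<dots> = (\<integral>\<^sup>+\<omega>. ennreal (A0 $ i $ j) \<partial>M)"
    using mean_offspring[OF order_refl] A_eq unfolding S_def[symmetric]
    by (intro nn_integral_cong_AE) (auto elim!: eventually_elim2)
  finally show ?thesis by (simp add: emeasure_space_1)
qed

text \<open>The individual with indices 0, 1, 1 represents all others;
  \<open>offspring_weight_laplace\<close> transfers its Laplace transform to them.\<close>

sublocale law: offspring_law M "xi 0 (Suc 0) (Suc 0)" A0 u r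
proof
  show "(\<integral>\<^sup>+\<omega>. ennreal (real (xi 0 (Suc 0) (Suc 0) i j \<omega>) * ln (real (xi 0 (Suc 0) (Suc 0) i j \<omega>))) \<partial>M) < \<infinity>" for i j
  proof -
    have "(\<integral>\<^sup>+\<omega>. ennreal (real (xi 0 (Suc 0) (Suc 0) i j \<omega>) * ln (real (xi 0 (Suc 0) (Suc 0) i j \<omega>))) \<partial>M) =
      (\<integral>\<^sup>+ \<omega>. ennreal (real (offspring Psi U 0 (Suc 0) (Suc 0) i j \<omega>) * ln (real (offspring Psi U 0 (Suc 0) (Suc 0) i j \<omega>))) \<partial>M)"
      using offspring_AE by (intro nn_integral_cong_AE) (auto elim!: eventually_mono)
    then show ?thesis using offspring_ln_offspring[of i j] by simp
  qed
qed (use xi_measurable xi_mean A0_nonneg u_pos r eigenvector in auto)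

definition offspring_weight :: "real^'d \<Rightarrow> nat \<times> nat \<times> nat \<times> 'd \<Rightarrow> 'w \<Rightarrow> real" where
  "offspring_weight \<theta> = (\<lambda>(m, n, k, j) \<omega>. \<Sum>i\<in>UNIV. \<theta> $ i * real (xi m n k i j \<omega>))"

lemma offspring_weight_laplace:
  assumes "t \<in> index" "nonneg_vec \<theta>"
  shows "(\<integral>\<^sup>+\<omega>. ennreal (exp (- offspring_weight \<theta> t \<omega>)) \<partial>M) = ennreal (law.laplace \<theta> (snd (snd (snd t))))"
proof -
  obtain m n k j where t: "t = (m, n, k, j)" by (cases t) auto
  \<comment> \<open>The extension by 0 outside the unit interval makes \<open>f\<close> Borel on the
    line, as \<open>psi\<close> is measurable only on the interval; the uniforms never leave
    it.\<close>
  define f where "f x = (if x \<in> {0..1} then ennreal (exp (- (\<Sum>i\<in>UNIV. \<theta> $ i * real (psi j x $ i)))) else 0)"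
    for x :: real
  have "(\<lambda>x. psi j x $ i) \<in> measurable (restrict_space borel {0..1}) (count_space UNIV)" for i
    by (rule measurable_compose[OF psi_measurable]) simp
  then have "(\<lambda>x. ennreal (exp (- (\<Sum>i\<in>UNIV. \<theta> $ i * real (psi j x $ i))))) \<in> borel_measurable (restrict_space borel {0..1})"
    by measurable
  then have f[measurable]: "f \<in> borel_measurable borel"
    unfolding f_def by (subst (asm) measurable_restrict_space_iff[where c=0]) auto
  have eq: "(\<integral>\<^sup>+\<omega>. ennreal (exp (- offspring_weight \<theta> s \<omega>)) \<partial>M) = (\<integral>\<^sup>+x. f x \<partial>uniform_measure lborel {0..1})"
    if s: "s \<in> index" "snd (snd (snd s)) = j" for s
  proof -
    obtain m n k where s_eq: "s = (m, n, k, j)" using s by (cases s) auto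
    have [measurable]: "random_variable borel (UU s)" by (rule UU_measurable[OF s(1)])
    have "(\<integral>\<^sup>+\<omega>. ennreal (exp (- offspring_weight \<theta> s \<omega>)) \<partial>M) = (\<integral>\<^sup>+\<omega>. f (UU s \<omega>) \<partial>M)"
      using UU_range[OF s(1)] by (intro nn_integral_cong) (auto simp: offspring_weight_def f_def s_eq xi_eq)
    also have "\<dots> = (\<integral>\<^sup>+x. f x \<partial>distr M borel (UU s))" by (simp add: nn_integral_distr)
    also have "distr M borel (UU s) = uniform_measure lborel {0..1}"
      using U_uniform s(1) by (simp add: UU_def s_eq index_def)
    finally show ?thesis .
  qed
  have "(\<integral>\<^sup>+\<omega>. ennreal (exp (- offspring_weight \<theta> t \<omega>)) \<partial>M) =
      (\<integral>\<^sup>+\<omega>. ennreal (exp (- offspring_weight \<theta> (0, 1, 1, j) \<omega>)) \<partial>M)"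
    using assms by (subst (1 2) eq) (auto simp: t index_def)
  also have "\<dots> = (\<integral>\<^sup>+\<omega>. ennreal (exp (- law.weight \<theta> j \<omega>)) \<partial>M)"
    unfolding offspring_weight_def law.weight_def by simp
  also have "\<dots> = ennreal (law.laplace \<theta> j)"
    unfolding law.laplace_def by (rule nn_integral_eq_integral[OF law.exp_weight_integrable[OF assms(2)]]) simp
  finally show ?thesis by (simp add: t)
qed

section \<open>Independence of immigration, past and current reproduction\<close>

definition Y_algebra :: "'w measure" where
  "Y_algebra = vimage_algebra (space M) (\<lambda>\<omega> n. Y n \<omega>) (PiM UNIV (\<lambda>_. borel))"

lemma space_Y_algebra [simp]: "space Y_algebra = space M"
  by (simp add: Y_algebra_def)

lemma sets_Y_algebra: "sets Y_algebra \<subseteq> events"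
  unfolding Y_algebra_def
  by (rule sets_image_in_sets) (auto intro!: measurable_PiM_single')

lemma Y_algebra_measurable: "Y n \<in> borel_measurable Y_algebra"
proof -
  have "(\<lambda>\<omega> n. Y n \<omega>) \<in> measurable Y_algebra (PiM UNIV (\<lambda>_. borel))"
    unfolding Y_algebra_def by (rule measurable_vimage_algebra1) (auto simp: space_PiM)
  from measurable_compose[OF this measurable_component_singleton[of n]] show ?thesis by simp
qed

lemma Y_algebra_imp_measurable: "f \<in> measurable Y_algebra N \<Longrightarrow> f \<in> measurable M N"
  using sets_Y_algebra by (auto simp: measurable_def)

definition U_sets :: "nat \<times> nat \<times> nat \<times> 'd \<Rightarrow> 'w set set" where
  "U_sets t = {UU t -` A \<inter> space M | A. A \<in> sets borel}"

text \<open>The assumed independence is between the whole family of uniforms and the pair (Psi, Y).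
  Immigration events belong to the second sigma-algebra, finite intersections of uniform events to
  the first; the uniforms are mutually independent by assumption.\<close>

lemma indep_Y_U: "indep_sets (case_option (sets Y_algebra) U_sets) (insert None (Some ` index))"
proof (rule indep_sets_insert_option)
  show "indep_sets U_sets index"
    using UU_indep unfolding indep_vars_def2 U_sets_def by simp
  show "sets Y_algebra \<subseteq> events" by (rule sets_Y_algebra)
next
  fix a J B assume a: "a \<in> sets Y_algebra" and J: "finite J" "J \<noteq> {}" "J \<subseteq> index"
    and B: "\<And>j. j \<in> J \<Longrightarrow> B j \<in> U_sets j"
  define PY where "PY = vimage_algebra (space M) (\<lambda>\<omega>. (\<lambda>n\<in>{1::nat..}. Psi n \<omega>, \<lambda>n. Y n \<omega>))
    (PiM {1..} (\<lambda>_. F) \<Otimes>\<^sub>M PiM UNIV (\<lambda>_. borel))"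
  define UA where "UA = vimage_algebra (space M)
    (\<lambda>\<omega>. \<lambda>(m, n, k, j)\<in>{(m, n, k, j). m < n \<and> k \<ge> 1}. U m n k j \<omega>)
    (PiM {(m, n, k, j). m < n \<and> k \<ge> 1} (\<lambda>_. borel))"
  have indep: "indep_set (sets UA) (sets PY)"
    using U_indep_PsiY unfolding indep_rvs_def UA_def PY_def by simp
  have UA_eq: "UA = vimage_algebra (space M) (\<lambda>\<omega>. \<lambda>t\<in>index. UU t \<omega>) (PiM index (\<lambda>_. borel))"
  proof -
    have "(\<lambda>\<omega>. \<lambda>(m, n, k, j)\<in>{(m, n, k, j). m < n \<and> k \<ge> 1}. U m n k j \<omega>) = (\<lambda>\<omega>. \<lambda>t\<in>index. UU t \<omega>)"
      by (auto simp: index_def UU_def restrict_def fun_eq_iff)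
    then show ?thesis unfolding UA_def index_def by simp
  qed
  have "(\<lambda>\<omega> n. Y n \<omega>) \<in> measurable PY (PiM UNIV (\<lambda>_. borel))"
  proof -
    have "(\<lambda>\<omega>. (\<lambda>n\<in>{1::nat..}. Psi n \<omega>, \<lambda>n. Y n \<omega>)) \<in>
        measurable PY (PiM {1..} (\<lambda>_. F) \<Otimes>\<^sub>M PiM UNIV (\<lambda>_. borel))"
      unfolding PY_def
    proof (rule measurable_vimage_algebra1)
      show "(\<lambda>\<omega>. (\<lambda>n\<in>{1::nat..}. Psi n \<omega>, \<lambda>n. Y n \<omega>)) \<in> space M \<rightarrow>
          space (PiM {1..} (\<lambda>_. F) \<Otimes>\<^sub>M PiM UNIV (\<lambda>_. borel))"
        using measurable_space[OF Psi_measurable] by (auto simp: space_pair_measure space_PiM)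
    qed
    from measurable_compose[OF this measurable_snd] show ?thesis by simp
  qed
  then have "sets Y_algebra \<subseteq> sets PY"
    unfolding Y_algebra_def by (intro sets_image_in_sets) (simp_all add: PY_def)
  then have a': "a \<in> sets PY" using a by auto
  have UU_UA: "UU t \<in> borel_measurable UA" if t: "t \<in> index" for t
  proof -
    have "(\<lambda>\<omega>. \<lambda>t\<in>index. UU t \<omega>) \<in> measurable UA (PiM index (\<lambda>_. borel))"
      unfolding UA_eq by (rule measurable_vimage_algebra1) (auto simp: space_PiM)
    from measurable_compose[OF this measurable_component_singleton[OF t]] show ?thesis using t by simp
  qed
  have "B j \<in> sets UA" if j: "j \<in> J" for j
  proof -
    obtain C where "B j = UU j -` C \<inter> space M" "C \<in> sets borel" using B[OF j] by (auto simp: U_sets_def)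
    moreover have "space UA = space M" by (simp add: UA_def)
    ultimately show ?thesis using measurable_sets[OF UU_UA, of j C] j J(3) by auto
  qed
  then have "(\<Inter>j\<in>J. B j) \<in> sets UA" using J by (intro sets.finite_INT) auto
  from indep_setD[OF indep this a'] show "prob (a \<inter> (\<Inter>j\<in>J. B j)) = prob a * prob (\<Inter>j\<in>J. B j)"
    by (simp add: Int_commute mult.commute)
qed

text \<open>The past of generation \<open>n\<close> includes the whole immigration sequence, also its future.\<close>

definition past :: "nat \<Rightarrow> (nat \<times> nat \<times> nat \<times> 'd) set" where
  "past n = {t \<in> index. fst (snd t) \<le> n}"

definition past_algebra :: "nat \<Rightarrow> 'w measure" where
  "past_algebra n = sigma (space M) (sets Y_algebra \<union> (\<Union>t\<in>past n. U_sets t))"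

lemma past_generator_subset: "sets Y_algebra \<union> (\<Union>t\<in>past n. U_sets t) \<subseteq> Pow (space M)"
  using sets.sets_into_space[of _ Y_algebra] by (auto simp: U_sets_def)

lemma space_past_algebra [simp]: "space (past_algebra n) = space M"
  unfolding past_algebra_def by (rule space_measure_of[OF past_generator_subset])

lemma sets_past_algebra:
  "sets (past_algebra n) = sigma_sets (space M) (sets Y_algebra \<union> (\<Union>t\<in>past n. U_sets t))"
  unfolding past_algebra_def by (rule sets_measure_of[OF past_generator_subset])

lemma Y_algebra_imp_past_measurable: "f \<in> measurable Y_algebra N \<Longrightarrow> f \<in> measurable (past_algebra n) N"
  by (auto simp: measurable_def sets_past_algebra)

lemma UU_past_measurable: "t \<in> past n \<Longrightarrow> UU t \<in> borel_measurable (past_algebra n)"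
  by (rule measurableI) (auto simp: sets_past_algebra U_sets_def)

lemma events_past_algebra: "sets (past_algebra n) \<subseteq> events"
proof -
  have "U_sets t \<subseteq> events" if "t \<in> past n" for t
    using UU_measurable[of t] that by (auto simp: U_sets_def past_def)
  then show ?thesis
    unfolding sets_past_algebra using sets_Y_algebra by (intro sets.sigma_sets_subset Un_least UN_least)
qed

lemma past_imp_measurable: "f \<in> measurable (past_algebra n) N \<Longrightarrow> f \<in> measurable M N"
  using events_past_algebra by (auto simp: measurable_def)

text \<open>Independence survives grouping into disjoint blocks: immigration with all uniforms up to
  generation \<open>n\<close> forms one block, each current uniform a block of its own.\<close>

lemma nn_integral_past_times_current:
  assumes f: "f \<in> borel_measurable (past_algebra n)"
    and J: "finite J" "J \<subseteq> index" "\<And>t. t \<in> J \<Longrightarrow> fst (snd t) = Suc n"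
    and q: "\<And>t. t \<in> J \<Longrightarrow> q t \<in> borel_measurable (vimage_algebra (space M) (UU t) borel)"
  shows "(\<integral>\<^sup>+\<omega>. f \<omega> * (\<Prod>t\<in>J. q t \<omega>) \<partial>M) = (\<integral>\<^sup>+\<omega>. f \<omega> \<partial>M) * (\<Prod>t\<in>J. \<integral>\<^sup>+\<omega>. q t \<omega> \<partial>M)"
proof -
  define L where "L = insert None (Some ` J)"
  define gr where "gr = case_option (insert None (Some ` past n)) (\<lambda>t. {Some t})"
  define E where "E = case_option (sets Y_algebra) U_sets"
  define X where "X = case_option f q"
  have q_sets: "q t -` S \<inter> space M \<in> U_sets t" if "t \<in> J" "S \<in> sets borel" for t and S :: "ennreal set"
    using measurable_sets[OF q[OF that(1)] that(2)] by (auto simp: sets_vimage_algebra2 U_sets_def)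
  have rv: "random_variable borel (X i)" if "i \<in> L" for i
  proof (cases i)
    case None
    then show ?thesis using past_imp_measurable[OF f] by (simp add: X_def)
  next
    case (Some t)
    then have t: "t \<in> J" using that by (auto simp: L_def)
    have "U_sets t \<subseteq> events"
      using UU_measurable[of t] t J(2) by (auto simp: U_sets_def)
    then show ?thesis using q_sets[OF t] Some by (auto simp: X_def intro!: measurableI)
  qed
  have "indep_sets E (\<Union>i\<in>L. gr i)"
    unfolding E_def
    by (rule indep_sets_mono_index[OF _ indep_Y_U]) (use J(2) in \<open>auto simp: L_def gr_def past_def\<close>)
  then have "indep_sets (\<lambda>i. sigma_sets (space M) (\<Union>j\<in>gr i. E j)) L"
  proof (rule indep_sets_collect_sigma)
    show "Int_stable (E j)" for j
    proof (cases j)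
      case None
      then show ?thesis by (simp add: E_def sets.Int_stable)
    next
      case (Some t)
      have "\<exists>C. UU t -` A \<inter> space M \<inter> (UU t -` B \<inter> space M) = UU t -` C \<inter> space M \<and> C \<in> sets borel"
        if "A \<in> sets borel" "B \<in> sets borel" for A B
        using that by (intro exI[of _ "A \<inter> B"]) auto
      then show ?thesis using Some by (auto simp: E_def Int_stable_def U_sets_def)
    qed
    \<comment> \<open>Indices in \<open>J\<close> have generation \<open>Suc n\<close>, those in
      \<open>past n\<close> at most \<open>n\<close>.\<close>
    show "disjoint_family_on gr L"
    proof (unfold disjoint_family_on_def, intro ballI impI)
      fix i j assume "i \<in> L" "j \<in> L" "i \<noteq> j"
      then show "gr i \<inter> gr j = {}"
        using J(3) by (cases i; cases j) (fastforce simp: gr_def L_def past_def)+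
    qed
  qed
  then have "indep_sets (\<lambda>i. {X i -` S \<inter> space M | S. S \<in> sets borel}) L"
  proof (rule indep_sets_mono_sets)
    fix i assume i: "i \<in> L"
    show "{X i -` S \<inter> space M | S. S \<in> sets borel} \<subseteq> sigma_sets (space M) (\<Union>j\<in>gr i. E j)"
    proof (cases i)
      case None
      have "(\<Union>j\<in>gr None. E j) = sets Y_algebra \<union> (\<Union>t\<in>past n. U_sets t)"
        by (auto simp: gr_def E_def)
      then show ?thesis
        using measurable_sets[OF f] None by (auto simp: X_def sets_past_algebra)
    next
      case (Some t)
      then have "t \<in> J" using i by (auto simp: L_def)
      then have "q t -` S \<inter> space M \<in> sigma_sets (space M) (U_sets t)" if "S \<in> sets borel" for S
        using that by (intro sigma_sets.Basic q_sets)
      then show ?thesis unfolding Some X_def gr_def E_def by auto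
    qed
  qed
  then have "indep_vars (\<lambda>_. borel) X L"
    using rv by (simp add: indep_vars_def2)
  then have "(\<integral>\<^sup>+\<omega>. (\<Prod>i\<in>L. X i \<omega>) \<partial>M) = (\<Prod>i\<in>L. \<integral>\<^sup>+\<omega>. X i \<omega> \<partial>M)"
    using J(1) by (intro indep_vars_nn_integral) (auto simp: L_def)
  then show ?thesis
    using J(1) by (simp add: L_def X_def prod.reindex)
qed

section \<open>Laplace functional of the branching process\<close>

abbreviation B :: "nat \<Rightarrow> nat \<Rightarrow> 'w \<Rightarrow> nat^'d" where
  "B \<equiv> immigrant_line xi Y0"

abbreviation Z :: "nat \<Rightarrow> 'w \<Rightarrow> real^'d" where
  "Z \<equiv> branching_process xi Y0"

definition immigrants :: "real^'d \<Rightarrow> real^'d" where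
  "immigrants x = (\<chi> i. real (floor_vec x $ i))"

text \<open>Generation \<open>n\<close> is represented by the indices of the uniforms it uses when
  reproducing: line \<open>m\<close>, target generation \<open>Suc n\<close>, the k-th individual of
  type \<open>j\<close>.\<close>

definition parents :: "nat \<Rightarrow> 'w \<Rightarrow> (nat \<times> nat \<times> nat \<times> 'd) set" where
  "parents n \<omega> = {(m, l, k, j). l = Suc n \<and> m \<le> n \<and> 1 \<le> k \<and> k \<le> B m n \<omega> $ j}"

lemma Y0_algebra_measurable: "Y0 n \<in> borel_measurable Y_algebra"
  using Y_algebra_measurable by (cases n) auto

lemma B_past_measurable: "(\<lambda>\<omega>. B m n \<omega> $ j) \<in> measurable (past_algebra n) (count_space UNIV)"
proof (rule immigrant_line_measurable)
  show "Y0 m \<in> borel_measurable (past_algebra n)" for m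
    using Y0_algebra_measurable by (rule Y_algebra_imp_past_measurable)
  show "xi m l k i j \<in> measurable (past_algebra n) (count_space UNIV)" if "m < l" "l \<le> n" "1 \<le> k" for m l k i j
  proof -
    have t: "(m, l, k, j) \<in> past n" "(m, l, k, j) \<in> index" using that by (auto simp: past_def index_def)
    have "UU (m, l, k, j) \<omega> \<in> {0..1}" if "\<omega> \<in> space (past_algebra n)" for \<omega>
      using UU_range[OF t(2), of \<omega>] that by simp
    from psi_compose_measurable[OF UU_past_measurable[OF t(1)] this]
    show ?thesis by (simp add: xi_eq[abs_def])
  qed
qed

lemma sum_parents:
  "(\<Sum>t\<in>parents n \<omega>. f t) = (\<Sum>m\<le>n. \<Sum>j\<in>UNIV. \<Sum>k=1..B m n \<omega> $ j. f (m, Suc n, k, j))"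
  for f :: "_ \<Rightarrow> real"
proof -
  have "parents n \<omega> = (\<lambda>(m, j, k). (m, Suc n, k, j)) ` (SIGMA m:{..n}. SIGMA j:UNIV. {1..B m n \<omega> $ j})"
    by (force simp: parents_def)
  moreover have "inj_on (\<lambda>(m, j, k). (m, Suc n, k, j)) (SIGMA m:{..n}. SIGMA j:UNIV. {1..B m n \<omega> $ j})"
    by (auto simp: inj_on_def)
  ultimately show ?thesis
    by (simp add: sum.reindex sum.Sigma split_def)
qed

lemma finite_parents: "finite (parents n \<omega>)"
proof -
  have "parents n \<omega> \<subseteq> {..n} \<times> {Suc n} \<times> (\<Union>m\<in>{..n}. \<Union>j. {..B m n \<omega> $ j}) \<times> UNIV"
    by (force simp: parents_def)
  then show ?thesis by (rule finite_subset) auto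
qed

lemma parents_past: "{\<omega>\<in>space M. parents n \<omega> = J} \<in> sets (past_algebra n)"
proof -
  have "{\<omega>\<in>space (past_algebra n). t \<in> parents n \<omega> \<longleftrightarrow> t \<in> J} \<in> sets (past_algebra n)" for t
  proof (cases t)
    case (fields m l k j)
    define c where "c \<longleftrightarrow> l = Suc n \<and> m \<le> n \<and> 1 \<le> k"
    have eq: "t \<in> parents n \<omega> \<longleftrightarrow> c \<and> k \<le> B m n \<omega> $ j" for \<omega>
      by (auto simp: fields parents_def c_def)
    have "{\<omega>\<in>space (past_algebra n). k \<le> B m n \<omega> $ j} \<in> sets (past_algebra n)"
      using measurable_sets[OF B_past_measurable[of m n j], of "{k..}"]
      by (simp add: vimage_def Int_def conj_commute)
    then show ?thesis
      unfolding eq using sets.sets_Collect_neg[of "past_algebra n" "\<lambda>\<omega>. k \<le> B m n \<omega> $ j"]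
      by (cases c; cases "t \<in> J") (auto simp: sets.top[of "past_algebra n", simplified])
  qed
  \<comment> \<open>Equality with \<open>J\<close> is tested index by index, and there are only
    countably many indices.\<close>
  then have "{\<omega>\<in>space (past_algebra n). \<forall>t. t \<in> parents n \<omega> \<longleftrightarrow> t \<in> J} \<in> sets (past_algebra n)"
    by (rule sets.sets_Collect_countable_All)
  then show ?thesis by (simp add: set_eq_iff)
qed

lemma Z_0: "Z 0 \<omega> = 0"
  by (simp add: branching_process_def floor_vec_def vec_eq_iff)

lemma Z_Suc:
  "\<theta> \<bullet> Z (Suc n) \<omega> = (\<Sum>t\<in>parents n \<omega>. offspring_weight \<theta> t \<omega>) + \<theta> \<bullet> immigrants (Y (Suc n) \<omega>)"
proof -
  have "real (B m (Suc n) \<omega> $ i) = (\<Sum>j\<in>UNIV. \<Sum>k=1..B m n \<omega> $ j. real (xi m (Suc n) k i j \<omega>))" if "m \<le> n" for m i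
    using that by simp
  then have "Z (Suc n) \<omega> $ i = (\<Sum>m\<le>n. \<Sum>j\<in>UNIV. \<Sum>k=1..B m n \<omega> $ j. real (xi m (Suc n) k i j \<omega>)) +
      immigrants (Y (Suc n) \<omega>) $ i" for i
    by (simp add: branching_process_def immigrants_def)
  then have "\<theta> \<bullet> Z (Suc n) \<omega> = (\<Sum>i\<in>UNIV. \<theta> $ i *
      (\<Sum>m\<le>n. \<Sum>j\<in>UNIV. \<Sum>k=1..B m n \<omega> $ j. real (xi m (Suc n) k i j \<omega>))) + \<theta> \<bullet> immigrants (Y (Suc n) \<omega>)"
    by (simp add: inner_vec_def distrib_left sum.distrib)
  also have "(\<Sum>i\<in>UNIV. \<theta> $ i * (\<Sum>m\<le>n. \<Sum>j\<in>UNIV. \<Sum>k=1..B m n \<omega> $ j. real (xi m (Suc n) k i j \<omega>))) =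
      (\<Sum>m\<le>n. \<Sum>j\<in>UNIV. \<Sum>k=1..B m n \<omega> $ j. \<Sum>i\<in>UNIV. \<theta> $ i * real (xi m (Suc n) k i j \<omega>))"
  proof -
    have "(\<Sum>i\<in>UNIV. \<theta> $ i * (\<Sum>m\<le>n. \<Sum>j\<in>UNIV. \<Sum>k=1..B m n \<omega> $ j. real (xi m (Suc n) k i j \<omega>))) =
        (\<Sum>i\<in>UNIV. \<Sum>m\<le>n. \<Sum>j\<in>UNIV. \<Sum>k=1..B m n \<omega> $ j. \<theta> $ i * real (xi m (Suc n) k i j \<omega>))"
      by (simp only: sum_distrib_left)
    also have "\<dots> = (\<Sum>m\<le>n. \<Sum>i\<in>UNIV. \<Sum>j\<in>UNIV. \<Sum>k=1..B m n \<omega> $ j. \<theta> $ i * real (xi m (Suc n) k i j \<omega>))"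
      by (rule sum.swap)
    also have "\<dots> = (\<Sum>m\<le>n. \<Sum>j\<in>UNIV. \<Sum>i\<in>UNIV. \<Sum>k=1..B m n \<omega> $ j. \<theta> $ i * real (xi m (Suc n) k i j \<omega>))"
      by (rule sum.cong[OF refl], rule sum.swap)
    also have "\<dots> = (\<Sum>m\<le>n. \<Sum>j\<in>UNIV. \<Sum>k=1..B m n \<omega> $ j. \<Sum>i\<in>UNIV. \<theta> $ i * real (xi m (Suc n) k i j \<omega>))"
      by (rule sum.cong[OF refl], rule sum.cong[OF refl], rule sum.swap)
    finally show ?thesis .
  qed
  finally show ?thesis by (simp add: sum_parents offspring_weight_def)
qed

lemma Z_eq: "Z n \<omega> $ j = (\<Sum>m\<le>n. real (B m n \<omega> $ j))"
  by (simp add: branching_process_def)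

text \<open>The branching property over one generation: each parent of type \<open>j\<close>
  contributes an independent factor exp(-(L theta)_j), whence theta becomes L theta. The functional
  \<open>h\<close> may depend on the entire immigration, also on later times, so that the factors of
  newer immigrants can be absorbed into it.\<close>

lemma nn_integral_Z_step:
  assumes h: "h \<in> borel_measurable Y_algebra" and \<theta>: "nonneg_vec \<theta>"
  shows "(\<integral>\<^sup>+\<omega>. h \<omega> * ennreal (exp (- (\<theta> \<bullet> Z (Suc n) \<omega>))) \<partial>M) =
    (\<integral>\<^sup>+\<omega>. h \<omega> * ennreal (exp (- (\<theta> \<bullet> immigrants (Y (Suc n) \<omega>)))) *
      ennreal (exp (- (law.laplace_exponent \<theta> \<bullet> Z n \<omega>))) \<partial>M)"
proof -
  define h' where "h' \<omega> = h \<omega> * ennreal (exp (- (\<theta> \<bullet> immigrants (Y (Suc n) \<omega>))))" for \<omega>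
  define q where "q t \<omega> = ennreal (exp (- offspring_weight \<theta> t \<omega>))" for t \<omega>
  define c where "c t = ennreal (law.laplace \<theta> (snd (snd (snd t))))" for t :: "nat \<times> nat \<times> nat \<times> 'd"
  have "(\<lambda>\<omega>. floor_vec (Y (Suc n) \<omega>) $ i) \<in> measurable Y_algebra (count_space UNIV)" for i
    by (rule floor_vec_measurable[OF Y_algebra_measurable])
  then have "(\<lambda>\<omega>. ennreal (exp (- (\<theta> \<bullet> immigrants (Y (Suc n) \<omega>))))) \<in> borel_measurable Y_algebra"
    unfolding inner_vec_def immigrants_def vec_lambda_beta inner_real_def by measurable
  then have h': "h' \<in> borel_measurable Y_algebra"
    unfolding h'_def using h by measurable
  have q_meas: "q t \<in> borel_measurable (vimage_algebra (space M) (UU t) borel)" if t: "t \<in> index" for t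
  proof -
    obtain m l k j where t_eq: "t = (m, l, k, j)" by (cases t) auto
    have "(\<lambda>\<omega>. psi j (UU t \<omega>) $ i) \<in> measurable (vimage_algebra (space M) (UU t) borel) (count_space UNIV)" for i
      by (rule psi_compose_measurable) (use UU_range[OF t] in \<open>auto intro!: measurable_vimage_algebra1\<close>)
    then show ?thesis
      unfolding q_def t_eq offspring_weight_def prod.case xi_eq by measurable
  qed
  have "(\<integral>\<^sup>+\<omega>. h \<omega> * ennreal (exp (- (\<theta> \<bullet> Z (Suc n) \<omega>))) \<partial>M) = (\<integral>\<^sup>+\<omega>. h' \<omega> * (\<Prod>t\<in>parents n \<omega>. q t \<omega>) \<partial>M)"
  proof (rule nn_integral_cong)
    fix \<omega>
    have "(\<Prod>t\<in>parents n \<omega>. q t \<omega>) = ennreal (exp (- (\<Sum>t\<in>parents n \<omega>. offspring_weight \<theta> t \<omega>)))"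
      by (simp add: q_def prod_ennreal exp_sum finite_parents flip: sum_negf)
    moreover have "exp (- (\<theta> \<bullet> Z (Suc n) \<omega>)) =
        exp (- (\<theta> \<bullet> immigrants (Y (Suc n) \<omega>))) * exp (- (\<Sum>t\<in>parents n \<omega>. offspring_weight \<theta> t \<omega>))"
      by (simp add: Z_Suc flip: exp_add)
    ultimately show "h \<omega> * ennreal (exp (- (\<theta> \<bullet> Z (Suc n) \<omega>))) = h' \<omega> * (\<Prod>t\<in>parents n \<omega>. q t \<omega>)"
      by (simp add: h'_def ennreal_mult mult.assoc)
  qed
  also have "\<dots> = (\<integral>\<^sup>+\<omega>. h' \<omega> * (\<Prod>t\<in>parents n \<omega>. c t) \<partial>M)"
  proof (rule nn_integral_random_prod[where I="{t\<in>index. fst (snd t) = Suc n}"])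
    show "finite (parents n \<omega>) \<and> parents n \<omega> \<subseteq> {t\<in>index. fst (snd t) = Suc n}" for \<omega>
      using finite_parents by (auto simp: parents_def index_def)
    show "{\<omega>\<in>space M. parents n \<omega> = J} \<in> events" for J
      using parents_past events_past_algebra by blast
    show "h' \<in> borel_measurable M" using h' by (rule Y_algebra_imp_measurable)
    show "q t \<in> borel_measurable M" if "t \<in> {t\<in>index. fst (snd t) = Suc n}" for t
    proof -
      have "sets (vimage_algebra (space M) (UU t) borel) \<subseteq> events"
        using that by (intro sets_image_in_sets UU_measurable) auto
      then show ?thesis using q_meas[of t] that by (auto simp: measurable_def)
    qed
    fix J assume J: "finite J" "J \<subseteq> {t\<in>index. fst (snd t) = Suc n}"
    have "(\<integral>\<^sup>+\<omega>. (h' \<omega> * indicator {\<omega>\<in>space M. parents n \<omega> = J} \<omega>) * (\<Prod>t\<in>J. q t \<omega>) \<partial>M) =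
        (\<integral>\<^sup>+\<omega>. h' \<omega> * indicator {\<omega>\<in>space M. parents n \<omega> = J} \<omega> \<partial>M) * (\<Prod>t\<in>J. \<integral>\<^sup>+\<omega>. q t \<omega> \<partial>M)"
    proof (rule nn_integral_past_times_current)
      show "(\<lambda>\<omega>. h' \<omega> * indicator {\<omega>\<in>space M. parents n \<omega> = J} \<omega>) \<in> borel_measurable (past_algebra n)"
        using parents_past Y_algebra_imp_past_measurable[OF h']
        by (intro borel_measurable_times_ennreal borel_measurable_indicator) auto
    qed (use J q_meas in auto)
    also have "(\<Prod>t\<in>J. \<integral>\<^sup>+\<omega>. q t \<omega> \<partial>M) = (\<Prod>t\<in>J. c t)"
      unfolding q_def c_def using J by (intro prod.cong offspring_weight_laplace \<theta>) auto
    finally show "(\<integral>\<^sup>+\<omega>. h' \<omega> * indicator {\<omega>\<in>space M. parents n \<omega> = J} \<omega> * (\<Prod>t\<in>J. q t \<omega>) \<partial>M) =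
        (\<integral>\<^sup>+\<omega>. h' \<omega> * indicator {\<omega>\<in>space M. parents n \<omega> = J} \<omega> \<partial>M) * (\<Prod>t\<in>J. c t)" .
  qed
  also have "\<dots> = (\<integral>\<^sup>+\<omega>. h' \<omega> * ennreal (exp (- (law.laplace_exponent \<theta> \<bullet> Z n \<omega>))) \<partial>M)"
  proof (rule nn_integral_cong)
    fix \<omega>
    have "(\<Prod>t\<in>parents n \<omega>. c t) = ennreal (exp (- (\<Sum>t\<in>parents n \<omega>. law.laplace_exponent \<theta> $ snd (snd (snd t)))))"
      by (simp add: c_def law.laplace_eq_exp[OF \<theta>] prod_ennreal exp_sum finite_parents flip: sum_negf)
    also have "(\<Sum>t\<in>parents n \<omega>. law.laplace_exponent \<theta> $ snd (snd (snd t))) = law.laplace_exponent \<theta> \<bullet> Z n \<omega>"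
    proof -
      have "(\<Sum>t\<in>parents n \<omega>. law.laplace_exponent \<theta> $ snd (snd (snd t))) =
          (\<Sum>m\<le>n. \<Sum>j\<in>UNIV. law.laplace_exponent \<theta> $ j * real (B m n \<omega> $ j))"
        by (simp add: sum_parents mult.commute)
      also have "\<dots> = (\<Sum>j\<in>UNIV. \<Sum>m\<le>n. law.laplace_exponent \<theta> $ j * real (B m n \<omega> $ j))"
        by (rule sum.swap)
      finally show ?thesis by (simp add: inner_vec_def Z_eq sum_distrib_left)
    qed
    finally show "h' \<omega> * (\<Prod>t\<in>parents n \<omega>. c t) = h' \<omega> * ennreal (exp (- (law.laplace_exponent \<theta> \<bullet> Z n \<omega>)))"
      by simp
  qed
  finally show ?thesis by (simp add: h'_def)
qed

lemma immigrants_algebra_measurable: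
  "(\<lambda>\<omega>. \<theta> \<bullet> immigrants (Y l \<omega>)) \<in> borel_measurable Y_algebra"
proof -
  have "(\<lambda>\<omega>. floor_vec (Y l \<omega>) $ i) \<in> measurable Y_algebra (count_space UNIV)" for i
    by (rule floor_vec_measurable[OF Y_algebra_measurable])
  then show ?thesis
    unfolding inner_vec_def immigrants_def vec_lambda_beta inner_real_def by measurable
qed

text \<open>Peeling off generations from the last one: immigrants of time \<open>l\<close> reproduce
  n - l times and meet the exponent iterated that often. Both \<open>h\<close> and theta change in
  the induction and must be arbitrary.\<close>

lemma nn_integral_Z:
  assumes "h \<in> borel_measurable Y_algebra" "nonneg_vec \<theta>"
  shows "(\<integral>\<^sup>+\<omega>. h \<omega> * ennreal (exp (- (\<theta> \<bullet> Z n \<omega>))) \<partial>M) =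
    (\<integral>\<^sup>+\<omega>. h \<omega> * (\<Prod>l=1..n. ennreal (exp (- ((law.laplace_exponent ^^ (n - l)) \<theta> \<bullet> immigrants (Y l \<omega>))))) \<partial>M)"
  using assms
proof (induction n arbitrary: h \<theta>)
  case 0
  then show ?case by (simp add: Z_0)
next
  case (Suc n)
  have h': "(\<lambda>\<omega>. h \<omega> * ennreal (exp (- (\<theta> \<bullet> immigrants (Y (Suc n) \<omega>))))) \<in> borel_measurable Y_algebra"
    using Suc.prems(1) immigrants_algebra_measurable[of \<theta> "Suc n"] by measurable
  have iterate: "(law.laplace_exponent ^^ (n - l)) (law.laplace_exponent \<theta>) = (law.laplace_exponent ^^ (Suc n - l)) \<theta>"
    if "l \<in> {1..n}" for l
    using that by (simp add: Suc_diff_le funpow_swap1)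
  show ?case
    unfolding nn_integral_Z_step[OF Suc.prems] Suc.IH[OF h' law.laplace_exponent_nonneg[OF Suc.prems(2)]]
  proof (rule nn_integral_cong)
    fix \<omega>
    define f where "f l = ennreal (exp (- ((law.laplace_exponent ^^ (Suc n - l)) \<theta> \<bullet> immigrants (Y l \<omega>))))" for l
    have "(\<Prod>l=1..n. ennreal (exp (- ((law.laplace_exponent ^^ (n - l)) (law.laplace_exponent \<theta>) \<bullet> immigrants (Y l \<omega>))))) =
        (\<Prod>l=1..n. f l)"
      unfolding f_def by (rule prod.cong) (simp_all add: iterate)
    moreover have "(\<Prod>l=1..Suc n. f l) = (\<Prod>l=1..n. f l) * f (Suc n)" by simp
    moreover have "f (Suc n) = ennreal (exp (- (\<theta> \<bullet> immigrants (Y (Suc n) \<omega>))))" by (simp add: f_def)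
    ultimately show "h \<omega> * ennreal (exp (- (\<theta> \<bullet> immigrants (Y (Suc n) \<omega>)))) *
        (\<Prod>l=1..n. ennreal (exp (- ((law.laplace_exponent ^^ (n - l)) (law.laplace_exponent \<theta>) \<bullet> immigrants (Y l \<omega>))))) =
        h \<omega> * (\<Prod>l=1..Suc n. ennreal (exp (- ((law.laplace_exponent ^^ (Suc n - l)) \<theta> \<bullet> immigrants (Y l \<omega>)))))"
      unfolding f_def[symmetric] by (simp only: mult.assoc mult.commute[of "\<Prod>l=1..n. f l"])
  qed
qed

lemma Z_nonneg: "nonneg_vec (branching_process x Y0 n \<omega>)"
  by (simp add: nonneg_vec_def branching_process_def sum_nonneg)

lemma branching_process_measurable:
  assumes "\<And>m l k i j. m < l \<Longrightarrow> 1 \<le> k \<Longrightarrow> x m l k i j \<in> measurable M (count_space UNIV)"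
  shows "random_variable borel (branching_process x Y0 n)"
  unfolding borel_measurable_cart_iff branching_process_def vec_lambda_beta
proof (intro allI borel_measurable_sum)
  fix i m
  have "(\<lambda>\<omega>. immigrant_line x Y0 m n \<omega> $ i) \<in> measurable M (count_space UNIV)"
    using assms by (intro immigrant_line_measurable Y0_measurable) auto
  then show "(\<lambda>\<omega>. real (immigrant_line x Y0 m n \<omega> $ i)) \<in> borel_measurable M"
    by measurable
qed

lemma Z_measurable [measurable]: "random_variable borel (Z n)"
  by (rule branching_process_measurable) (rule xi_measurable)

lemma offspring_process_measurable [measurable]: "random_variable borel (branching_process (offspring Psi U) Y0 n)"
  by (rule branching_process_measurable) (rule offspring_measurable)

lemma branching_process_AE: "AE \<omega> in M. \<forall>n. branching_process (offspring Psi U) Y0 n \<omega> = Z n \<omega>"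
  using offspring_AE
proof eventually_elim
  case (elim \<omega>)
  have "immigrant_line (offspring Psi U) Y0 m n \<omega> = B m n \<omega>" for m n
    by (induction n) (auto simp: elim)
  then show ?case by (simp add: branching_process_def)
qed

lemma expectation_Z:
  assumes h: "h \<in> borel_measurable Y_algebra" and h01: "\<And>\<omega>. 0 \<le> h \<omega>" "\<And>\<omega>. h \<omega> \<le> 1" and \<theta>: "nonneg_vec \<theta>"
  shows "expectation (\<lambda>\<omega>. h \<omega> * exp (- (\<theta> \<bullet> Z n \<omega>))) =
    expectation (\<lambda>\<omega>. h \<omega> * (\<Prod>l=1..n. exp (- ((law.laplace_exponent ^^ (n - l)) \<theta> \<bullet> immigrants (Y l \<omega>)))))"
proof -
  have [measurable]: "random_variable borel h" using h by (rule Y_algebra_imp_measurable)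
  have [measurable]: "random_variable borel (\<lambda>\<omega>. \<theta>' \<bullet> immigrants (Y l \<omega>))" for \<theta>' l
    using immigrants_algebra_measurable by (rule Y_algebra_imp_measurable)
  have "expectation (\<lambda>\<omega>. h \<omega> * exp (- (\<theta> \<bullet> Z n \<omega>))) = enn2real (\<integral>\<^sup>+\<omega>. ennreal (h \<omega>) * ennreal (exp (- (\<theta> \<bullet> Z n \<omega>))) \<partial>M)"
    using h01 by (subst integral_eq_nn_integral) (auto simp: ennreal_mult)
  also have "(\<integral>\<^sup>+\<omega>. ennreal (h \<omega>) * ennreal (exp (- (\<theta> \<bullet> Z n \<omega>))) \<partial>M) =
      (\<integral>\<^sup>+\<omega>. ennreal (h \<omega>) * (\<Prod>l=1..n. ennreal (exp (- ((law.laplace_exponent ^^ (n - l)) \<theta> \<bullet> immigrants (Y l \<omega>))))) \<partial>M)"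
    by (rule nn_integral_Z[OF measurable_compose[OF h measurable_ennreal] \<theta>])
  also have "enn2real \<dots> =
      expectation (\<lambda>\<omega>. h \<omega> * (\<Prod>l=1..n. exp (- ((law.laplace_exponent ^^ (n - l)) \<theta> \<bullet> immigrants (Y l \<omega>)))))"
    using h01 by (subst integral_eq_nn_integral) (auto simp: ennreal_mult prod_ennreal prod_nonneg)
  finally show ?thesis .
qed

section \<open>Recurrence of Z against divergence of the series\<close>

lemma immigrants_nonneg: "nonneg_vec (immigrants x)"
  by (simp add: nonneg_vec_def immigrants_def)

lemma immigrants_bounds:
  assumes "nonneg_vec x"
  shows "x $ i - 1 \<le> immigrants x $ i" "immigrants x $ i \<le> x $ i"
proof -
  have "immigrants x $ i = of_int \<lfloor>x $ i\<rfloor>"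
    using assms by (simp add: immigrants_def floor_vec_def nonneg_vec_def)
  then show "x $ i - 1 \<le> immigrants x $ i" "immigrants x $ i \<le> x $ i" by linarith+
qed

lemma sum_imp_branching_recurrent:
  assumes sum: "(\<Sum>n. ennreal (\<Prod>k<n. p k)) = \<infinity>"
  shows "recurrent M (branching_process (offspring Psi U)) Y"
proof -
  obtain C where C: "0 < C" "\<And>x. nonneg_vec x \<Longrightarrow> u \<bullet> x \<le> C * infnorm x"
    using positive_weights_infnorm[of u] u_pos by metis
  have nonneg_u: "nonneg_vec u" using u_pos by (simp add: nonneg_vec_def less_imp_le)
  show ?thesis
  proof (rule sum_imp_recurrent[OF sum])
    fix n
    define G where "G k x = (indicator {x. r ^ k * infnorm x \<le> y} x * exp (- (C * (r ^ k * infnorm x))) :: real)"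
      for k and x :: "real^'d"
    define h where "h \<omega> = (\<Prod>l=1..n. indicator {x. r ^ (n - l) * infnorm x \<le> y} (Y l \<omega>) :: real)" for \<omega>
    have G[measurable]: "G k \<in> borel_measurable borel" for k unfolding G_def by measurable
    have G01: "0 \<le> G k x" "G k x \<le> 1" for k x
      using C r by (auto simp: G_def indicator_def infnorm_pos_le)
    have h: "h \<in> borel_measurable Y_algebra"
    proof -
      note Y_algebra_measurable[measurable]
      show ?thesis unfolding h_def by measurable
    qed
    have h01: "0 \<le> h \<omega>" "h \<omega> \<le> 1" for \<omega>
      by (auto simp: h_def intro!: prod_nonneg prod_le_1)
    have [measurable]: "random_variable borel h" using h by (rule Y_algebra_imp_measurable)
    have [measurable]: "random_variable borel (\<lambda>\<omega>. \<theta>' \<bullet> immigrants (Y l \<omega>))" for \<theta>' l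
      using immigrants_algebra_measurable by (rule Y_algebra_imp_measurable)
    have L_nonneg: "0 \<le> (law.laplace_exponent ^^ k) u \<bullet> immigrants x" for k x
      using law.funpow_laplace_exponent_nonneg[OF nonneg_u, of k] immigrants_nonneg[of x]
      by (auto simp: inner_vec_def nonneg_vec_def intro!: sum_nonneg)
    have "(\<Prod>k<n. expectation (\<lambda>\<omega>. indicator {\<omega>\<in>space M. r ^ k * infnorm (Y 1 \<omega>) \<le> y} \<omega> *
          exp (- (C * (r ^ k * infnorm (Y 1 \<omega>)))))) = (\<Prod>k<n. expectation (\<lambda>\<omega>. G k (Y 1 \<omega>)))"
      by (intro prod.cong Bochner_Integration.integral_cong refl) (auto simp: G_def indicator_def)
    also have "\<dots> = expectation (\<lambda>\<omega>. \<Prod>l=1..n. G (n - l) (Y l \<omega>))"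
      by (rule expectation_prod_Y[symmetric]) (use G01 in auto)
    also have "\<dots> \<le> expectation (\<lambda>\<omega>. h \<omega> *
        (\<Prod>l=1..n. exp (- ((law.laplace_exponent ^^ (n - l)) u \<bullet> immigrants (Y l \<omega>)))))"
    proof (rule integral_mono)
      show "integrable M (\<lambda>\<omega>. \<Prod>l=1..n. G (n - l) (Y l \<omega>))"
        by (rule integrable_const_bound[where B=1]) (use G01 in \<open>auto simp: abs_prod intro!: AE_I2 prod_le_1\<close>)
      show "integrable M (\<lambda>\<omega>. h \<omega> * (\<Prod>l=1..n. exp (- ((law.laplace_exponent ^^ (n - l)) u \<bullet> immigrants (Y l \<omega>)))))"
      proof (rule integrable_const_bound[where B=1])
        show "AE \<omega> in M. norm (h \<omega> * (\<Prod>l=1..n. exp (- ((law.laplace_exponent ^^ (n - l)) u \<bullet> immigrants (Y l \<omega>))))) \<le> 1"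
          using h01 L_nonneg by (intro AE_I2) (simp add: abs_mult prod_nonneg mult_le_one prod_le_1)
      qed measurable
      fix \<omega> assume w: "\<omega> \<in> space M"
      \<comment> \<open>By L^k u <= r^k u and since taking integer parts only decreases nonnegative
        entries, Z admits the same product bound as X.\<close>
      have "(\<Prod>l=1..n. exp (- (C * (r ^ (n - l) * infnorm (Y l \<omega>))))) \<le>
          (\<Prod>l=1..n. exp (- ((law.laplace_exponent ^^ (n - l)) u \<bullet> immigrants (Y l \<omega>))))"
      proof (intro prod_mono conjI)
        fix l
        have "(law.laplace_exponent ^^ (n - l)) u \<bullet> immigrants (Y l \<omega>) \<le> (\<Sum>i\<in>UNIV. (r ^ (n - l) * u $ i) * Y l \<omega> $ i)"
          unfolding inner_vec_def inner_real_def
          using law.funpow_laplace_exponent_le[OF nonneg_u order_refl, of "n - l"]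
            immigrants_bounds(2)[OF Y_nonneg[OF w]] immigrants_nonneg[of "Y l \<omega>"] r u_pos
          by (intro sum_mono mult_mono) (auto simp: nonneg_vec_def less_imp_le)
        also have "\<dots> = r ^ (n - l) * (u \<bullet> Y l \<omega>)" by (simp add: inner_vec_def sum_distrib_left mult.assoc)
        also have "\<dots> \<le> r ^ (n - l) * (C * infnorm (Y l \<omega>))"
          using C(2)[OF Y_nonneg[OF w]] r by (intro mult_left_mono) auto
        finally show "exp (- (C * (r ^ (n - l) * infnorm (Y l \<omega>)))) \<le>
            exp (- ((law.laplace_exponent ^^ (n - l)) u \<bullet> immigrants (Y l \<omega>)))"
          by (simp add: mult.left_commute)
      qed simp
      then show "(\<Prod>l=1..n. G (n - l) (Y l \<omega>)) \<le>
          h \<omega> * (\<Prod>l=1..n. exp (- ((law.laplace_exponent ^^ (n - l)) u \<bullet> immigrants (Y l \<omega>))))"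
        using h01 unfolding G_def prod.distrib h_def[symmetric] by (intro mult_left_mono) auto
    qed
    also have "\<dots> = expectation (\<lambda>\<omega>. h \<omega> * exp (- (u \<bullet> Z n \<omega>)))"
      by (rule expectation_Z[symmetric]) (use h h01 nonneg_u in auto)
    also have "\<dots> = expectation (\<lambda>\<omega>. h \<omega> * exp (- (u \<bullet> branching_process (offspring Psi U) Y0 n \<omega>)))"
      using branching_process_AE by (intro integral_cong_AE) (auto elim!: eventually_mono)
    finally show "(\<Prod>k<n. expectation (\<lambda>\<omega>. indicator {\<omega>\<in>space M. r ^ k * infnorm (Y 1 \<omega>) \<le> y} \<omega> *
          exp (- (C * (r ^ k * infnorm (Y 1 \<omega>)))))) \<le>
        expectation (\<lambda>\<omega>. (\<Prod>l=1..n. indicator {x. r ^ (n - l) * infnorm x \<le> y} (Y l \<omega>)) *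
          exp (- (u \<bullet> branching_process (offspring Psi U) Y0 n \<omega>)))"
      by (simp add: h_def)
  qed (use C Z_nonneg in auto)
qed

lemma branching_recurrent_imp_sum:
  assumes rec: "recurrent M (branching_process (offspring Psi U)) Y"
  shows "(\<Sum>n. ennreal (\<Prod>k<n. p k)) = \<infinity>"
  using rec
proof (rule recurrent_imp_sum)
  fix b :: real assume b: "0 < b"
  obtain cu Cu where cu: "0 < cu" "0 < Cu" "\<And>x. nonneg_vec x \<Longrightarrow> cu * infnorm x \<le> u \<bullet> x"
    "\<And>x. nonneg_vec x \<Longrightarrow> u \<bullet> x \<le> Cu * infnorm x"
    using positive_weights_infnorm[of u] u_pos by metis
  obtain K where K: "\<And>k j. r ^ (K + k) * u $ j / 2 \<le> (law.laplace_exponent ^^ k) (r ^ K *\<^sub>R u) $ j"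
    using law.funpow_laplace_exponent_ge by metis
  define \<theta> where "\<theta> = r ^ K *\<^sub>R u"
  \<comment> \<open>Obtained from L^k theta >= r^(K+k) u / 2 and u.x >= cu times the norm of x; the
    resulting decay exp(-c x) is at most 1/(c x), as the product comparison requires.\<close>
  define c where "c = r ^ K * cu / 2"
  \<comment> \<open>Integer parts lose at most 1 per coordinate; at scale \<open>k\<close> this
    costs a factor exp(c' r^k), and these factors have a bounded product.\<close>
  define c' where "c' = r ^ K * (\<Sum>i\<in>UNIV. u $ i) / 2"
  define t where "t = r ^ K * (Cu * b)"
  define g where "g x = exp (- (c * x))" for x :: real
  have \<theta>: "nonneg_vec \<theta>" using u_pos r by (simp add: nonneg_vec_def \<theta>_def less_imp_le)
  have c: "0 < c" "0 \<le> c'" using cu r u_pos by (auto simp: c_def c'_def less_imp_le intro!: mult_nonneg_nonneg sum_nonneg)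
  have g[measurable]: "g \<in> borel_measurable borel" unfolding g_def by measurable
  have g01: "0 \<le> g x" "g x \<le> 1" if "0 \<le> x" for x using that c by (auto simp: g_def)
  obtain D where D: "0 < D" "\<And>n. (\<Prod>k<n. expectation (\<lambda>\<omega>. g (r ^ k * infnorm (Y 1 \<omega>)))) \<le> D * (\<Prod>k<n. p k)"
  proof (rule prod_expectation_scaled_le[of "\<lambda>\<omega>. infnorm (Y 1 \<omega>)" r y g "1 / c"])
    show "g x \<le> 1 / c / x" if "0 < x" for x
    proof -
      have "c * x \<le> exp (c * x)" using exp_ge_add_one_self[of "c * x"] by linarith
      then show ?thesis using that c by (simp add: g_def exp_minus field_simps)
    qed
  qed (use infnorm_nonneg r y Y_small g01 in auto)
  define E where "E = exp (t + c' * (1 / (1 - r)))"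
  have "prob {\<omega>\<in>space M. infnorm (branching_process (offspring Psi U) Y0 n \<omega>) \<le> b} \<le> (E * D) * (\<Prod>k<n. p k)" for n
  proof -
    have [measurable]: "random_variable borel (\<lambda>\<omega>. \<theta>' \<bullet> immigrants (Y l \<omega>))" for \<theta>' l
      using immigrants_algebra_measurable by (rule Y_algebra_imp_measurable)
    have L_nonneg: "0 \<le> (law.laplace_exponent ^^ k) \<theta> \<bullet> immigrants x" for k x
      using law.funpow_laplace_exponent_nonneg[OF \<theta>, of k] immigrants_nonneg[of x]
      by (auto simp: inner_vec_def nonneg_vec_def intro!: sum_nonneg)
    have Z_nn: "0 \<le> \<theta> \<bullet> Z n \<omega>" for \<omega>
      using Z_nonneg[of xi n \<omega>] \<theta> by (auto simp: inner_vec_def nonneg_vec_def intro!: sum_nonneg)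
    have "prob {\<omega>\<in>space M. infnorm (branching_process (offspring Psi U) Y0 n \<omega>) \<le> b} =
        prob {\<omega>\<in>space M. infnorm (Z n \<omega>) \<le> b}"
      using branching_process_AE by (intro measure_eq_AE) (auto elim!: eventually_mono)
    also have "\<dots> = expectation (indicator {\<omega>\<in>space M. infnorm (Z n \<omega>) \<le> b})" by simp
    \<comment> \<open>Exponential Markov bound: on the event theta.Z_n is at most \<open>t\<close>,
      because theta is r^K u.\<close>
    also have "\<dots> \<le> expectation (\<lambda>\<omega>. exp t * (1 * exp (- (\<theta> \<bullet> Z n \<omega>))))"
    proof (rule integral_mono)
      show "integrable M (\<lambda>\<omega>. exp t * (1 * exp (- (\<theta> \<bullet> Z n \<omega>))))"
        using Z_nn by (intro integrable_mult_right integrable_const_bound[where B=1]) auto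
      fix \<omega>
      show "indicator {\<omega>\<in>space M. infnorm (Z n \<omega>) \<le> b} \<omega> \<le> exp t * (1 * exp (- (\<theta> \<bullet> Z n \<omega>)))"
      proof (cases "infnorm (Z n \<omega>) \<le> b")
        case True
        have "u \<bullet> Z n \<omega> \<le> Cu * b"
          using cu(4)[OF Z_nonneg, of xi n \<omega>] mult_left_mono[OF True, of Cu] cu(2) by linarith
        then have "\<theta> \<bullet> Z n \<omega> \<le> t" using r by (simp add: \<theta>_def t_def mult_left_mono)
        then show ?thesis by (simp add: indicator_def flip: exp_add)
      qed simp
    qed (auto intro!: integrable_const_bound[where B=1])
    also have "\<dots> = exp t * expectation (\<lambda>\<omega>. 1 * exp (- (\<theta> \<bullet> Z n \<omega>)))" by simp
    also have "expectation (\<lambda>\<omega>. 1 * exp (- (\<theta> \<bullet> Z n \<omega>))) =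
        expectation (\<lambda>\<omega>. 1 * (\<Prod>l=1..n. exp (- ((law.laplace_exponent ^^ (n - l)) \<theta> \<bullet> immigrants (Y l \<omega>)))))"
      by (rule expectation_Z) (use \<theta> in auto)
    also have "\<dots> \<le> expectation (\<lambda>\<omega>. exp (c' * (1 / (1 - r))) * (\<Prod>l=1..n. g (r ^ (n - l) * infnorm (Y l \<omega>))))"
    proof (rule integral_mono)
      show "integrable M (\<lambda>\<omega>. 1 * (\<Prod>l=1..n. exp (- ((law.laplace_exponent ^^ (n - l)) \<theta> \<bullet> immigrants (Y l \<omega>)))))"
      proof (rule integrable_const_bound[where B=1])
        show "AE \<omega> in M. norm (1 * (\<Prod>l=1..n. exp (- ((law.laplace_exponent ^^ (n - l)) \<theta> \<bullet> immigrants (Y l \<omega>))))) \<le> 1"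
          using L_nonneg by (intro AE_I2) (simp add: prod_nonneg prod_le_1)
      qed measurable
      show "integrable M (\<lambda>\<omega>. exp (c' * (1 / (1 - r))) * (\<Prod>l=1..n. g (r ^ (n - l) * infnorm (Y l \<omega>))))"
      proof (intro integrable_mult_right integrable_const_bound[where B=1])
        show "AE \<omega> in M. norm (\<Prod>l=1..n. g (r ^ (n - l) * infnorm (Y l \<omega>))) \<le> 1"
          using g01 r infnorm_nonneg by (intro AE_I2) (simp add: abs_prod prod_le_1)
      qed measurable
      fix \<omega> assume w: "\<omega> \<in> space M"
      have step: "exp (- ((law.laplace_exponent ^^ k) \<theta> \<bullet> immigrants (Y l \<omega>))) \<le> exp (c' * r ^ k) * g (r ^ k * infnorm (Y l \<omega>))"
        for k l
      proof -
        have "c * (r ^ k * infnorm (Y l \<omega>)) - c' * r ^ k \<le> r ^ (K + k) / 2 * (u \<bullet> Y l \<omega>) - c' * r ^ k"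
          using mult_left_mono[OF cu(3)[OF Y_nonneg[OF w, of l]], of "r ^ (K + k) / 2"] r
          by (simp add: c_def power_add mult_ac)
        also have "\<dots> = (\<Sum>i\<in>UNIV. (r ^ (K + k) * u $ i / 2) * (Y l \<omega> $ i - 1))"
          by (simp add: inner_vec_def c'_def sum_distrib_left sum_distrib_right sum_divide_distrib
              sum_subtractf[symmetric] power_add diff_divide_distrib algebra_simps)
        also have "\<dots> \<le> (\<Sum>i\<in>UNIV. (r ^ (K + k) * u $ i / 2) * immigrants (Y l \<omega>) $ i)"
          using immigrants_bounds(1)[OF Y_nonneg[OF w]] r u_pos
          by (intro sum_mono mult_left_mono) (simp_all add: less_imp_le)
        also have "\<dots> \<le> (law.laplace_exponent ^^ k) \<theta> \<bullet> immigrants (Y l \<omega>)"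
          unfolding inner_vec_def inner_real_def \<theta>_def using K immigrants_nonneg[of "Y l \<omega>"]
          by (intro sum_mono mult_right_mono) (simp_all add: nonneg_vec_def)
        finally show ?thesis by (simp add: g_def flip: exp_add)
      qed
      have "(\<Prod>l=1..n. exp (- ((law.laplace_exponent ^^ (n - l)) \<theta> \<bullet> immigrants (Y l \<omega>)))) \<le>
          (\<Prod>l=1..n. exp (c' * r ^ (n - l)) * g (r ^ (n - l) * infnorm (Y l \<omega>)))"
        using step by (intro prod_mono) auto
      also have "\<dots> = exp (c' * (\<Sum>l=1..n. r ^ (n - l))) * (\<Prod>l=1..n. g (r ^ (n - l) * infnorm (Y l \<omega>)))"
        by (simp add: prod.distrib exp_sum sum_distrib_left)
      also have "(\<Sum>l=1..n. r ^ (n - l)) = (\<Sum>k<n. r ^ k)"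
        by (rule sum.reindex_bij_witness[of _ "\<lambda>k. n - k" "\<lambda>l. n - l"]) auto
      also have "exp (c' * (\<Sum>k<n. r ^ k)) * (\<Prod>l=1..n. g (r ^ (n - l) * infnorm (Y l \<omega>))) \<le>
          exp (c' * (1 / (1 - r))) * (\<Prod>l=1..n. g (r ^ (n - l) * infnorm (Y l \<omega>)))"
        using sum_geometric_le[OF r, of n] c g01 r infnorm_nonneg
        by (intro mult_right_mono iffD2[OF exp_le_cancel_iff] mult_left_mono prod_nonneg) auto
      finally show "1 * (\<Prod>l=1..n. exp (- ((law.laplace_exponent ^^ (n - l)) \<theta> \<bullet> immigrants (Y l \<omega>)))) \<le>
          exp (c' * (1 / (1 - r))) * (\<Prod>l=1..n. g (r ^ (n - l) * infnorm (Y l \<omega>)))" by simp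
    qed
    also have "\<dots> = exp (c' * (1 / (1 - r))) * (\<Prod>k<n. expectation (\<lambda>\<omega>. g (r ^ k * infnorm (Y 1 \<omega>))))"
    proof -
      have "expectation (\<lambda>\<omega>. \<Prod>l=1..n. g (r ^ (n - l) * infnorm (Y l \<omega>))) =
          (\<Prod>k<n. expectation (\<lambda>\<omega>. g (r ^ k * infnorm (Y 1 \<omega>))))"
        using g01 r by (intro expectation_prod_Y[of "\<lambda>k x. g (r ^ k * infnorm x)"]) (auto simp: infnorm_pos_le)
      then show ?thesis by simp
    qed
    also have "\<dots> \<le> exp (c' * (1 / (1 - r))) * (D * (\<Prod>k<n. p k))"
      by (intro mult_left_mono D) simp
    finally show ?thesis by (simp add: E_def exp_add mult.assoc)
  qed
  moreover have "0 < E * D" using D by (simp add: E_def)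
  ultimately show "\<exists>D>0. \<forall>n. prob {\<omega>\<in>space M. infnorm (branching_process (offspring Psi U) Y0 n \<omega>) \<le> b} \<le> D * (\<Prod>k<n. p k)"
    by blast
qed

end

theorem theorem3:
  fixes M :: "'w measure"
    and A :: "nat \<Rightarrow> 'w \<Rightarrow> real^'d^'d"
    and Y :: "nat \<Rightarrow> 'w \<Rightarrow> real^'d"
    and A0 :: "real^'d^'d"
    and y :: real
  defines "XR \<equiv> recurrent M (ar_process A) Y"
    and "MR \<equiv> recurrent M (max_ar_process A) Y"
    and "RC \<equiv> (\<Sum>n. ennreal (\<Prod>m=0..n.
            measure M {\<omega> \<in> space M. infnorm (Y 1 \<omega>) \<le> y * mat_spectral_radius A0 powi (- int m)})) = \<infinity>"
  assumes "autoregressive_setting M A Y"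
    and "primitive_mat A0"
    and "mat_spectral_radius A0 < 1"
    and "AE \<omega> in M. \<forall>n\<ge>1. A n \<omega> = A0"
    and "y > 0"
    and "measure M {\<omega> \<in> space M. infnorm (Y 1 \<omega>) \<le> y} > 0"
  shows "(XR \<longleftrightarrow> MR) \<and> (MR \<longleftrightarrow> RC) \<and>
    (\<forall>F Psi U psi.
       branching_setting M A Y F Psi U \<longrightarrow>
       psi \<in> offspring_fn_families \<longrightarrow>
       (AE \<omega> in M. \<forall>n\<ge>1. Psi n \<omega> = psi) \<longrightarrow>
       (\<forall>i j. (\<integral>\<^sup>+ \<omega>. ennreal (real (offspring Psi U 0 1 1 i j \<omega>) * ln (real (offspring Psi U 0 1 1 i j \<omega>))) \<partial>M) < \<infinity>) \<longrightarrow>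
       (RC \<longleftrightarrow> recurrent M (branching_process (offspring Psi U)) Y))"
proof -
  define r where "r = mat_spectral_radius A0"
  have nn: "nonneg_mat A0" using assms(5) by (simp add: primitive_mat_def)
  obtain u :: "real^'d" and l where u: "\<And>i. 0 < u $ i" and l: "0 < l" and eig: "\<And>z. u \<bullet> (A0 *v z) = l * (u \<bullet> z)"
    using primitive_mat_left_eigenvector[OF assms(5)] by metis
  have r_eq: "r = l" unfolding r_def by (rule spectral_radius_left_eigenvector[OF nn u l eig])
  have r: "0 < r" "r < 1" using l assms(6) by (simp_all add: r_eq[symmetric] r_def)
  interpret constant_matrix_setting M A Y A0 u r y
    using assms(4) nn u r eig assms(7-9)
    by (auto simp: constant_matrix_setting_def constant_matrix_setting_axioms_def r_eq)
  have "measure M {\<omega> \<in> space M. infnorm (Y 1 \<omega>) \<le> y * r powi (- int m)} = p m" for m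
    using r by (simp add: power_int_minus field_simps)
  then have RC: "RC \<longleftrightarrow> (\<Sum>n. ennreal (\<Prod>k<n. p k)) = \<infinity>"
    unfolding RC_def r_def[symmetric] by (simp only: suminf_prod_shift)
  have branching: "RC \<longleftrightarrow> recurrent M (branching_process (offspring Psi U)) Y"
    if "branching_setting M A Y F Psi U" "psi \<in> offspring_fn_families" "AE \<omega> in M. \<forall>n\<ge>1. Psi n \<omega> = psi"
      "\<forall>i j. (\<integral>\<^sup>+ \<omega>. ennreal (real (offspring Psi U 0 1 1 i j \<omega>) * ln (real (offspring Psi U 0 1 1 i j \<omega>))) \<partial>M) < \<infinity>"
    for F Psi U psi
  proof -
    interpret b: deterministic_branching_setting M A Y A0 u r y F Psi U psi
      using that constant_matrix_setting_axioms
      by (simp add: deterministic_branching_setting_def deterministic_branching_setting_axioms_def)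
    show ?thesis
      using b.sum_imp_branching_recurrent b.branching_recurrent_imp_sum RC by blast
  qed
  \<comment> \<open>The implications form a cycle from XR to MR to RC and back to XR.\<close>
  have "XR \<longleftrightarrow> RC" "MR \<longleftrightarrow> RC"
    using ar_recurrent_imp_max_ar_recurrent max_ar_recurrent_imp_sum sum_imp_ar_recurrent
    unfolding XR_def MR_def RC by blast+
  then show ?thesis using branching by blast
qed

end
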